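(* Let $d\ge 1$ and let $(\mathbf A,\mathbf B)$ be a random $d\times d$ matrix and a random vector in $\mathbb R^d$ satisfying Condition (T) (see context), with exponents $\alpha_1,\dots,\alpha_d$ as in (T-4). Let $\mathbf W=(W_1,\dots,W_d)$ be the solution of $\mathbf W\stackrel{d}{=}\mathbf A\mathbf W+\mathbf B$ with $\mathbf W$ independent of $(\mathbf A,\mathbf B)$. Then there exist strictly positive constants $C_1,\dots,C_d$ such that $$\lim_{x\to\infty}x^{\widetilde\alpha_i}\,\mathbb P(W_i>x)=C_i,\qquad i=1,\dots,d,$$ where $\widetilde\alpha_i=\min\{\alpha_j: i\trianglelefteq j\}$.
   Context: Condition (T): (T-1) $\mathbf A\ge 0$ and $\mathbf B\ge 0$ entrywise almost surely; (T-2) $\mathbb P(B_i=0)<1$ for $i=1,\dots,d$; (T-3) $\mathbf A$ is upper triangular, i.e. $\mathbb P(A_{ij}=0)=1$ whenever $i>j$; (T-4) there exist $\alpha_1,\dots,\alpha_d>0$ with $\mathbb E A_{ii}^{\alpha_i}=1$ for all $i$ and $\alpha_i\ne\alpha_j$ for $i\neq j$; (T-5) $\mathbb E A_{ij}^{\alpha_i}<\infty$ for all $i,j\le d$; (T-6) $\mathbb E B_i^{\alpha_i}<\infty$ for all $i$; (T-7) $\mathbb E[A_{ii}^{\alpha_i}\log^+A_{ii}]<\infty$ for all $i$; (T-8) the law of $\log A_{ii}$ conditioned on $\{A_{ii}>0\}$ is non-arithmetic for all $i$. (Under (T) the top Lyapunov exponent of $\mathbf A$ is negative, so the solution $\mathbf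 W$ exists and is unique in law.) A nonnegative random variable $X$ is called positive if $\mathbb P(X>0)>0$. For $i,j\in\{1,\dots,d\}$ write $i\preccurlyeq j$ if $A_{ij}$ is positive, and $i\trianglelefteq j$ if there exist $m\ge 0$ and indices $i=i(0)\le i(1)\le\dots\le i(m)=j$ with $A_{i(k)i(k+1)}$ positive for $k=0,\dots,m-1$ (in particular $i\trianglelefteq i$). *)

theory Defs
  imports "HOL-Probability.Probability"
begin

definition rv_positive :: "'a measure \<Rightarrow> ('a \<Rightarrow> real) \<Rightarrow> bool" where
  "rv_positive M X \<longleftrightarrow> measure M {\<omega> \<in> space M. X \<omega> > 0} > 0"

definition prec_rel :: "'a measure \<Rightarrow> ('a \<Rightarrow> nat \<Rightarrow> nat \<Rightarrow> real) \<Rightarrow> nat \<Rightarrow> nat \<Rightarrow> bool" where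
  "prec_rel M A i j \<longleftrightarrow> rv_positive M (\<lambda>\<omega>. A \<omega> i j)"

definition tri_rel :: "'a measure \<Rightarrow> ('a \<Rightarrow> nat \<Rightarrow> nat \<Rightarrow> real) \<Rightarrow> nat \<Rightarrow> nat \<Rightarrow> bool" where
  "tri_rel M A i j \<longleftrightarrow> (\<exists>(m::nat) (f::nat \<Rightarrow> nat). f 0 = i \<and> f m = j \<and>
      (\<forall>k<m. f k \<le> f (Suc k) \<and> prec_rel M A (f k) (f (Suc k))))"

text \<open>The law of log X conditioned on {X > 0} is non-arithmetic: it is not concentrated
  on any lattice h\<int> with h > 0.\<close>
definition log_nonarithmetic :: "'a measure \<Rightarrow> ('a \<Rightarrow> real) \<Rightarrow> bool" where
  "log_nonarithmetic M X \<longleftrightarrow>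
     \<not> (\<exists>h>0. AE \<omega> in M. X \<omega> > 0 \<longrightarrow> ln (X \<omega>) \<in> range (\<lambda>k::int. h * of_int k))"

definition condition_T :: "'a measure \<Rightarrow> nat \<Rightarrow> ('a \<Rightarrow> nat \<Rightarrow> nat \<Rightarrow> real) \<Rightarrow> ('a \<Rightarrow> nat \<Rightarrow> real)
      \<Rightarrow> (nat \<Rightarrow> real) \<Rightarrow> bool" where
  "condition_T M d A B \<alpha> \<longleftrightarrow>
    \<comment> \<open>(T-1)\<close>
    (\<forall>i\<in>{1..d}. \<forall>j\<in>{1..d}. AE \<omega> in M. A \<omega> i j \<ge> 0) \<and>
    (\<forall>i\<in>{1..d}. AE \<omega> in M. B \<omega> i \<ge> 0) \<and>
    \<comment> \<open>(T-2)\<close>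
    (\<forall>i\<in>{1..d}. measure M {\<omega> \<in> space M. B \<omega> i = 0} < 1) \<and>
    \<comment> \<open>(T-3)\<close>
    (\<forall>i\<in>{1..d}. \<forall>j\<in>{1..d}. i > j \<longrightarrow> measure M {\<omega> \<in> space M. A \<omega> i j = 0} = 1) \<and>
    \<comment> \<open>(T-4)\<close>
    (\<forall>i\<in>{1..d}. \<alpha> i > 0 \<and> integrable M (\<lambda>\<omega>. A \<omega> i i powr \<alpha> i)
        \<and> integral\<^sup>L M (\<lambda>\<omega>. A \<omega> i i powr \<alpha> i) = 1) \<and>
    inj_on \<alpha> {1..d} \<and>
    \<comment> \<open>(T-5)\<close>
    (\<forall>i\<in>{1..d}. \<forall>j\<in>{1..d}. integrable M (\<lambda>\<omega>. A \<omega> i j powr \<alpha> i)) \<and>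
    \<comment> \<open>(T-6)\<close>
    (\<forall>i\<in>{1..d}. integrable M (\<lambda>\<omega>. B \<omega> i powr \<alpha> i)) \<and>
    \<comment> \<open>(T-7)\<close>
    (\<forall>i\<in>{1..d}. integrable M (\<lambda>\<omega>. A \<omega> i i powr \<alpha> i * max 0 (ln (A \<omega> i i)))) \<and>
    \<comment> \<open>(T-8)\<close>
    (\<forall>i\<in>{1..d}. log_nonarithmetic M (\<lambda>\<omega>. A \<omega> i i))"

end

theory Submission
  imports Defs
begin

text \<open>
  If \<open>\<alpha> i\<close> is minimal among the exponents reachable from \<open>i\<close>, then
  \<open>f t = e\<^sup>\<alpha>\<^sup>t P(W\<^sub>i > e\<^sup>t)\<close> solves a renewal equation \<open>f = f * \<eta> + g\<close> for the law \<open>\<eta>\<close> of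
  \<open>ln A\<^sub>i\<^sub>i\<close> tilted by \<open>A\<^sub>i\<^sub>i\<^sup>\<alpha>\<close>, with \<open>g \<ge> 0\<close> integrable and not a.e. zero. A maximum principle for the
  partial sums of the renewal measure shows that \<open>f\<close> is bounded. Let \<open>\<phi>\<close> be a sliding average of \<open>f\<close>.
  Integrating \<open>\<phi>\<^sup>2 * \<eta> - \<phi>\<^sup>2\<close> over a half line bounds the energy
  \<open>\<integral>\<integral> (\<phi>(t - s) - \<phi>(t))\<^sup>2 \<eta>(ds) dt\<close>, so \<open>\<phi>(t - s) - \<phi>(t)\<close> tends to 0 for \<open>\<eta>\<close>-almost every \<open>s\<close>, and
  then for all real \<open>s\<close> because \<open>\<eta>\<close> is non-arithmetic. The identity
  \<open>\<integral> (\<integral>\<^sub>T\<^sub>-\<^sub>s\<^sup>T \<phi>) \<eta>(ds) = \<integral>\<^sub>-\<^sub>\<infinity>\<^sup>T (\<phi> - \<phi> * \<eta>)\<close> then identifies the limit of \<open>\<phi>\<close>,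
  and monotonicity of the tail gives the limit of \<open>f\<close>.

  If the minimum \<open>\<alpha>\<close> is attained at another index, consider for non-negative row vectors \<open>p\<close> the upper and
  lower limits \<open>U p\<close> and \<open>L p\<close> of \<open>x\<^sup>\<alpha> P(p \<cdot> W > x)\<close>. By Fatou \<open>U p \<le> E U(p A)\<close> and \<open>E L(p A) \<le> L p\<close>,
  while \<open>U p \<le> (1 - \<delta>)\<^sup>-\<^sup>\<alpha> L p + c p\<^sub>i\<^sup>\<alpha>\<close> as soon as the limits exist for vectors supported beyond \<open>i\<close>. Iterating
  multiplies the error term by powers of \<open>E A\<^sub>i\<^sub>i\<^sup>\<alpha> < 1\<close>, hence \<open>U = L\<close>.
\<close>

section \<open>Renewal equations on the line\<close>

text \<open>The obstacle at a critical index is that \<open>W_i\<close> has no moment of order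
  \<open>\<alpha>\<close>: the limit to be proved makes it infinite. Integrability of
  \<open>g\<close> must come from the probability that \<open>e^t\<close> lies between the diagonal
  term and the whole sum. Its bound mixes a small power of the remaining sum with a power of
  \<open>W_i\<close> strictly below \<open>\<alpha>\<close>, and such moments of \<open>W_i\<close>
  come from \<open>E A_ii^\<beta> < 1\<close> for \<open>\<beta> < \<alpha>\<close>. At any other
  index \<open>E A_ii^\<alpha> < 1\<close>, so there is no tilted probability law to convolve with.
  Cutting the level of \<open>p \<cdot> W\<close> costs a factor
  \<open>(1 - \<delta>)^-\<alpha>\<close>; paid in every iteration it would blow up. Hence the cut
  is made once, and afterwards the inequality is only averaged over \<open>A\<close>. Two facts are
  not among the hypotheses: \<open>W \<ge> 0\<close> almost surely, obtained by iterating the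
  equation for the negative part, and the positivity of the constants, which is carried back from
  the minimising index along a path of positive entries.\<close>

definition step_conv :: "real measure \<Rightarrow> (real \<Rightarrow> ennreal) \<Rightarrow> real \<Rightarrow> ennreal" where
  "step_conv \<eta> \<phi> t = (\<integral>\<^sup>+s. \<phi> (t - s) \<partial>\<eta>)"

section \<open>Renewal sums and a bound for solutions of the renewal equation\<close>

locale step_law = prob_space \<eta> for \<eta> :: "real measure" +
  assumes sets_eta [measurable_cong]: "sets \<eta> = sets borel"
begin

lemma space_eta [simp]: "space \<eta> = UNIV"
  using sets_eq_imp_space_eq[OF sets_eta] by simp

sublocale lborel_eta: pair_sigma_finite lborel \<eta> ..

lemma measurable_step_conv [measurable]:
  assumes [measurable]: "\<phi> \<in> borel_measurable borel"
  shows "step_conv \<eta> \<phi> \<in> borel_measurable borel"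
  unfolding step_conv_def by measurable

lemma step_conv_mono: "(\<And>t. \<phi> t \<le> \<psi> t) \<Longrightarrow> step_conv \<eta> \<phi> t \<le> step_conv \<eta> \<psi> t"
  unfolding step_conv_def by (rule nn_integral_mono)

text \<open>Both sides are the triple convolution of \<open>h\<close>, \<open>\<eta>\<close> and
  \<open>\<phi>\<close> at \<open>t\<close>; translation invariance of \<open>lborel\<close> moves
  the shift by \<open>s\<close> from one factor to the other. With values in \<open>ennreal\<close>,
  Tonelli applies without integrability.\<close>

lemma step_conv_adjoint:
  assumes [measurable]: "h \<in> borel_measurable borel" "\<phi> \<in> borel_measurable borel"
  shows "(\<integral>\<^sup>+r. step_conv \<eta> h (t - r) * \<phi> r \<partial>lborel) = (\<integral>\<^sup>+r. h (t - r) * step_conv \<eta> \<phi> r \<partial>lborel)"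
proof -
  have "(\<integral>\<^sup>+r. step_conv \<eta> h (t - r) * \<phi> r \<partial>lborel) = (\<integral>\<^sup>+r. \<integral>\<^sup>+s. h (t - r - s) * \<phi> r \<partial>\<eta> \<partial>lborel)"
    unfolding step_conv_def by (intro nn_integral_cong) (simp add: nn_integral_multc)
  also have "\<dots> = (\<integral>\<^sup>+s. \<integral>\<^sup>+r. h (t - r - s) * \<phi> r \<partial>lborel \<partial>\<eta>)"
    by (rule lborel_eta.Fubini'[symmetric]) measurable
  also have "\<dots> = (\<integral>\<^sup>+s. \<integral>\<^sup>+r. h (t - r) * \<phi> (r - s) \<partial>lborel \<partial>\<eta>)"
  proof (rule nn_integral_cong)
    fix s
    show "(\<integral>\<^sup>+r. h (t - r - s) * \<phi> r \<partial>lborel) = (\<integral>\<^sup>+r. h (t - r) * \<phi> (r - s) \<partial>lborel)"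
      by (subst nn_integral_real_affine[where c=1 and t="-s"]) (simp_all add: algebra_simps)
  qed
  also have "\<dots> = (\<integral>\<^sup>+r. \<integral>\<^sup>+s. h (t - r) * \<phi> (r - s) \<partial>\<eta> \<partial>lborel)"
    by (rule lborel_eta.Fubini') measurable
  also have "\<dots> = (\<integral>\<^sup>+r. h (t - r) * step_conv \<eta> \<phi> r \<partial>lborel)"
    unfolding step_conv_def by (intro nn_integral_cong) (simp add: nn_integral_cmult)
  finally show ?thesis .
qed

text \<open>Exponentials are eigenfunctions of the convolution, with the Laplace transform of
  \<open>\<eta>\<close> as eigenvalue. An \<open>N\<close>-fold convolution tested against one
  therefore produces the \<open>N\<close>-th power of that value.\<close>

lemma step_conv_exp:
  "step_conv \<eta> (\<lambda>t. ennreal (exp (\<kappa> * t))) t = ennreal (exp (\<kappa> * t)) * (\<integral>\<^sup>+s. ennreal (exp (- \<kappa> * s)) \<partial>\<eta>)"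
  unfolding step_conv_def
  by (subst nn_integral_cmult[symmetric])
     (auto intro!: nn_integral_cong simp: ennreal_mult[symmetric] exp_add[symmetric] algebra_simps)

lemma measurable_step_conv_funpow [measurable]:
  "h \<in> borel_measurable borel \<Longrightarrow> (step_conv \<eta> ^^ N) h \<in> borel_measurable borel"
  by (induction N) auto

lemma step_conv_funpow_adjoint_exp:
  assumes [measurable]: "h \<in> borel_measurable borel"
  shows "(\<integral>\<^sup>+r. (step_conv \<eta> ^^ N) h (t - r) * ennreal (exp (\<kappa> * r)) \<partial>lborel)
    = (\<integral>\<^sup>+s. ennreal (exp (- \<kappa> * s)) \<partial>\<eta>) ^ N * (\<integral>\<^sup>+r. h (t - r) * ennreal (exp (\<kappa> * r)) \<partial>lborel)"
proof (induction N)
  case (Suc N)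
  have "(\<integral>\<^sup>+r. (step_conv \<eta> ^^ Suc N) h (t - r) * ennreal (exp (\<kappa> * r)) \<partial>lborel)
      = (\<integral>\<^sup>+r. (step_conv \<eta> ^^ N) h (t - r) * step_conv \<eta> (\<lambda>t. ennreal (exp (\<kappa> * t))) r \<partial>lborel)"
    by (simp add: step_conv_adjoint)
  also have "\<dots> = (\<integral>\<^sup>+r. (\<integral>\<^sup>+s. ennreal (exp (- \<kappa> * s)) \<partial>\<eta>) * ((step_conv \<eta> ^^ N) h (t - r) * ennreal (exp (\<kappa> * r))) \<partial>lborel)"
    unfolding step_conv_exp by (simp add: mult_ac)
  also have "\<dots> = (\<integral>\<^sup>+s. ennreal (exp (- \<kappa> * s)) \<partial>\<eta>) * (\<integral>\<^sup>+r. (step_conv \<eta> ^^ N) h (t - r) * ennreal (exp (\<kappa> * r)) \<partial>lborel)"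
    by (rule nn_integral_cmult) measurable
  finally show ?case
    using Suc by (simp add: mult_ac)
qed simp

text \<open>The renewal equation is substituted into itself \<open>N\<close> times and tested
  against \<open>h\<close>. The convolutions fall on \<open>h\<close>, so \<open>G\<close> is
  weighed by partial sums of the renewal measure and the error by the \<open>N\<close>-fold
  convolution of \<open>h\<close>.\<close>

lemma renewal_sum_adjoint:
  assumes [measurable]: "h \<in> borel_measurable borel" "F \<in> borel_measurable borel" "G \<in> borel_measurable borel"
    and eq: "\<And>t. F t = step_conv \<eta> F t + G t"
  shows "(\<integral>\<^sup>+r. h (t - r) * F r \<partial>lborel)
    = (\<integral>\<^sup>+r. (\<Sum>k<N. (step_conv \<eta> ^^ k) h (t - r)) * G r \<partial>lborel)
      + (\<integral>\<^sup>+r. (step_conv \<eta> ^^ N) h (t - r) * F r \<partial>lborel)"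
proof (induction N)
  case (Suc N)
  have "(\<integral>\<^sup>+r. (step_conv \<eta> ^^ N) h (t - r) * F r \<partial>lborel)
     = (\<integral>\<^sup>+r. (step_conv \<eta> ^^ N) h (t - r) * step_conv \<eta> F r + (step_conv \<eta> ^^ N) h (t - r) * G r \<partial>lborel)"
    by (subst eq) (simp add: distrib_left)
  also have "\<dots> = (\<integral>\<^sup>+r. (step_conv \<eta> ^^ N) h (t - r) * step_conv \<eta> F r \<partial>lborel)
      + (\<integral>\<^sup>+r. (step_conv \<eta> ^^ N) h (t - r) * G r \<partial>lborel)"
    by (rule nn_integral_add) measurable
  also have "(\<integral>\<^sup>+r. (step_conv \<eta> ^^ N) h (t - r) * step_conv \<eta> F r \<partial>lborel)
      = (\<integral>\<^sup>+r. (step_conv \<eta> ^^ Suc N) h (t - r) * F r \<partial>lborel)"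
    by (simp add: step_conv_adjoint)
  finally have *: "(\<integral>\<^sup>+r. (step_conv \<eta> ^^ N) h (t - r) * F r \<partial>lborel) = 
      (\<integral>\<^sup>+r. (step_conv \<eta> ^^ Suc N) h (t - r) * F r \<partial>lborel) + (\<integral>\<^sup>+r. (step_conv \<eta> ^^ N) h (t - r) * G r \<partial>lborel)" .
  have "(\<integral>\<^sup>+r. (\<Sum>k<Suc N. (step_conv \<eta> ^^ k) h (t - r)) * G r \<partial>lborel)
     = (\<integral>\<^sup>+r. (\<Sum>k<N. (step_conv \<eta> ^^ k) h (t - r)) * G r \<partial>lborel) + (\<integral>\<^sup>+r. (step_conv \<eta> ^^ N) h (t - r) * G r \<partial>lborel)"
    unfolding sum.lessThan_Suc distrib_right by (rule nn_integral_add) measurable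
  with * Suc show ?case by (simp add: add_ac)
qed simp

lemma renewal_sum_Suc:
  assumes [measurable]: "h \<in> borel_measurable borel"
  shows "(\<Sum>k<Suc N. (step_conv \<eta> ^^ k) h t) = h t + step_conv \<eta> (\<lambda>t. \<Sum>k<N. (step_conv \<eta> ^^ k) h t) t"
proof -
  have "step_conv \<eta> (\<lambda>t. \<Sum>k<N. (step_conv \<eta> ^^ k) h t) t = (\<Sum>k<N. step_conv \<eta> ((step_conv \<eta> ^^ k) h) t)"
    unfolding step_conv_def[of _ "(\<lambda>t. \<Sum>k<N. (step_conv \<eta> ^^ k) h t)"] step_conv_def[of _ "(step_conv \<eta> ^^ _) h"]
    by (rule nn_integral_sum) measurable
  then show ?thesis
    unfolding sum.lessThan_Suc_shift by simp
qed

text \<open>Maximum principle: off the support of \<open>h\<close> the partial sum at stage \<open>N + 1\<close> is an average of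
  its values at stage \<open>N\<close>, so it is controlled by its values on the support of \<open>h\<close>.\<close>
lemma renewal_sum_bounded:
  fixes \<theta> \<rho> :: real
  assumes \<theta>: "0 < \<theta>" and \<rho>: "(\<integral>\<^sup>+s. ennreal (exp (- \<theta> * s)) \<partial>\<eta>) \<le> ennreal \<rho>" "0 \<le> \<rho>" "\<rho> < 1"
  shows "(\<Sum>k<N. (step_conv \<eta> ^^ k) (indicator {0..1}) t) \<le> ennreal (exp \<theta> / (1 - \<rho>))"
proof -
  \<comment> \<open>The exponential is a supersolution: \<open>exp (\<theta> t) + \<rho> exp
    (\<theta> t) / (1 - \<rho>) = exp (\<theta> t) / (1 - \<rho>)\<close>. The bound grows with
    \<open>t\<close>, but on \<open>{0..1}\<close>, where the maximum principle needs it, it is at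
    most \<open>exp \<theta> / (1 - \<rho>)\<close>.\<close>
  have exp_bound: "(\<Sum>k<N. (step_conv \<eta> ^^ k) (indicator {0..1}) t) \<le> ennreal (exp (\<theta> * t) / (1 - \<rho>))" for N t
  proof (induction N arbitrary: t)
    case (Suc N)
    have "step_conv \<eta> (\<lambda>t. \<Sum>k<N. (step_conv \<eta> ^^ k) (indicator {0..1}) t) t
       \<le> step_conv \<eta> (\<lambda>t. ennreal (exp (\<theta> * t) / (1 - \<rho>))) t"
      by (rule step_conv_mono) (rule Suc)
    also have "\<dots> = ennreal (1 / (1 - \<rho>)) * step_conv \<eta> (\<lambda>t. ennreal (exp (\<theta> * t))) t"
      unfolding step_conv_def using \<rho>
      by (subst nn_integral_cmult[symmetric]) (auto simp: ennreal_mult[symmetric] divide_inverse mult_ac)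
    also have "\<dots> \<le> ennreal (1 / (1 - \<rho>)) * (ennreal (exp (\<theta> * t)) * ennreal \<rho>)"
      unfolding step_conv_exp by (intro mult_left_mono \<rho>) auto
    also have "\<dots> = ennreal (exp (\<theta> * t) * \<rho> / (1 - \<rho>))"
      using \<rho> by (simp add: ennreal_mult[symmetric] divide_inverse mult_ac)
    finally have 1: "step_conv \<eta> (\<lambda>t. \<Sum>k<N. (step_conv \<eta> ^^ k) (indicator {0..1}) t) t
        \<le> ennreal (exp (\<theta> * t) * \<rho> / (1 - \<rho>))" .
    have 2: "indicator {0..1} t \<le> ennreal (exp (\<theta> * t))"
      using \<theta> by (auto simp: indicator_def)
    have "(\<Sum>k<Suc N. (step_conv \<eta> ^^ k) (indicator {0..1}) t)
       \<le> ennreal (exp (\<theta> * t)) + ennreal (exp (\<theta> * t) * \<rho> / (1 - \<rho>))"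
      by (subst renewal_sum_Suc) (auto intro!: add_mono 1 2)
    also have "\<dots> = ennreal (exp (\<theta> * t) / (1 - \<rho>))"
      using \<rho> by (subst ennreal_plus[symmetric]) (auto simp: field_simps)
    finally show ?case .
  qed auto
  show ?thesis
  proof (induction N arbitrary: t)
    case (Suc N)
    show ?case
    proof (cases "t \<in> {0..1}")
      case True
      have "ennreal (exp (\<theta> * t) / (1 - \<rho>)) \<le> ennreal (exp \<theta> / (1 - \<rho>))"
        using True \<theta> \<rho> by (intro ennreal_leI divide_right_mono) auto
      with exp_bound show ?thesis by (rule order_trans)
    next
      case False
      have "(\<Sum>k<Suc N. (step_conv \<eta> ^^ k) (indicator {0..1}) t)
         = step_conv \<eta> (\<lambda>t. \<Sum>k<N. (step_conv \<eta> ^^ k) (indicator {0..1}) t) t"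
        using False by (subst renewal_sum_Suc) auto
      also have "\<dots> \<le> step_conv \<eta> (\<lambda>t. ennreal (exp \<theta> / (1 - \<rho>))) t"
        by (rule step_conv_mono) (rule Suc)
      also have "\<dots> = ennreal (exp \<theta> / (1 - \<rho>))"
        unfolding step_conv_def by (simp add: emeasure_space_1[simplified])
      finally show ?thesis .
    qed
  qed auto
qed

text \<open>Averaging over \<open>{t-1..t}\<close> and iterating the equation \<open>N\<close> times
  leaves two terms. The first is bounded by the maximum principle. In the second, \<open>f\<close>
  is replaced by \<open>\<delta> exp (\<alpha> r) + K exp (\<theta> r)\<close>: the transform at
  \<open>\<alpha>\<close> is at most 1, so the \<open>\<delta>\<close> part stays of size
  \<open>\<delta> exp (\<alpha> t)\<close>, and the \<open>K\<close> part picks up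
  \<open>\<rho> ^ N\<close>. Letting \<open>N\<close> grow and then \<open>\<delta>\<close> vanish
  removes both.\<close>

lemma renewal_solution_bounded:
  fixes f g :: "real \<Rightarrow> real" and \<alpha> \<theta> \<rho> :: real
  assumes [measurable]: "f \<in> borel_measurable borel" "g \<in> borel_measurable borel"
    and f0: "\<And>t. 0 \<le> f t" and g0: "\<And>t. 0 \<le> g t" and g: "integrable lborel g"
    and eq: "\<And>t. ennreal (f t) = step_conv \<eta> (\<lambda>t. ennreal (f t)) t + ennreal (g t)"
    and \<alpha>: "0 < \<alpha>" "(\<integral>\<^sup>+s. ennreal (exp (- \<alpha> * s)) \<partial>\<eta>) \<le> 1"
    and \<theta>: "0 < \<theta>" and \<rho>: "(\<integral>\<^sup>+s. ennreal (exp (- \<theta> * s)) \<partial>\<eta>) \<le> ennreal \<rho>" "0 \<le> \<rho>" "\<rho> < 1"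
    and mono: "\<And>r t. r \<le> t \<Longrightarrow> f t * exp (- \<alpha> * (t - r)) \<le> f r"
    and decay: "\<And>\<delta>. 0 < \<delta> \<Longrightarrow> \<exists>K\<ge>0. \<forall>r. f r \<le> \<delta> * exp (\<alpha> * r) + K * exp (\<theta> * r)"
  shows "f t \<le> exp \<alpha> * (exp \<theta> / (1 - \<rho>) * (\<integral>r. g r \<partial>lborel))"
proof -
  define C where "C = exp \<theta> / (1 - \<rho>)"
  define I where "I = (\<integral>r. g r \<partial>lborel)"
  have C0: "0 \<le> C" using \<rho> by (auto simp: C_def)
  have I0: "0 \<le> I" unfolding I_def using g0 by (intro integral_nonneg_AE) auto
  have Inn: "(\<integral>\<^sup>+r. ennreal (g r) \<partial>lborel) = ennreal I"
    unfolding I_def using g g0 by (intro nn_integral_eq_integral) auto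
  define h :: "real \<Rightarrow> ennreal" where "h = indicator {0..1}"
  have [measurable]: "h \<in> borel_measurable borel" by (simp add: h_def)
  have hexp: "(\<integral>\<^sup>+r. h (t - r) * ennreal (exp (\<kappa> * r)) \<partial>lborel) \<le> ennreal (exp (\<kappa> * t))" if "0 < \<kappa>" for \<kappa>
  proof -
    have "(\<integral>\<^sup>+r. h (t - r) * ennreal (exp (\<kappa> * r)) \<partial>lborel) \<le> (\<integral>\<^sup>+r. ennreal (exp (\<kappa> * t)) * indicator {t-1..t} r \<partial>lborel)"
      using that by (intro nn_integral_mono) (auto simp: h_def indicator_def)
    also have "\<dots> = ennreal (exp (\<kappa> * t))" by (simp add: nn_integral_cmult)
    finally show ?thesis .
  qed
  \<comment> \<open>Since \<open>exp (- \<alpha> t) f t\<close> decreases, \<open>f\<close> on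
    \<open>{t-1..t}\<close> is nowhere smaller than \<open>exp (- \<alpha>) f t\<close>.\<close>
  have low: "ennreal (f t * exp (- \<alpha>)) \<le> (\<integral>\<^sup>+r. h (t - r) * ennreal (f r) \<partial>lborel)"
  proof -
    have "ennreal (f t * exp (- \<alpha>)) = (\<integral>\<^sup>+r. ennreal (f t * exp (- \<alpha>)) * indicator {t-1..t} r \<partial>lborel)"
      by (simp add: nn_integral_cmult)
    also have "\<dots> \<le> (\<integral>\<^sup>+r. h (t - r) * ennreal (f r) \<partial>lborel)"
    proof (intro nn_integral_mono)
      fix r
      have "f t * exp (- \<alpha>) \<le> f r" if "t - 1 \<le> r" "r \<le> t"
      proof -
        have "f t * exp (- \<alpha>) \<le> f t * exp (- \<alpha> * (t - r))"
          using that \<alpha> f0 by (intro mult_left_mono) (auto simp: mult_le_cancel_left1)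
        also have "\<dots> \<le> f r" using that mono by auto
        finally show ?thesis .
      qed
      then show "ennreal (f t * exp (- \<alpha>)) * indicator {t-1..t} r \<le> h (t - r) * ennreal (f r)"
        by (auto simp: h_def indicator_def intro!: ennreal_leI)
    qed
    finally show ?thesis .
  qed
  have key: "f t * exp (- \<alpha>) \<le> C * I + (\<delta> * exp (\<alpha> * t) + K * \<rho> ^ N * exp (\<theta> * t))"
    if \<delta>: "0 < \<delta>" and K: "0 \<le> K" "\<forall>r. f r \<le> \<delta> * exp (\<alpha> * r) + K * exp (\<theta> * r)" for \<delta> K N
  proof -
    let ?hN = "(step_conv \<eta> ^^ N) h"
    have "(\<integral>\<^sup>+r. (\<Sum>k<N. (step_conv \<eta> ^^ k) h (t - r)) * ennreal (g r) \<partial>lborel) \<le> (\<integral>\<^sup>+r. ennreal C * ennreal (g r) \<partial>lborel)"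
      unfolding h_def C_def using \<theta> \<rho> by (intro nn_integral_mono mult_right_mono renewal_sum_bounded) auto
    also have "\<dots> = ennreal (C * I)"
      using C0 I0 by (simp add: nn_integral_cmult Inn ennreal_mult)
    finally have 1: "(\<integral>\<^sup>+r. (\<Sum>k<N. (step_conv \<eta> ^^ k) h (t - r)) * ennreal (g r) \<partial>lborel) \<le> ennreal (C * I)" .
    have "(\<integral>\<^sup>+r. ?hN (t - r) * ennreal (f r) \<partial>lborel)
       \<le> (\<integral>\<^sup>+r. ennreal \<delta> * (?hN (t - r) * ennreal (exp (\<alpha> * r))) + ennreal K * (?hN (t - r) * ennreal (exp (\<theta> * r))) \<partial>lborel)"
    proof (intro nn_integral_mono)
      fix r
      have "ennreal (f r) \<le> ennreal \<delta> * ennreal (exp (\<alpha> * r)) + ennreal K * ennreal (exp (\<theta> * r))"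
        using K \<delta> by (simp add: ennreal_mult[symmetric] ennreal_plus[symmetric] ennreal_leI del: ennreal_plus)
      then have "?hN (t - r) * ennreal (f r) \<le> ?hN (t - r) * (ennreal \<delta> * ennreal (exp (\<alpha> * r)) + ennreal K * ennreal (exp (\<theta> * r)))"
        by (rule mult_left_mono) simp
      then show "?hN (t - r) * ennreal (f r) \<le> ennreal \<delta> * (?hN (t - r) * ennreal (exp (\<alpha> * r))) + ennreal K * (?hN (t - r) * ennreal (exp (\<theta> * r)))"
        by (simp add: distrib_left mult_ac)
    qed
    also have "\<dots> = ennreal \<delta> * (\<integral>\<^sup>+r. ?hN (t - r) * ennreal (exp (\<alpha> * r)) \<partial>lborel) + ennreal K * (\<integral>\<^sup>+r. ?hN (t - r) * ennreal (exp (\<theta> * r)) \<partial>lborel)"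
      by (subst nn_integral_add) (auto simp: nn_integral_cmult)
    also have "\<dots> \<le> ennreal \<delta> * (1 ^ N * ennreal (exp (\<alpha> * t))) + ennreal K * (ennreal \<rho> ^ N * ennreal (exp (\<theta> * t)))"
      unfolding step_conv_funpow_adjoint_exp[OF \<open>h \<in> borel_measurable borel\<close>]
      using \<alpha> \<theta> \<rho> hexp[of \<alpha>] hexp[of \<theta>]
      by (intro add_mono mult_mono power_mono order_refl) auto
    also have "\<dots> = ennreal (\<delta> * exp (\<alpha> * t) + K * \<rho> ^ N * exp (\<theta> * t))"
      using \<delta> K \<rho> by (simp add: ennreal_mult[symmetric] ennreal_plus[symmetric] ennreal_power mult_ac del: ennreal_plus)
    finally have 2: "(\<integral>\<^sup>+r. ?hN (t - r) * ennreal (f r) \<partial>lborel) \<le> ennreal (\<delta> * exp (\<alpha> * t) + K * \<rho> ^ N * exp (\<theta> * t))" .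
    have "ennreal (f t * exp (- \<alpha>)) \<le> ennreal (C * I) + ennreal (\<delta> * exp (\<alpha> * t) + K * \<rho> ^ N * exp (\<theta> * t))"
      using low unfolding renewal_sum_adjoint[of h "\<lambda>t. ennreal (f t)" "\<lambda>t. ennreal (g t)" t N, OF _ _ _ eq, simplified]
      by (rule order_trans) (intro add_mono 1 2)
    also have "\<dots> = ennreal (C * I + (\<delta> * exp (\<alpha> * t) + K * \<rho> ^ N * exp (\<theta> * t)))"
      using C0 I0 \<delta> K \<rho> by (intro ennreal_plus[symmetric]) auto
    finally show ?thesis
      using C0 I0 \<delta> K \<rho> by (subst (asm) ennreal_le_iff) auto
  qed
  have key2: "f t * exp (- \<alpha>) \<le> C * I + \<delta> * exp (\<alpha> * t)" if \<delta>: "0 < \<delta>" for \<delta>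
  proof -
    obtain K where K: "0 \<le> K" "\<forall>r. f r \<le> \<delta> * exp (\<alpha> * r) + K * exp (\<theta> * r)" using decay[OF \<delta>] by auto
    have "(\<lambda>N. C * I + (\<delta> * exp (\<alpha> * t) + K * \<rho> ^ N * exp (\<theta> * t))) \<longlonglongrightarrow> C * I + (\<delta> * exp (\<alpha> * t) + K * 0 * exp (\<theta> * t))"
      using \<rho> by (intro tendsto_intros LIMSEQ_power_zero) auto
    then show ?thesis
      using key[OF \<delta> K] by (intro LIMSEQ_le_const[where X="\<lambda>N. C * I + (\<delta> * exp (\<alpha> * t) + K * \<rho> ^ N * exp (\<theta> * t))"]) auto
  qed
  have "f t * exp (- \<alpha>) \<le> C * I"
  proof (rule field_le_epsilon)
    fix e :: real assume "0 < e"
    then show "f t * exp (- \<alpha>) \<le> C * I + e"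
      using key2[of "e * exp (- (\<alpha> * t))"] by (simp add: exp_minus mult.assoc)
  qed
  then show ?thesis
    by (simp add: C_def I_def exp_minus field_simps)
qed

end

section \<open>Limits of Lipschitz solutions\<close>

definition shift_kernel :: "real \<Rightarrow> real \<Rightarrow> real" where
  "shift_kernel s u = indicator {0..<s} u - indicator {s..<0} u"

lemma measurable_shift_kernel [measurable]:
  assumes [measurable]: "f \<in> borel_measurable M" "g \<in> borel_measurable M"
  shows "(\<lambda>x. shift_kernel (f x) (g x)) \<in> borel_measurable M"
proof -
  have "(\<lambda>x. shift_kernel (f x) (g x)) =
     (\<lambda>x. (if 0 \<le> g x \<and> g x < f x then 1 else 0) - (if f x \<le> g x \<and> g x < 0 then 1 else 0))"
    by (auto simp: shift_kernel_def indicator_def fun_eq_iff)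
  also have "\<dots> \<in> borel_measurable M" by measurable
  finally show ?thesis .
qed

text \<open>In this form the integral of \<open>\<psi> (T - u)\<close> against the kernel is a
  difference of two half-line integrals: the oriented integral of \<open>\<psi>\<close> from
  \<open>T - s\<close> to \<open>T\<close>, for either sign of \<open>s\<close>.\<close>

lemma shift_kernel_eq: "shift_kernel s u = indicator {0..} u - indicator {s..} u"
  by (auto simp: shift_kernel_def indicator_def)

lemma integrable_shift_kernel [simp, intro]: "integrable lborel (shift_kernel s)"
  unfolding shift_kernel_def by (cases "0 \<le> s") auto

lemma integral_shift_kernel: "(\<integral>u. shift_kernel s u \<partial>lborel) = s"
  by (cases "0 \<le> s") (auto simp: shift_kernel_def)

lemma integral_abs_shift_kernel: "(\<integral>u. \<bar>shift_kernel s u\<bar> \<partial>lborel) = \<bar>s\<bar>"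
proof (cases "0 \<le> s")
  case True
  then have "(\<lambda>u. \<bar>shift_kernel s u\<bar>) = shift_kernel s" by (auto simp: shift_kernel_def indicator_def fun_eq_iff)
  then show ?thesis using True by (simp add: integral_shift_kernel)
next
  case False
  then have "(\<lambda>u. \<bar>shift_kernel s u\<bar>) = (\<lambda>u. - shift_kernel s u)" by (auto simp: shift_kernel_def indicator_def fun_eq_iff)
  then show ?thesis using False by (simp add: integral_shift_kernel)
qed

lemma integrable_shift_kernel_mult:
  assumes [measurable]: "\<psi> \<in> borel_measurable borel" and B: "\<And>t. \<bar>\<psi> t\<bar> \<le> B"
  shows "integrable lborel (\<lambda>u. \<psi> u * shift_kernel s u)"
    "\<bar>\<integral>u. \<psi> u * shift_kernel s u \<partial>lborel\<bar> \<le> B * \<bar>s\<bar>"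
proof -
  have B0: "0 \<le> B" using B[of 0] by linarith
  have i: "integrable lborel (\<lambda>u. B * \<bar>shift_kernel s u\<bar>)" by auto
  show *: "integrable lborel (\<lambda>u. \<psi> u * shift_kernel s u)"
    by (rule Bochner_Integration.integrable_bound[OF i]) (auto simp: abs_mult B0 intro!: mult_right_mono B)
  have "\<bar>\<integral>u. \<psi> u * shift_kernel s u \<partial>lborel\<bar> \<le> (\<integral>u. B * \<bar>shift_kernel s u\<bar> \<partial>lborel)"
    using i by (intro order_trans[OF integral_abs_bound] integral_mono integrable_abs *) (auto simp: abs_mult B0 intro!: mult_right_mono B)
  then show "\<bar>\<integral>u. \<psi> u * shift_kernel s u \<partial>lborel\<bar> \<le> B * \<bar>s\<bar>"
    by (simp add: integral_abs_shift_kernel)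
qed

text \<open>A closed subgroup of the line is a lattice or everything. If the positive elements stay
  above some \<open>e > 0\<close>, their infimum belongs to the group and generates it by division
  with remainder; otherwise the multiples of arbitrarily small elements are dense. The trivial group
  lies in any lattice.\<close>

lemma closed_subgroup_real_UNIV:
  fixes P :: "real set"
  assumes 0: "0 \<in> P" and diff: "\<And>x y. x \<in> P \<Longrightarrow> y \<in> P \<Longrightarrow> x - y \<in> P" and cl: "closed P"
    and nl: "\<And>h. 0 < h \<Longrightarrow> \<not> P \<subseteq> range (\<lambda>k::int. h * of_int k)"
  shows "P = UNIV"
proof -
  have neg: "- x \<in> P" if "x \<in> P" for x using diff[OF 0 that] by simp
  have add: "x + y \<in> P" if "x \<in> P" "y \<in> P" for x y using diff[OF that(1) neg[OF that(2)]] by simp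
  have mulnat: "of_nat k * x \<in> P" if "x \<in> P" for k :: nat and x
    by (induction k) (auto simp: distrib_right 0 intro: add that)
  have mul: "of_int k * x \<in> P" if "x \<in> P" for k :: int and x
  proof (cases "0 \<le> k")
    case True then show ?thesis using mulnat[OF that, of "nat k"] by simp
  next
    case False then show ?thesis using neg[OF mulnat[OF that, of "nat (- k)"]] by simp
  qed
  have rem: "\<bar>x - of_int \<lfloor>x / p\<rfloor> * p\<bar> < p" "0 \<le> x - of_int \<lfloor>x / p\<rfloor> * p" if "0 < p" for x p :: real
  proof -
    have "of_int \<lfloor>x / p\<rfloor> \<le> x / p" "x / p < of_int \<lfloor>x / p\<rfloor> + 1" by linarith+
    then have "of_int \<lfloor>x / p\<rfloor> * p \<le> x" "x < (of_int \<lfloor>x / p\<rfloor> + 1) * p"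
      unfolding pos_le_divide_eq[OF that] pos_divide_less_eq[OF that] by simp_all
    then show "\<bar>x - of_int \<lfloor>x / p\<rfloor> * p\<bar> < p" "0 \<le> x - of_int \<lfloor>x / p\<rfloor> * p"
      by (simp_all add: algebra_simps)
  qed
  have small: "\<exists>p\<in>P. 0 < p \<and> p < e" if e: "0 < e" for e
  proof (rule ccontr)
    assume no: "\<not> ?thesis"
    \<comment> \<open>Under the assumption \<open>Q\<close> consists of all positive elements;
      written as an intersection with \<open>{e..}\<close> it is closed, so its infimum is
      attained.\<close>
    define Q where "Q = P \<inter> {e..}"
    have Qcl: "closed Q" unfolding Q_def using cl by (intro closed_Int) auto
    have Qbdd: "bdd_below Q" unfolding Q_def by (auto intro: bdd_belowI[of _ e])
    have pos: "x \<in> Q" if "x \<in> P" "0 < x" for x using no that unfolding Q_def by (auto simp: not_less)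
    show False
    proof (cases "Q = {}")
      case True
      have "x = 0" if "x \<in> P" for x
        using pos[OF that] pos[OF neg[OF that]] True by (cases "x < 0"; cases "x > 0"; force)
      then have "P \<subseteq> range (\<lambda>k::int. 1 * of_int k)" by (force intro: range_eqI[of _ _ 0])
      with nl[of 1] show False by simp
    next
      case False
      define h where "h = Inf Q"
      have hQ: "h \<in> Q" unfolding h_def by (rule closed_contains_Inf[OF False Qbdd Qcl])
      then have h0: "0 < h" using e by (auto simp: Q_def)
      have "x \<in> range (\<lambda>k::int. h * of_int k)" if "x \<in> P" for x
      proof -
        define y where "y = x - of_int \<lfloor>x / h\<rfloor> * h"
        have yP: "y \<in> P" unfolding y_def using hQ by (intro diff that mul) (auto simp: Q_def)
        have y: "0 \<le> y" "y < h" using rem[OF h0, of x] unfolding y_def by auto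
        have "\<not> 0 < y"
        proof
          assume "0 < y"
          then have "y \<in> Q" using pos yP by auto
          then have "h \<le> y" unfolding h_def using Qbdd by (rule cInf_lower)
          with y show False by simp
        qed
        then have "y = 0" using y by simp
        then show ?thesis unfolding y_def by (intro range_eqI[of _ _ "\<lfloor>x / h\<rfloor>"]) (simp add: mult.commute)
      qed
      with nl[OF h0] show False by blast
    qed
  qed
  have "x \<in> closure P" for x
  proof (subst closure_approachable, intro allI impI)
    fix e :: real assume "0 < e"
    then obtain p where p: "p \<in> P" "0 < p" "p < e" using small by blast
    then show "\<exists>y\<in>P. dist y x < e"
      using rem[OF p(2), of x] mul[OF p(1)] by (intro bexI[of _ "of_int \<lfloor>x / p\<rfloor> * p"]) (auto simp: dist_real_def)
  qed
  then show ?thesis using cl by auto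
qed

text \<open>If \<open>|k t| \<ge> e\<close>, the Lipschitz bound keeps
  \<open>|k| \<ge> e / 2\<close> on the next interval of length \<open>e / (2 L)\<close>, so the
  square has at least a fixed mass \<open>c\<close> to the right of \<open>t\<close>. Far out, the
  remaining mass is smaller than that.\<close>

lemma square_integrable_Lipschitz_tendsto_0:
  fixes k :: "real \<Rightarrow> real"
  assumes lip: "\<And>s t. \<bar>k s - k t\<bar> \<le> L * \<bar>s - t\<bar>" and L: "0 < L"
    and [measurable]: "k \<in> borel_measurable borel"
    and fin: "(\<integral>\<^sup>+t. ennreal ((k t)\<^sup>2) \<partial>lborel) < \<infinity>"
  shows "(k \<longlongrightarrow> 0) at_top"
proof -
  have int: "integrable lborel (\<lambda>t. (k t)\<^sup>2)"
    using fin by (intro integrableI_nonneg) auto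
  have "((\<lambda>y. LBINT x:{..y}. (k x)\<^sup>2) \<longlongrightarrow> (\<integral>x. (k x)\<^sup>2 \<partial>lborel)) at_top"
    unfolding set_lebesgue_integral_def by (rule tendsto_integral_at_top) (use int in auto)
  then have lim: "((\<lambda>y. (LBINT x:{..y}. (k x)\<^sup>2)) \<longlongrightarrow> (\<integral>x. (k x)\<^sup>2 \<partial>lborel)) at_top" .
  show ?thesis
  proof (rule tendstoI)
    fix e :: real assume e: "0 < e"
    define c where "c = (e/2)\<^sup>2 * (e / (2 * L))"
    have c: "0 < c" using e L by (simp add: c_def)
    have "eventually (\<lambda>y. dist (LBINT x:{..y}. (k x)\<^sup>2) (\<integral>x. (k x)\<^sup>2 \<partial>lborel) < c) at_top"
      using lim c by (rule tendstoD)
    then show "eventually (\<lambda>t. dist (k t) 0 < e) at_top"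
    proof eventually_elim
      case (elim t)
      show ?case
      proof (rule ccontr)
        assume "\<not> dist (k t) 0 < e"
        then have ke: "e \<le> \<bar>k t\<bar>" by simp
        define l where "l = e / (2 * L)"
        have l0: "0 < l" using e L by (simp add: l_def)
        have kr: "(e/2)\<^sup>2 \<le> (k r)\<^sup>2" if "t < r" "r \<le> t + l" for r
        proof -
          have "\<bar>k r - k t\<bar> \<le> L * \<bar>r - t\<bar>" by (rule lip)
          also have "\<dots> \<le> L * l" using that L by (intro mult_left_mono) auto
          also have "\<dots> = e / 2" using L by (simp add: l_def)
          finally have "e / 2 \<le> \<bar>k r\<bar>" using ke by linarith
          then have "(e/2)\<^sup>2 \<le> \<bar>k r\<bar>\<^sup>2" using e by (intro power_mono) auto
          then show ?thesis by simp
        qed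
        have "c + (LBINT x:{..t}. (k x)\<^sup>2) = (\<integral>x. (e/2)\<^sup>2 * indicator {t<..t+l} x + indicator {..t} x * (k x)\<^sup>2 \<partial>lborel)"
          unfolding set_lebesgue_integral_def
          using l0 integrable_real_mult_indicator[OF _ int, of "{..t}"]
          by (subst Bochner_Integration.integral_add) (auto simp: c_def l_def mult.commute)
        also have "\<dots> \<le> (\<integral>x. (k x)\<^sup>2 \<partial>lborel)"
        proof (intro integral_mono int Bochner_Integration.integrable_add)
          show "integrable lborel (\<lambda>x. indicator {..t} x * (k x)\<^sup>2)"
            using integrable_real_mult_indicator[OF _ int, of "{..t}"] by (simp add: mult.commute)
          show "integrable lborel (\<lambda>x. (e / 2)\<^sup>2 * indicator {t<..t+l} x)"
            using l0 by (intro integrable_mult_right integrable_real_indicator) auto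
        qed (use l0 kr in \<open>auto simp: indicator_def\<close>)
        finally have "c + (LBINT x:{..t}. (k x)\<^sup>2) \<le> (\<integral>x. (k x)\<^sup>2 \<partial>lborel)" .
        with elim show False by (auto simp: dist_real_def)
      qed
    qed
  qed
qed

lemma nn_integral_indicator_eq_integral:
  fixes \<psi> :: "'b \<Rightarrow> real"
  assumes "integrable M (\<lambda>r. indicator A r * \<psi> r)" "\<And>r. 0 \<le> \<psi> r"
  shows "(\<integral>\<^sup>+r. indicator A r * ennreal (\<psi> r) \<partial>M) = ennreal (\<integral>r. indicator A r * \<psi> r \<partial>M)"
proof -
  have "(\<integral>\<^sup>+r. indicator A r * ennreal (\<psi> r) \<partial>M) = (\<integral>\<^sup>+r. ennreal (indicator A r * \<psi> r) \<partial>M)"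
    by (intro nn_integral_cong) (auto simp: indicator_def)
  also have "\<dots> = ennreal (\<integral>r. indicator A r * \<psi> r \<partial>M)"
    using assms by (intro nn_integral_eq_integral) auto
  finally show ?thesis .
qed

context step_law begin

text \<open>By Fubini the half-line integral of the convolution averages the half-line integrals of
  \<open>\<psi>\<close> up to \<open>T - s\<close>. Passing from \<open>\<psi>\<close> to its
  convolution thus costs only the boundary term \<open>J T s\<close>, bounded uniformly in
  \<open>T\<close> through the first absolute moment of \<open>\<eta>\<close>. The function
  \<open>\<psi>\<close> is general because both a solution and its square are inserted.\<close>

lemma nn_integral_step_conv_atMost:
  fixes \<psi> :: "real \<Rightarrow> real"
  assumes int_eta: "integrable \<eta> (\<lambda>s. s)"
    and [measurable]: "\<psi> \<in> borel_measurable borel" and \<psi>: "\<And>t. 0 \<le> \<psi> t" "\<And>t. \<psi> t \<le> B"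
    and int: "\<And>T. integrable lborel (\<lambda>r. indicator {..T} r * \<psi> r)"
  defines "J \<equiv> \<lambda>T s. (\<integral>u. \<psi> (T - u) * shift_kernel s u \<partial>lborel)"
  shows "integrable \<eta> (J T)"
    "(\<integral>\<^sup>+r. indicator {..T} r * step_conv \<eta> (\<lambda>t. ennreal (\<psi> t)) r \<partial>lborel)
       = ennreal ((\<integral>r. indicator {..T} r * \<psi> r \<partial>lborel) - (\<integral>s. J T s \<partial>\<eta>))"
    "\<bar>\<integral>s. J T s \<partial>\<eta>\<bar> \<le> B * (\<integral>s. \<bar>s\<bar> \<partial>\<eta>)"
    "(\<integral>s. J T s \<partial>\<eta>) \<le> (\<integral>r. indicator {..T} r * \<psi> r \<partial>lborel)"
proof -
  define \<Psi> where "\<Psi> T = (\<integral>r. indicator {..T} r * \<psi> r \<partial>lborel)" for T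
  have \<Psi>0: "0 \<le> \<Psi> T" for T unfolding \<Psi>_def using \<psi> by (intro integral_nonneg_AE) auto
  have absB: "\<bar>\<psi> t\<bar> \<le> B" for t using \<psi>[of t] by auto
  have J_meas [measurable]: "J T \<in> borel_measurable borel"
    unfolding J_def by (rule lborel.borel_measurable_lebesgue_integral) simp
  have Jb: "\<bar>J T s\<bar> \<le> B * \<bar>s\<bar>" for s
    unfolding J_def by (rule integrable_shift_kernel_mult(2)[where \<psi>="\<lambda>u. \<psi> (T - u)"]) (auto simp: absB)
  have B0: "0 \<le> B" using absB[of 0] by linarith
  show Jint: "integrable \<eta> (J T)"
  proof (rule Bochner_Integration.integrable_bound[where f="\<lambda>s. B * s"])
    show "integrable \<eta> (\<lambda>s. B * s)" using int_eta by (rule integrable_mult_right)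
    show "AE s in \<eta>. norm (J T s) \<le> norm (B * s)"
      using Jb by (intro AE_I2) (simp only: real_norm_def abs_mult abs_of_nonneg[OF B0])
  qed measurable
  show Jbb: "\<bar>\<integral>s. J T s \<partial>\<eta>\<bar> \<le> B * (\<integral>s. \<bar>s\<bar> \<partial>\<eta>)"
  proof -
    have "\<bar>\<integral>s. J T s \<partial>\<eta>\<bar> \<le> (\<integral>s. B * \<bar>s\<bar> \<partial>\<eta>)"
      by (intro order_trans[OF integral_abs_bound] integral_mono integrable_abs Jint integrable_mult_right int_eta Jb)
    then show ?thesis by simp
  qed
  have refl: "\<Psi> (T - s) = (\<integral>u. indicator {s..} u * \<psi> (T - u) \<partial>lborel)"
       "integrable lborel (\<lambda>u. indicator {s..} u * \<psi> (T - u))" for s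
  proof -
    have ind: "indicator {..T - s} (T - u) = (indicator {s..} u :: real)" for u by (auto simp: indicator_def)
    show "\<Psi> (T - s) = (\<integral>u. indicator {s..} u * \<psi> (T - u) \<partial>lborel)"
      unfolding \<Psi>_def by (subst lborel_integral_real_affine[where c="-1" and t=T]) (auto simp: ind)
    show "integrable lborel (\<lambda>u. indicator {s..} u * \<psi> (T - u))"
      using lborel_integrable_real_affine[OF int[of "T - s"], of "-1" T] by (simp add: ind)
  qed
  have diff: "\<Psi> (T - s) = \<Psi> T - J T s" for s
  proof -
    have "J T s = (\<integral>u. indicator {0..} u * \<psi> (T - u) - indicator {s..} u * \<psi> (T - u) \<partial>lborel)"
      unfolding J_def shift_kernel_eq by (simp add: algebra_simps)
    also have "\<dots> = \<Psi> T - \<Psi> (T - s)"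
      using refl[of 0] refl[of s] by (subst Bochner_Integration.integral_diff) auto
    finally show ?thesis by simp
  qed
  have "(\<integral>\<^sup>+r. indicator {..T} r * step_conv \<eta> (\<lambda>t. ennreal (\<psi> t)) r \<partial>lborel)
      = (\<integral>\<^sup>+r. \<integral>\<^sup>+s. indicator {..T} r * ennreal (\<psi> (r - s)) \<partial>\<eta> \<partial>lborel)"
    unfolding step_conv_def by (intro nn_integral_cong nn_integral_cmult[symmetric]) auto
  also have "\<dots> = (\<integral>\<^sup>+s. \<integral>\<^sup>+r. indicator {..T} r * ennreal (\<psi> (r - s)) \<partial>lborel \<partial>\<eta>)"
    by (rule lborel_eta.Fubini'[symmetric]) measurable
  also have "\<dots> = (\<integral>\<^sup>+s. ennreal (\<Psi> (T - s)) \<partial>\<eta>)"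
  proof (rule nn_integral_cong)
    fix s
    have "(\<integral>\<^sup>+r. indicator {..T} r * ennreal (\<psi> (r - s)) \<partial>lborel) = (\<integral>\<^sup>+r. indicator {..T - s} r * ennreal (\<psi> r) \<partial>lborel)"
      by (subst nn_integral_real_affine[where c=1 and t=s]) (auto intro!: nn_integral_cong simp: indicator_def)
    also have "\<dots> = ennreal (\<Psi> (T - s))"
      unfolding \<Psi>_def by (intro nn_integral_indicator_eq_integral int \<psi>)
    finally show "(\<integral>\<^sup>+r. indicator {..T} r * ennreal (\<psi> (r - s)) \<partial>lborel) = ennreal (\<Psi> (T - s))" .
  qed
  also have "\<dots> = ennreal (\<integral>s. \<Psi> (T - s) \<partial>\<eta>)"
  proof (intro nn_integral_eq_integral)
    show "integrable \<eta> (\<lambda>s. \<Psi> (T - s))" unfolding diff by (intro Bochner_Integration.integrable_diff Jint) simp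
  qed (simp add: \<Psi>0)
  also have d2: "(\<integral>s. \<Psi> (T - s) \<partial>\<eta>) = \<Psi> T - (\<integral>s. J T s \<partial>\<eta>)"
    unfolding diff using Jint prob_space by (subst Bochner_Integration.integral_diff) (auto simp del: space_eta)
  finally show "(\<integral>\<^sup>+r. indicator {..T} r * step_conv \<eta> (\<lambda>t. ennreal (\<psi> t)) r \<partial>lborel)
       = ennreal ((\<integral>r. indicator {..T} r * \<psi> r \<partial>lborel) - (\<integral>s. J T s \<partial>\<eta>))"
    unfolding \<Psi>_def .
  have "0 \<le> (\<integral>s. \<Psi> (T - s) \<partial>\<eta>)" using \<Psi>0 by (intro integral_nonneg_AE) auto
  then show "(\<integral>s. J T s \<partial>\<eta>) \<le> (\<integral>r. indicator {..T} r * \<psi> r \<partial>lborel)"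
    unfolding d2 by (simp add: \<Psi>_def)
qed

lemma step_conv_eq_integral:
  fixes \<psi> :: "real \<Rightarrow> real"
  assumes [measurable]: "\<psi> \<in> borel_measurable borel" and \<psi>: "\<And>t. 0 \<le> \<psi> t" "\<And>t. \<psi> t \<le> B"
  shows "step_conv \<eta> (\<lambda>t. ennreal (\<psi> t)) t = ennreal (\<integral>s. \<psi> (t - s) \<partial>\<eta>)"
    "integrable \<eta> (\<lambda>s. \<psi> (t - s))"
proof -
  show *: "integrable \<eta> (\<lambda>s. \<psi> (t - s))"
    by (rule integrable_const_bound[where B=B]) (use \<psi> in auto)
  show "step_conv \<eta> (\<lambda>t. ennreal (\<psi> t)) t = ennreal (\<integral>s. \<psi> (t - s) \<partial>\<eta>)"
    unfolding step_conv_def using * \<psi> by (intro nn_integral_eq_integral) auto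
qed

text \<open>Stated for Lipschitz functions since a raw solution need not be continuous: the
  Lipschitz bound turns finite energy of a difference into convergence and makes the set of
  asymptotic periods closed. Once every shift is an asymptotic period, \<open>\<phi>\<close> is
  nearly constant around \<open>T\<close>, so its oriented integral over a stretch of length
  \<open>s\<close> is close to \<open>s \<phi>(T)\<close>, with mean \<open>m \<phi>(T)\<close> over
  \<open>s\<close>.\<close>

theorem smooth_renewal:
  fixes \<phi> \<gamma> :: "real \<Rightarrow> real"
  assumes int_eta: "integrable \<eta> (\<lambda>s. s)"
    and m: "m = (\<integral>s. s \<partial>\<eta>)" "m \<noteq> 0"
    and nonarith: "\<And>h. 0 < h \<Longrightarrow> \<not> (AE s in \<eta>. s \<in> range (\<lambda>k::int. h * of_int k))"
    and lip: "\<And>s t. \<bar>\<phi> s - \<phi> t\<bar> \<le> L * \<bar>s - t\<bar>" and L: "0 < L"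
    and \<phi>: "\<And>t. 0 \<le> \<phi> t" "\<And>t. \<phi> t \<le> B"
    and int: "\<And>T. integrable lborel (\<lambda>r. indicator {..T} r * \<phi> r)"
    and \<gamma>: "\<And>t. 0 \<le> \<gamma> t" "integrable lborel \<gamma>"
    and eq: "\<And>t. \<phi> t = (\<integral>s. \<phi> (t - s) \<partial>\<eta>) + \<gamma> t"
  shows "(\<phi> \<longlongrightarrow> (\<integral>r. \<gamma> r \<partial>lborel) / m) at_top"
proof -
  have cont: "continuous_on UNIV \<phi>"
  proof -
    have "L-lipschitz_on UNIV \<phi>" using lip L by (intro lipschitz_onI) (auto simp: dist_real_def)
    then show ?thesis by (rule lipschitz_on_continuous_on)
  qed
  have [measurable]: "\<phi> \<in> borel_measurable borel"
    by (rule borel_measurable_continuous_onI[OF cont])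
  have [measurable]: "\<gamma> \<in> borel_measurable borel" using \<gamma>(2) by auto
  have B0: "0 \<le> B" using \<phi>[of 0] by linarith
  define J where "J T s = (\<integral>u. \<phi> (T - u) * shift_kernel s u \<partial>lborel)" for T s
  define \<Gamma> where "\<Gamma> T = (\<integral>r. indicator {..T} r * \<gamma> r \<partial>lborel)" for T
  define \<Psi> where "\<Psi> T = (\<integral>r. indicator {..T} r * \<phi> r \<partial>lborel)" for T
  have int\<gamma>: "integrable lborel (\<lambda>r. indicator {..T} r * \<gamma> r)" for T
    using integrable_real_mult_indicator[OF _ \<gamma>(2), of "{..T}"] by (simp add: mult.commute)
  have \<Gamma>0: "0 \<le> \<Gamma> T" for T unfolding \<Gamma>_def using \<gamma> by (intro integral_nonneg_AE) auto
  have \<Gamma>_le: "\<Gamma> T \<le> (\<integral>r. \<gamma> r \<partial>lborel)" for T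
    unfolding \<Gamma>_def using \<gamma> int\<gamma> by (intro integral_mono) (auto simp: indicator_def)
  have eq_nn: "ennreal (\<phi> t) = step_conv \<eta> (\<lambda>t. ennreal (\<phi> t)) t + ennreal (\<gamma> t)" for t
    using \<gamma>(1) \<phi> by (subst step_conv_eq_integral(1)[where \<psi>=\<phi>, OF _ \<phi>])
      (auto simp: ennreal_plus[symmetric] eq[symmetric] intro!: integral_nonneg_AE simp del: ennreal_plus)
  note A1 = nn_integral_step_conv_atMost[OF int_eta _ \<phi> int, folded J_def \<Psi>_def, simplified]
  \<comment> \<open>Integrate the equation up to \<open>T\<close>: the finite
    \<open>\<Psi> T\<close> cancels, and the boundary term equals the inhomogeneity accumulated so
    far.\<close>
  have J_eq: "(\<integral>s. J T s \<partial>\<eta>) = \<Gamma> T" for T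
  proof -
    have "ennreal (\<Psi> T) = (\<integral>\<^sup>+r. indicator {..T} r * ennreal (\<phi> r) \<partial>lborel)"
      unfolding \<Psi>_def by (intro nn_integral_indicator_eq_integral[symmetric] int \<phi>)
    also have "\<dots> = (\<integral>\<^sup>+r. indicator {..T} r * step_conv \<eta> (\<lambda>t. ennreal (\<phi> t)) r + indicator {..T} r * ennreal (\<gamma> r) \<partial>lborel)"
      by (subst eq_nn) (simp add: distrib_left)
    also have "\<dots> = (\<integral>\<^sup>+r. indicator {..T} r * step_conv \<eta> (\<lambda>t. ennreal (\<phi> t)) r \<partial>lborel) + (\<integral>\<^sup>+r. indicator {..T} r * ennreal (\<gamma> r) \<partial>lborel)"
      by (rule nn_integral_add) measurable
    also have "(\<integral>\<^sup>+r. indicator {..T} r * ennreal (\<gamma> r) \<partial>lborel) = ennreal (\<Gamma> T)"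
      unfolding \<Gamma>_def by (intro nn_integral_indicator_eq_integral int\<gamma> \<gamma>)
    also have "(\<integral>\<^sup>+r. indicator {..T} r * step_conv \<eta> (\<lambda>t. ennreal (\<phi> t)) r \<partial>lborel) = ennreal (\<Psi> T - (\<integral>s. J T s \<partial>\<eta>))"
      by (rule A1)
    also have "ennreal (\<Psi> T - (\<integral>s. J T s \<partial>\<eta>)) + ennreal (\<Gamma> T) = ennreal (\<Psi> T - (\<integral>s. J T s \<partial>\<eta>) + \<Gamma> T)"
      using A1(4)[of T] \<Gamma>0 by (intro ennreal_plus[symmetric]) auto
    finally show ?thesis
      using A1(4)[of T] \<Gamma>0[of T] by (subst (asm) ennreal_inj)
        (auto simp: \<Psi>_def \<phi> intro!: integral_nonneg_AE)
  qed
  \<comment> \<open>Integrating \<open>\<phi>\<^sup>2 * \<eta> - \<phi>\<^sup>2\<close> over a half line bounds the Dirichlet energy of \<open>\<phi>\<close> along the steps of the walk.\<close>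
  define E where "E t = (\<integral>\<^sup>+s. ennreal ((\<phi> (t - s) - \<phi> t)\<^sup>2) \<partial>\<eta>)" for t
  have [measurable]: "E \<in> borel_measurable borel" unfolding E_def by measurable
  have sq: "0 \<le> (\<phi> t)\<^sup>2" "(\<phi> t)\<^sup>2 \<le> B\<^sup>2" for t using \<phi>[of t] by (auto intro!: power_mono)
  have int2: "integrable lborel (\<lambda>r. indicator {..T} r * (\<phi> r)\<^sup>2)" for T
  proof (rule Bochner_Integration.integrable_bound[OF integrable_mult_right[OF int[of T], of B]])
    have "(\<phi> x)\<^sup>2 \<le> \<bar>B * \<phi> x\<bar>" for x using \<phi>[of x] by (simp add: power2_eq_square mult_right_mono)
    then show "AE x in lborel. norm (indicator {..T} x * (\<phi> x)\<^sup>2) \<le> norm (B * (indicator {..T} x * \<phi> x))"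
      by (auto simp: indicator_def)
  qed auto
  \<comment> \<open>Expanding the square and inserting the equation, \<open>E\<close> plus
    \<open>\<phi>^2\<close> equals the convolution of \<open>\<phi>^2\<close> plus
    \<open>2 \<phi> \<gamma>\<close>; then \<open>\<phi> \<le> B\<close>. The term
    \<open>\<phi>^2\<close> is kept on the left to avoid subtraction in
    \<open>ennreal\<close>.\<close>
  have pt: "E t + ennreal ((\<phi> t)\<^sup>2) \<le> step_conv \<eta> (\<lambda>t. ennreal ((\<phi> t)\<^sup>2)) t + ennreal (2 * B * \<gamma> t)" for t
  proof -
    have i1: "integrable \<eta> (\<lambda>s. \<phi> (t - s))" using step_conv_eq_integral(2)[where \<psi>=\<phi>, OF _ \<phi>] by auto
    have i2: "integrable \<eta> (\<lambda>s. (\<phi> (t - s))\<^sup>2)"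
      using step_conv_eq_integral(2)[where \<psi>="\<lambda>t. (\<phi> t)\<^sup>2", OF _ sq] by auto
    have exp: "(\<lambda>s. (\<phi> (t - s) - \<phi> t)\<^sup>2) = (\<lambda>s. (\<phi> (t - s))\<^sup>2 - 2 * \<phi> t * \<phi> (t - s) + (\<phi> t)\<^sup>2)"
      by (auto simp: power2_eq_square algebra_simps)
    have "E t = ennreal (\<integral>s. (\<phi> (t - s) - \<phi> t)\<^sup>2 \<partial>\<eta>)"
      unfolding E_def by (intro nn_integral_eq_integral) (auto simp: exp i1 i2)
    also have "(\<integral>s. (\<phi> (t - s) - \<phi> t)\<^sup>2 \<partial>\<eta>) = (\<integral>s. (\<phi> (t - s))\<^sup>2 \<partial>\<eta>) - 2 * \<phi> t * (\<integral>s. \<phi> (t - s) \<partial>\<eta>) + (\<phi> t)\<^sup>2"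
      unfolding exp using i1 i2 by (simp add: prob_space[simplified])
    also have "(\<integral>s. \<phi> (t - s) \<partial>\<eta>) = \<phi> t - \<gamma> t" using eq[of t] by simp
    finally have Et: "E t = ennreal ((\<integral>s. (\<phi> (t - s))\<^sup>2 \<partial>\<eta>) - 2 * \<phi> t * (\<phi> t - \<gamma> t) + (\<phi> t)\<^sup>2)" .
    have nn: "0 \<le> (\<integral>s. (\<phi> (t - s))\<^sup>2 \<partial>\<eta>)" by (intro integral_nonneg_AE) auto
    have nn2: "0 \<le> (\<integral>s. (\<phi> (t - s))\<^sup>2 \<partial>\<eta>) - 2 * \<phi> t * (\<phi> t - \<gamma> t) + (\<phi> t)\<^sup>2"
    proof -
      have "0 \<le> (\<integral>s. (\<phi> (t - s) - \<phi> t)\<^sup>2 \<partial>\<eta>)" by (intro integral_nonneg_AE) auto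
      also have "\<dots> = (\<integral>s. (\<phi> (t - s))\<^sup>2 \<partial>\<eta>) - 2 * \<phi> t * (\<integral>s. \<phi> (t - s) \<partial>\<eta>) + (\<phi> t)\<^sup>2"
        unfolding exp using i1 i2 by (simp add: prob_space[simplified])
      also have "(\<integral>s. \<phi> (t - s) \<partial>\<eta>) = \<phi> t - \<gamma> t" using eq[of t] by simp
      finally show ?thesis .
    qed
    have "\<phi> t * \<gamma> t \<le> B * \<gamma> t" using \<phi> \<gamma> by (intro mult_right_mono) auto
    then have "(\<integral>s. (\<phi> (t - s))\<^sup>2 \<partial>\<eta>) - 2 * \<phi> t * (\<phi> t - \<gamma> t) + (\<phi> t)\<^sup>2 + (\<phi> t)\<^sup>2 \<le> (\<integral>s. (\<phi> (t - s))\<^sup>2 \<partial>\<eta>) + 2 * B * \<gamma> t"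
      by (simp add: algebra_simps power2_eq_square)
    then show ?thesis
      unfolding Et step_conv_eq_integral(1)[where \<psi>="\<lambda>t. (\<phi> t)\<^sup>2", OF _ sq, simplified]
      using nn nn2 \<gamma>(1)[of t] B0
      by (simp add: ennreal_plus[symmetric] ennreal_leI del: ennreal_plus)
  qed
  \<comment> \<open>The boundary term of \<open>\<phi>^2\<close>, a function bounded by
    \<open>B^2\<close>, plus \<open>2 B\<close> times the total inhomogeneity.\<close>
  define Q where "Q = B\<^sup>2 * (\<integral>s. \<bar>s\<bar> \<partial>\<eta>) + 2 * B * (\<integral>r. \<gamma> r \<partial>lborel)"
  have Q0: "0 \<le> Q"
    unfolding Q_def using B0 \<gamma> by (intro add_nonneg_nonneg mult_nonneg_nonneg integral_nonneg_AE) auto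
  have energyT: "(\<integral>\<^sup>+r. indicator {..T} r * E r \<partial>lborel) \<le> ennreal Q" for T
  proof -
    \<comment> \<open>Finite, so that it can be cancelled from both sides of the integrated
      inequality.\<close>
    define \<Psi>2 where "\<Psi>2 = (\<integral>r. indicator {..T} r * (\<phi> r)\<^sup>2 \<partial>lborel)"
    note A2 = nn_integral_step_conv_atMost[where \<psi>="\<lambda>t. (\<phi> t)\<^sup>2", OF int_eta _ sq int2, simplified]
    let ?j = "(\<integral>s. (\<integral>u. (\<phi> (T - u))\<^sup>2 * shift_kernel s u \<partial>lborel) \<partial>\<eta>)"
    have \<Psi>20: "0 \<le> \<Psi>2" unfolding \<Psi>2_def by (intro integral_nonneg_AE) auto
    have p2: "(\<integral>\<^sup>+r. indicator {..T} r * ennreal ((\<phi> r)\<^sup>2) \<partial>lborel) = ennreal \<Psi>2"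
      unfolding \<Psi>2_def by (intro nn_integral_indicator_eq_integral int2) auto
    have p3: "(\<integral>\<^sup>+r. indicator {..T} r * ennreal (2 * B * \<gamma> r) \<partial>lborel) = ennreal (2 * B * \<Gamma> T)"
    proof -
      have "(\<integral>\<^sup>+r. indicator {..T} r * ennreal (2 * B * \<gamma> r) \<partial>lborel) = (\<integral>\<^sup>+r. ennreal (2 * B * (indicator {..T} r * \<gamma> r)) \<partial>lborel)"
        by (auto intro!: nn_integral_cong simp: indicator_def)
      also have "\<dots> = ennreal (\<integral>r. 2 * B * (indicator {..T} r * \<gamma> r) \<partial>lborel)"
        using B0 \<gamma> int\<gamma> by (intro nn_integral_eq_integral) auto
      finally show ?thesis by (simp add: \<Gamma>_def)
    qed
    have "(\<integral>\<^sup>+r. indicator {..T} r * E r \<partial>lborel) + ennreal \<Psi>2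
       = (\<integral>\<^sup>+r. indicator {..T} r * E r + indicator {..T} r * ennreal ((\<phi> r)\<^sup>2) \<partial>lborel)"
      unfolding p2[symmetric] by (rule nn_integral_add[symmetric]) measurable
    also have "\<dots> \<le> (\<integral>\<^sup>+r. indicator {..T} r * step_conv \<eta> (\<lambda>t. ennreal ((\<phi> t)\<^sup>2)) r + indicator {..T} r * ennreal (2 * B * \<gamma> r) \<partial>lborel)"
      unfolding distrib_left[symmetric] by (intro nn_integral_mono mult_left_mono pt) auto
    also have "\<dots> = ennreal (\<Psi>2 - ?j) + ennreal (2 * B * \<Gamma> T)"
      by (subst nn_integral_add) (auto simp: A2(2) p3 \<Psi>2_def)
    also have "\<dots> = ennreal (\<Psi>2 - ?j + 2 * B * \<Gamma> T)"
      using A2(4)[of T] B0 \<Gamma>0[of T] by (intro ennreal_plus[symmetric]) (auto simp: \<Psi>2_def)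
    also have "\<dots> \<le> ennreal (\<Psi>2 + Q)"
    proof (intro ennreal_leI)
      have "2 * B * \<Gamma> T \<le> 2 * B * (\<integral>r. \<gamma> r \<partial>lborel)" using \<Gamma>_le[of T] B0 by (intro mult_left_mono) auto
      then show "\<Psi>2 - ?j + 2 * B * \<Gamma> T \<le> \<Psi>2 + Q"
        using A2(3)[of T] unfolding Q_def by linarith
    qed
    also have "\<dots> \<le> ennreal \<Psi>2 + ennreal Q"
      using \<Psi>20 Q0 by simp
    finally have "ennreal \<Psi>2 + (\<integral>\<^sup>+r. indicator {..T} r * E r \<partial>lborel) \<le> ennreal \<Psi>2 + ennreal Q"
      by (simp add: add.commute)
    then show ?thesis by (simp add: ennreal_add_left_cancel_le)
  qed
  have energy: "(\<integral>\<^sup>+r. E r \<partial>lborel) \<le> ennreal Q"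
  proof -
    have sup: "(SUP n::nat. indicator {..real n} r * E r) = E r" for r
    proof (rule antisym)
      show "(SUP n::nat. indicator {..real n} r * E r) \<le> E r"
        by (rule SUP_least) (auto simp: indicator_def)
      obtain n :: nat where "r \<le> real n" using real_arch_simple by blast
      then show "E r \<le> (SUP n::nat. indicator {..real n} r * E r)"
        by (intro SUP_upper2[of n]) auto
    qed
    have "(\<integral>\<^sup>+r. E r \<partial>lborel) = (\<integral>\<^sup>+r. (SUP n::nat. indicator {..real n} r * E r) \<partial>lborel)"
      by (simp only: sup)
    also have "\<dots> = (SUP n::nat. \<integral>\<^sup>+r. indicator {..real n} r * E r \<partial>lborel)"
      by (rule nn_integral_monotone_convergence_SUP)
         (auto simp: incseq_def le_fun_def indicator_def)
    also have "\<dots> \<le> ennreal Q" by (intro SUP_least energyT)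
    finally show ?thesis .
  qed
  \<comment> \<open>The asymptotic periods of \<open>\<phi>\<close>. They form a closed subgroup of
    full \<open>\<eta>\<close>-measure, which no lattice can contain.\<close>
  define P where "P = {p. ((\<lambda>t. \<phi> (t - p) - \<phi> t) \<longlongrightarrow> 0) at_top}"
  have AE_P: "AE s in \<eta>. s \<in> P"
  proof -
    have "(\<integral>\<^sup>+s. \<integral>\<^sup>+t. ennreal ((\<phi> (t - s) - \<phi> t)\<^sup>2) \<partial>lborel \<partial>\<eta>) = (\<integral>\<^sup>+t. E t \<partial>lborel)"
      unfolding E_def by (rule lborel_eta.Fubini') measurable
    also have "\<dots> < \<infinity>" using energy by (rule le_less_trans) simp
    finally have "AE s in \<eta>. (\<integral>\<^sup>+t. ennreal ((\<phi> (t - s) - \<phi> t)\<^sup>2) \<partial>lborel) \<noteq> \<infinity>"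
      by (intro nn_integral_PInf_AE) auto
    then show ?thesis
    proof eventually_elim
      case (elim s)
      have "((\<lambda>t. \<phi> (t - s) - \<phi> t) \<longlongrightarrow> 0) at_top"
      proof (rule square_integrable_Lipschitz_tendsto_0[where L="2 * L"])
        fix t r
        have "\<bar>\<phi> (t - s) - \<phi> (r - s)\<bar> \<le> L * \<bar>t - r\<bar>" "\<bar>\<phi> t - \<phi> r\<bar> \<le> L * \<bar>t - r\<bar>"
          using lip[of "t - s" "r - s"] lip[of t r] by auto
        then show "\<bar>\<phi> (t - s) - \<phi> t - (\<phi> (r - s) - \<phi> r)\<bar> \<le> 2 * L * \<bar>t - r\<bar>" by linarith
      qed (use L elim in \<open>auto simp: less_top\<close>)
      then show ?case by (simp add: P_def)
    qed
  qed
  have "P = UNIV"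
  proof (rule closed_subgroup_real_UNIV)
    show "0 \<in> P" by (simp add: P_def)
  next
    fix x y assume x: "x \<in> P" and y: "y \<in> P"
    \<comment> \<open>The period \<open>y\<close> is applied at the point
      \<open>t - (x - y)\<close>, from which it leads to \<open>t - x\<close>.\<close>
    have "filterlim (\<lambda>t. - (x - y) + t) at_top at_top"
      by (rule filterlim_tendsto_add_at_top[OF tendsto_const filterlim_ident])
    then have "((\<lambda>t. \<phi> ((- (x - y) + t) - y) - \<phi> (- (x - y) + t)) \<longlongrightarrow> 0) at_top"
      using y unfolding P_def mem_Collect_eq by (rule filterlim_compose[rotated])
    then have y': "((\<lambda>t. \<phi> (t - (x - y) - y) - \<phi> (t - (x - y))) \<longlongrightarrow> 0) at_top"
      by (simp add: algebra_simps)
    have "((\<lambda>t. (\<phi> (t - x) - \<phi> t) - (\<phi> (t - (x - y) - y) - \<phi> (t - (x - y)))) \<longlongrightarrow> 0 - 0) at_top"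
      using x y' unfolding P_def by (intro tendsto_diff) auto
    then show "x - y \<in> P" unfolding P_def by (simp add: algebra_simps)
  next
    show "closed P"
    proof (unfold closed_sequential_limits, intro allI impI, elim conjE)
      fix x l assume x: "\<forall>n. x n \<in> P" and lim: "x \<longlonglongrightarrow> l"
      show "l \<in> P" unfolding P_def mem_Collect_eq
      proof (rule tendstoI)
        fix e :: real assume e: "0 < e"
        then have "eventually (\<lambda>n. dist (x n) l < e / (2 * L)) sequentially"
          using L by (intro tendstoD[OF lim]) auto
        then obtain n where n: "dist (x n) l < e / (2 * L)" by (auto simp: eventually_sequentially)
        have "((\<lambda>t. \<phi> (t - x n) - \<phi> t) \<longlongrightarrow> 0) at_top" using x by (simp add: P_def)
        then have "eventually (\<lambda>t. dist (\<phi> (t - x n) - \<phi> t) 0 < e/2) at_top"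
          using e by (intro tendstoD) auto
        then show "eventually (\<lambda>t. dist (\<phi> (t - l) - \<phi> t) 0 < e) at_top"
        proof eventually_elim
          case (elim t)
          have "\<bar>\<phi> (t - l) - \<phi> (t - x n)\<bar> \<le> L * \<bar>x n - l\<bar>" using lip[of "t - l" "t - x n"] by simp
          also have "\<dots> \<le> e / 2" using n L by (simp add: dist_real_def field_simps)
          finally show ?case using elim unfolding dist_real_def by linarith
        qed
      qed
    qed
  next
    fix h :: real assume "0 < h"
    show "\<not> P \<subseteq> range (\<lambda>k::int. h * of_int k)"
    proof
      assume "P \<subseteq> range (\<lambda>k::int. h * of_int k)"
      with AE_P have "AE s in \<eta>. s \<in> range (\<lambda>k::int. h * of_int k)" by (auto elim: AE_mp)
      with nonarith[OF \<open>0 < h\<close>] show False by simp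
    qed
  qed
  then have shift: "((\<lambda>t. \<phi> (t - p) - \<phi> t) \<longlongrightarrow> 0) at_top" for p by (auto simp: P_def)
  \<comment> \<open>The difference integrates \<open>\<phi>(T - u) - \<phi>(T)\<close> against the
    kernel, whose integral is \<open>s\<close>. Every such difference tends to 0 and is bounded by
    \<open>2 B\<close>.\<close>
  have J_lim: "((\<lambda>T. J T s - s * \<phi> T) \<longlongrightarrow> 0) at_top" for s
  proof (rule tendsto_at_topI_sequentially)
    fix X :: "nat \<Rightarrow> real" assume X: "filterlim X at_top sequentially"
    have absB: "\<bar>\<phi> t\<bar> \<le> B" for t using \<phi>[of t] by auto
    have e: "J T s - s * \<phi> T = (\<integral>u. (\<phi> (T - u) - \<phi> T) * shift_kernel s u \<partial>lborel)" for T
    proof -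
      have "(\<integral>u. (\<phi> (T - u) - \<phi> T) * shift_kernel s u \<partial>lborel) = (\<integral>u. \<phi> (T - u) * shift_kernel s u - \<phi> T * shift_kernel s u \<partial>lborel)"
        by (simp add: algebra_simps)
      also have "\<dots> = J T s - \<phi> T * s"
        unfolding J_def using integrable_shift_kernel_mult(1)[of "\<lambda>u. \<phi> (T - u)" B s] absB
        by (subst Bochner_Integration.integral_diff) (auto simp: integral_shift_kernel)
      finally show ?thesis by (simp add: mult.commute)
    qed
    have "(\<lambda>n. \<integral>u. (\<phi> (X n - u) - \<phi> (X n)) * shift_kernel s u \<partial>lborel) \<longlonglongrightarrow> (\<integral>u. 0 * shift_kernel s u \<partial>lborel)"
    proof (rule integral_dominated_convergence[where w="\<lambda>u. 2 * B * \<bar>shift_kernel s u\<bar>"])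
      show "AE u in lborel. (\<lambda>n. (\<phi> (X n - u) - \<phi> (X n)) * shift_kernel s u) \<longlonglongrightarrow> 0 * shift_kernel s u"
        using filterlim_compose[OF shift X] by (intro AE_I2 tendsto_mult tendsto_const) auto
      fix n
      have "\<bar>\<phi> (X n - u) - \<phi> (X n)\<bar> \<le> 2 * B" for u using \<phi>[of "X n - u"] \<phi>[of "X n"] by linarith
      then show "AE u in lborel. norm ((\<phi> (X n - u) - \<phi> (X n)) * shift_kernel s u) \<le> 2 * B * \<bar>shift_kernel s u\<bar>"
        by (auto simp: abs_mult intro!: mult_right_mono)
    qed auto
    then show "(\<lambda>n. J (X n) s - s * \<phi> (X n)) \<longlonglongrightarrow> 0" by (simp add: e)
  qed
  \<comment> \<open>Averaging over \<open>s\<close> is dominated by \<open>2 B |s|\<close>,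
    integrable by the first moment of \<open>\<eta>\<close>. As \<open>\<Gamma>\<close> converges
    and \<open>m\<close> is nonzero, \<open>\<phi>\<close> converges.\<close>
  have "((\<lambda>T. \<Gamma> T - m * \<phi> T) \<longlongrightarrow> 0) at_top"
  proof (rule tendsto_at_topI_sequentially)
    fix X :: "nat \<Rightarrow> real" assume X: "filterlim X at_top sequentially"
    have e: "\<Gamma> T - m * \<phi> T = (\<integral>s. J T s - s * \<phi> T \<partial>\<eta>)" for T
      using A1(1)[of T] int_eta unfolding m(1) J_eq[symmetric] by simp
    have [measurable]: "J T \<in> borel_measurable borel" for T
      using borel_measurable_integrable[OF A1(1)[of T]] by (simp cong: measurable_cong_sets add: sets_eta)
    have "(\<lambda>n. \<integral>s. J (X n) s - s * \<phi> (X n) \<partial>\<eta>) \<longlonglongrightarrow> (\<integral>s. 0 \<partial>\<eta>)"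
    proof (rule integral_dominated_convergence[where w="\<lambda>s. 2 * B * \<bar>s\<bar>"])
      show "AE s in \<eta>. (\<lambda>n. J (X n) s - s * \<phi> (X n)) \<longlonglongrightarrow> 0"
        using filterlim_compose[OF J_lim X] by auto
      fix n
      have absB: "\<bar>\<phi> t\<bar> \<le> B" for t using \<phi>[of t] by auto
      have 1: "\<bar>J (X n) s\<bar> \<le> B * \<bar>s\<bar>" for s
        unfolding J_def by (rule integrable_shift_kernel_mult(2)) (auto simp: absB)
      have 2: "\<bar>s * \<phi> (X n)\<bar> \<le> B * \<bar>s\<bar>" for s
        by (simp add: abs_mult mult.commute[of "\<bar>s\<bar>"] mult_right_mono absB)
      show "AE s in \<eta>. norm (J (X n) s - s * \<phi> (X n)) \<le> 2 * B * \<bar>s\<bar>"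
      proof (rule AE_I2)
        fix s show "norm (J (X n) s - s * \<phi> (X n)) \<le> 2 * B * \<bar>s\<bar>"
          using 1[of s] 2[of s] by simp
      qed
    next
      show "integrable \<eta> (\<lambda>s. 2 * B * \<bar>s\<bar>)"
        by (intro integrable_mult_right integrable_abs int_eta)
    qed measurable
    then show "(\<lambda>n. \<Gamma> (X n) - m * \<phi> (X n)) \<longlonglongrightarrow> 0" by (simp add: e)
  qed
  moreover have "(\<Gamma> \<longlongrightarrow> (\<integral>r. \<gamma> r \<partial>lborel)) at_top"
    using tendsto_integral_at_top[OF _ \<gamma>(2)] by (simp add: \<Gamma>_def[abs_def])
  ultimately have "((\<lambda>T. (\<Gamma> T - (\<Gamma> T - m * \<phi> T)) / m) \<longlongrightarrow> ((\<integral>r. \<gamma> r \<partial>lborel) - 0) / m) at_top"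
    using m(2) by (intro tendsto_intros) auto
  then show ?thesis using m(2) by simp
qed

end

section \<open>From smoothed to original solutions\<close>

lemma nn_integral_exp_atMost:
  fixes \<alpha> T :: real
  assumes \<alpha>: "0 < \<alpha>"
  shows "(\<integral>\<^sup>+r. ennreal (exp (\<alpha> * r)) * indicator {..T} r \<partial>lborel) = ennreal (exp (\<alpha> * T) / \<alpha>)"
proof -
  have "(\<integral>\<^sup>+r. ennreal (exp (\<alpha> * r)) * indicator {..T} r \<partial>lborel) = (\<integral>\<^sup>+r. ennreal (exp (- (\<alpha> * r))) * indicator {- T..} r \<partial>lborel)"
    by (subst nn_integral_real_affine[where c="-1" and t=0]) (auto intro!: nn_integral_cong simp: indicator_def)
  also have "\<dots> = ennreal (0 - (- exp (- (\<alpha> * (- T))) / \<alpha>))"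
  proof (rule nn_integral_FTC_atLeast[where F="\<lambda>r. - exp (- (\<alpha> * r)) / \<alpha>"])
    have "filterlim (\<lambda>r. - (\<alpha> * r)) at_bot at_top"
      using \<alpha> by (subst filterlim_uminus_at_top[symmetric])
        (intro filterlim_tendsto_pos_mult_at_top[OF tendsto_const] filterlim_ident)
    then have "((\<lambda>r. - exp (- (\<alpha> * r)) / \<alpha>) \<longlongrightarrow> - 0 / \<alpha>) at_top"
      using \<alpha> by (intro tendsto_intros filterlim_compose[OF exp_at_bot]) auto
    then show "((\<lambda>r. - exp (- (\<alpha> * r)) / \<alpha>) \<longlongrightarrow> 0) at_top" by simp
    show "DERIV (\<lambda>r. - exp (- (\<alpha> * r)) / \<alpha>) x :> exp (- (\<alpha> * x))" for x
      using \<alpha> by (auto intro!: derivative_eq_intros)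
  qed auto
  finally show ?thesis by simp
qed

context step_law begin

text \<open>\<open>f t\<close> stands for \<open>exp (\<alpha> t) P(X > exp t)\<close>: then
  \<open>f_le\<close> says that a probability is at most 1, \<open>mono\<close> that the tail
  decreases, and \<open>decay\<close> follows from the tail tending to 0.\<close>

theorem renewal_theorem:
  fixes f g :: "real \<Rightarrow> real" and \<alpha> \<theta> \<rho> :: real
  assumes int_eta: "integrable \<eta> (\<lambda>s. s)"
    and m: "m = (\<integral>s. s \<partial>\<eta>)" "m \<noteq> 0"
    and nonarith: "\<And>h. 0 < h \<Longrightarrow> \<not> (AE s in \<eta>. s \<in> range (\<lambda>k::int. h * of_int k))"
    and f_meas [measurable]: "f \<in> borel_measurable borel" and g_meas [measurable]: "g \<in> borel_measurable borel"
    and f0: "\<And>t. 0 \<le> f t" and f_le: "\<And>t. f t \<le> exp (\<alpha> * t)"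
    and g0: "\<And>t. 0 \<le> g t" and g: "integrable lborel g"
    and eq: "\<And>t. ennreal (f t) = step_conv \<eta> (\<lambda>t. ennreal (f t)) t + ennreal (g t)"
    and \<alpha>: "0 < \<alpha>" "(\<integral>\<^sup>+s. ennreal (exp (- \<alpha> * s)) \<partial>\<eta>) \<le> 1"
    and \<theta>: "0 < \<theta>" and \<rho>: "(\<integral>\<^sup>+s. ennreal (exp (- \<theta> * s)) \<partial>\<eta>) \<le> ennreal \<rho>" "0 \<le> \<rho>" "\<rho> < 1"
    and mono: "\<And>r t. r \<le> t \<Longrightarrow> f t * exp (- \<alpha> * (t - r)) \<le> f r"
    and decay: "\<And>\<delta>. 0 < \<delta> \<Longrightarrow> \<exists>K\<ge>0. \<forall>r. f r \<le> \<delta> * exp (\<alpha> * r) + K * exp (\<theta> * r)"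
  shows "(f \<longlongrightarrow> (\<integral>r. g r \<partial>lborel) / m) at_top"
proof -
  \<comment> \<open>The added 1 makes \<open>B\<close> positive, as a Lipschitz constant has to be,
    even if \<open>g\<close> vanishes almost everywhere.\<close>
  define B where "B = exp \<alpha> * (exp \<theta> / (1 - \<rho>) * (\<integral>r. g r \<partial>lborel)) + 1"
  have fB: "f t \<le> B" for t
    using renewal_solution_bounded[OF f_meas g_meas f0 g0 g eq \<alpha> \<theta> \<rho> mono decay, of t] by (simp add: B_def)
  have B0: "0 < B"
    unfolding B_def using \<rho> g0 by (auto intro!: add_nonneg_pos mult_nonneg_nonneg integral_nonneg_AE)
  have absfB: "\<bar>f t\<bar> \<le> B" for t using fB[of t] f0[of t] by auto
  define I where "I = (\<integral>r. g r \<partial>lborel)"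
  have I0: "0 \<le> I" unfolding I_def using g0 by (intro integral_nonneg_AE) auto
  \<comment> \<open>The sliding average of \<open>f\<close> over windows of length \<open>\<delta>\<close> is Lipschitz and solves a renewal equation of its own.\<close>
  define \<phi> where "\<phi> \<delta> t = (\<integral>u. f (t - u) * indicator {0..\<delta>} u \<partial>lborel)" for \<delta> t
  define \<gamma> where "\<gamma> \<delta> t = (\<integral>u. g (t - u) * indicator {0..\<delta>} u \<partial>lborel)" for \<delta> t
  have lim_\<phi>: "(\<phi> \<delta> \<longlongrightarrow> \<delta> * I / m) at_top" if \<delta>: "0 < \<delta>" for \<delta>
  proof -
    have iint: "integrable lborel (\<lambda>u. b * indicator {0..\<delta>} u)" for b :: real
      using \<delta> by (intro integrable_mult_right integrable_real_indicator) auto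
    have fint: "integrable lborel (\<lambda>u. f (t - u) * indicator {0..\<delta>} u)" for t
      by (rule Bochner_Integration.integrable_bound[OF iint[of B]])
         (use absfB B0 \<delta> in \<open>auto simp: abs_mult split: split_indicator\<close>)
    have gint: "integrable lborel (\<lambda>u. g (t - u) * indicator {0..\<delta>} u)" for t
      using lborel_integrable_real_affine[OF g, of "-1" t]
      by (intro integrable_real_mult_indicator) auto
    have \<phi>0: "0 \<le> \<phi> \<delta> t" for t unfolding \<phi>_def using f0 by (intro integral_nonneg_AE) auto
    have \<gamma>0: "0 \<le> \<gamma> \<delta> t" for t unfolding \<gamma>_def using g0 by (intro integral_nonneg_AE) auto
    have \<phi>B: "\<phi> \<delta> t \<le> B * \<delta>" for t
    proof -
      have "\<phi> \<delta> t \<le> (\<integral>u. B * indicator {0..\<delta>} u \<partial>lborel)"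
        unfolding \<phi>_def using fB \<delta> by (intro integral_mono fint iint) (auto split: split_indicator)
      then show ?thesis using \<delta> by simp
    qed
    have \<phi>nn: "ennreal (\<phi> \<delta> t) = (\<integral>\<^sup>+u. indicator {0..\<delta>} (t - u) * ennreal (f u) \<partial>lborel)" for t
    proof -
      have "ennreal (\<phi> \<delta> t) = (\<integral>\<^sup>+u. ennreal (f (t - u) * indicator {0..\<delta>} u) \<partial>lborel)"
        unfolding \<phi>_def using f0 by (intro nn_integral_eq_integral[symmetric] fint) auto
      also have "\<dots> = (\<integral>\<^sup>+u. ennreal (f u * indicator {0..\<delta>} (t - u)) \<partial>lborel)"
        by (subst nn_integral_real_affine[where c="-1" and t=t]) auto
      also have "\<dots> = (\<integral>\<^sup>+u. indicator {0..\<delta>} (t - u) * ennreal (f u) \<partial>lborel)"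
        by (intro nn_integral_cong) (auto simp: indicator_def)
      finally show ?thesis .
    qed
    have \<gamma>nn: "ennreal (\<gamma> \<delta> t) = (\<integral>\<^sup>+u. indicator {0..\<delta>} (t - u) * ennreal (g u) \<partial>lborel)" for t
    proof -
      have "ennreal (\<gamma> \<delta> t) = (\<integral>\<^sup>+u. ennreal (g (t - u) * indicator {0..\<delta>} u) \<partial>lborel)"
        unfolding \<gamma>_def using g0 by (intro nn_integral_eq_integral[symmetric] gint) auto
      also have "\<dots> = (\<integral>\<^sup>+u. ennreal (g u * indicator {0..\<delta>} (t - u)) \<partial>lborel)"
        by (subst nn_integral_real_affine[where c="-1" and t=t]) auto
      also have "\<dots> = (\<integral>\<^sup>+u. indicator {0..\<delta>} (t - u) * ennreal (g u) \<partial>lborel)"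
        by (intro nn_integral_cong) (auto simp: indicator_def)
      finally show ?thesis .
    qed
    have \<phi>meas [measurable]: "\<phi> \<delta> \<in> borel_measurable borel"
      unfolding \<phi>_def by (rule lborel.borel_measurable_lebesgue_integral) measurable
    have \<gamma>meas [measurable]: "\<gamma> \<delta> \<in> borel_measurable borel"
      unfolding \<gamma>_def by (rule lborel.borel_measurable_lebesgue_integral) measurable
    \<comment> \<open>\<open>\<phi> \<delta> t\<close> integrates \<open>f\<close> over
      \<open>{t - \<delta>..t}\<close>. Moving the window from \<open>s\<close> to \<open>t\<close>
      gains at most the strip \<open>{s..t}\<close> and loses at most
      \<open>{s - \<delta>..t - \<delta>}\<close>; each strip carries at most
      \<open>B (t - s)\<close>.\<close>
    have lip1: "\<phi> \<delta> t - \<phi> \<delta> s \<le> B * (t - s)" if "s \<le> t" for s t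
    proof -
      have "ennreal (\<phi> \<delta> t) \<le> (\<integral>\<^sup>+u. indicator {0..\<delta>} (s - u) * ennreal (f u) + ennreal B * indicator {s..t} u \<partial>lborel)"
        unfolding \<phi>nn using that fB f0 by (intro nn_integral_mono) (auto simp: indicator_def intro!: ennreal_leI)
      also have "\<dots> = ennreal (\<phi> \<delta> s) + ennreal B * ennreal (t - s)"
        unfolding \<phi>nn using that by (subst nn_integral_add) (auto simp: nn_integral_cmult)
      also have "\<dots> = ennreal (\<phi> \<delta> s + B * (t - s))"
        using that B0 \<phi>0 by (simp add: ennreal_mult[symmetric])
      finally show ?thesis using that B0 \<phi>0[of s] by (subst (asm) ennreal_le_iff) auto
    qed
    have lip2: "\<phi> \<delta> s - \<phi> \<delta> t \<le> B * (t - s)" if "s \<le> t" for s t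
    proof -
      have "ennreal (\<phi> \<delta> s) \<le> (\<integral>\<^sup>+u. indicator {0..\<delta>} (t - u) * ennreal (f u) + ennreal B * indicator {s-\<delta>..t-\<delta>} u \<partial>lborel)"
        unfolding \<phi>nn using that fB f0 by (intro nn_integral_mono) (auto simp: indicator_def intro!: ennreal_leI)
      also have "\<dots> = ennreal (\<phi> \<delta> t) + ennreal B * ennreal (t - s)"
        unfolding \<phi>nn using that by (subst nn_integral_add) (auto simp: nn_integral_cmult)
      also have "\<dots> = ennreal (\<phi> \<delta> t + B * (t - s))"
        using that B0 \<phi>0 by (simp add: ennreal_mult[symmetric])
      finally show ?thesis using that B0 \<phi>0[of t] by (subst (asm) ennreal_le_iff) auto
    qed
    have lip: "\<bar>\<phi> \<delta> s - \<phi> \<delta> t\<bar> \<le> B * \<bar>s - t\<bar>" for s t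
      using lip1[of s t] lip2[of s t] lip1[of t s] lip2[of t s] by (cases "s \<le> t") (auto simp: abs_if)
    \<comment> \<open>This exponential bound gives integrability towards minus infinity, where
      boundedness alone would not suffice.\<close>
    have \<phi>exp: "\<phi> \<delta> t \<le> \<delta> * exp (\<alpha> * t)" for t
    proof -
      have "f (t - u) \<le> exp (\<alpha> * t)" if "0 \<le> u" for u
        using that \<alpha> by (intro order_trans[OF f_le[of "t - u"]]) auto
      then have "\<phi> \<delta> t \<le> (\<integral>u. exp (\<alpha> * t) * indicator {0..\<delta>} u \<partial>lborel)"
        unfolding \<phi>_def using \<delta> by (intro integral_mono fint iint) (auto split: split_indicator)
      then show ?thesis using \<delta> by (simp add: mult.commute)
    qed
    have expint: "integrable lborel (\<lambda>r. indicator {..T} r * exp (\<alpha> * r))" for T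
    proof -
      have "(\<integral>\<^sup>+r. ennreal (exp (\<alpha> * r)) * indicator {..T} r \<partial>lborel) < \<infinity>"
        using nn_integral_exp_atMost[OF \<alpha>(1)] by simp
      moreover have "(\<integral>\<^sup>+r. ennreal (exp (\<alpha> * r)) * indicator {..T} r \<partial>lborel) = (\<integral>\<^sup>+r. ennreal (indicator {..T} r * exp (\<alpha> * r)) \<partial>lborel)"
        by (intro nn_integral_cong) (auto simp: indicator_def)
      ultimately show ?thesis by (intro integrableI_nonneg) auto
    qed
    have int: "integrable lborel (\<lambda>r. indicator {..T} r * \<phi> \<delta> r)" for T
      by (rule Bochner_Integration.integrable_bound[OF integrable_mult_right[OF expint[of T], of \<delta>]])
         (use \<phi>exp \<phi>0 \<delta> in \<open>auto simp: indicator_def\<close>)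
    have nn\<gamma>: "(\<integral>\<^sup>+t. ennreal (\<gamma> \<delta> t) \<partial>lborel) = ennreal (\<delta> * I)"
    proof -
      have gg: "ennreal (\<gamma> \<delta> t) = (\<integral>\<^sup>+u. ennreal (g (t - u)) * indicator {0..\<delta>} u \<partial>lborel)" for t
      proof -
        have "ennreal (\<gamma> \<delta> t) = (\<integral>\<^sup>+u. ennreal (g (t - u) * indicator {0..\<delta>} u) \<partial>lborel)"
          unfolding \<gamma>_def using g0 by (intro nn_integral_eq_integral[symmetric] gint) auto
        then show ?thesis by (simp add: ennreal_mult ennreal_indicator g0)
      qed
      have "(\<integral>\<^sup>+t. ennreal (\<gamma> \<delta> t) \<partial>lborel) = (\<integral>\<^sup>+u. (\<integral>\<^sup>+t. ennreal (g (t - u)) * indicator {0..\<delta>} u \<partial>lborel) \<partial>lborel)"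
        unfolding gg by (rule lborel_pair.Fubini') measurable
      also have "\<dots> = (\<integral>\<^sup>+u. ennreal I * indicator {0..\<delta>} u \<partial>lborel)"
      proof (rule nn_integral_cong)
        fix u :: real
        have "(\<integral>\<^sup>+t. ennreal (g (t - u)) \<partial>lborel) = (\<integral>\<^sup>+t. ennreal (g t) \<partial>lborel)"
          by (subst nn_integral_real_affine[where c=1 and t=u]) auto
        also have "\<dots> = ennreal I" unfolding I_def using g g0 by (intro nn_integral_eq_integral) auto
        finally show "(\<integral>\<^sup>+t. ennreal (g (t - u)) * indicator {0..\<delta>} u \<partial>lborel) = ennreal I * indicator {0..\<delta>} u"
          by (simp add: nn_integral_multc)
      qed
      also have "\<dots> = ennreal (\<delta> * I)" using \<delta> I0 by (simp add: nn_integral_cmult ennreal_mult mult.commute)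
      finally show ?thesis .
    qed
    have \<gamma>_int: "integrable lborel (\<gamma> \<delta>)" using nn\<gamma> \<gamma>0 by (intro integrableI_nonneg) auto
    have \<gamma>I: "(\<integral>t. \<gamma> \<delta> t \<partial>lborel) = \<delta> * I"
      using nn_integral_eq_integral[OF \<gamma>_int] \<gamma>0 nn\<gamma> \<delta> I0 by (simp add: integral_nonneg_AE)
    have eqn: "ennreal (\<phi> \<delta> t) = step_conv \<eta> (\<lambda>t. ennreal (\<phi> \<delta> t)) t + ennreal (\<gamma> \<delta> t)" for t
    proof -
      have "ennreal (\<phi> \<delta> t) = (\<integral>\<^sup>+u. indicator {0..\<delta>} (t - u) * step_conv \<eta> (\<lambda>t. ennreal (f t)) u + indicator {0..\<delta>} (t - u) * ennreal (g u) \<partial>lborel)"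
        unfolding \<phi>nn by (subst eq) (simp add: distrib_left)
      also have "\<dots> = (\<integral>\<^sup>+u. indicator {0..\<delta>} (t - u) * step_conv \<eta> (\<lambda>t. ennreal (f t)) u \<partial>lborel) + ennreal (\<gamma> \<delta> t)"
        unfolding \<gamma>nn by (rule nn_integral_add) measurable
      also have "(\<integral>\<^sup>+u. indicator {0..\<delta>} (t - u) * step_conv \<eta> (\<lambda>t. ennreal (f t)) u \<partial>lborel)
          = (\<integral>\<^sup>+u. step_conv \<eta> (indicator {0..\<delta>}) (t - u) * ennreal (f u) \<partial>lborel)"
        by (rule step_conv_adjoint[symmetric]) measurable
      also have "\<dots> = (\<integral>\<^sup>+u. \<integral>\<^sup>+s. indicator {0..\<delta>} (t - u - s) * ennreal (f u) \<partial>\<eta> \<partial>lborel)"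
        unfolding step_conv_def by (intro nn_integral_cong nn_integral_multc[symmetric]) measurable
      also have "\<dots> = (\<integral>\<^sup>+s. \<integral>\<^sup>+u. indicator {0..\<delta>} (t - u - s) * ennreal (f u) \<partial>lborel \<partial>\<eta>)"
        by (rule lborel_eta.Fubini'[symmetric]) measurable
      also have "\<dots> = step_conv \<eta> (\<lambda>t. ennreal (\<phi> \<delta> t)) t"
        unfolding step_conv_def \<phi>nn by (simp add: algebra_simps)
      finally show ?thesis .
    qed
    have eqr: "\<phi> \<delta> t = (\<integral>s. \<phi> \<delta> (t - s) \<partial>\<eta>) + \<gamma> \<delta> t" for t
    proof -
      have "0 \<le> (\<integral>s. \<phi> \<delta> (t - s) \<partial>\<eta>)" using \<phi>0 by (intro integral_nonneg_AE) auto
      then show ?thesis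
        using eqn[of t] \<phi>0[of t] \<gamma>0[of t] unfolding step_conv_eq_integral(1)[OF \<phi>meas \<phi>0 \<phi>B]
        by (simp add: ennreal_plus[symmetric] del: ennreal_plus)
    qed
    show ?thesis
      using smooth_renewal[OF int_eta m nonarith lip B0 \<phi>0 \<phi>B int \<gamma>0 \<gamma>_int eqr] unfolding \<gamma>I .
  qed
  \<comment> \<open>\<open>f t\<close> is at most \<open>exp (\<alpha> \<delta>)\<close> times the
    average of \<open>f\<close> over the window before \<open>t\<close>, and at least
    \<open>exp (- \<alpha> \<delta>)\<close> times the average over the window after
    \<open>t\<close>. Both averages tend to \<open>I / m\<close>, and \<open>\<delta>\<close> is
    arbitrary.\<close>
  have upper: "f t \<le> exp (\<alpha> * \<delta>) * (\<phi> \<delta> t / \<delta>)" and lower: "exp (- \<alpha> * \<delta>) * (\<phi> \<delta> (t + \<delta>) / \<delta>) \<le> f t"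
    if \<delta>: "0 < \<delta>" for \<delta> t
  proof -
    have iint: "integrable lborel (\<lambda>u. b * indicator {0..\<delta>} u)" for b :: real
      using \<delta> by (intro integrable_mult_right integrable_real_indicator) auto
    have fint: "integrable lborel (\<lambda>u. f (t - u) * indicator {0..\<delta>} u)" for t
      by (rule Bochner_Integration.integrable_bound[OF iint[of B]])
         (use absfB B0 \<delta> in \<open>auto simp: abs_mult split: split_indicator\<close>)
    have "f t * exp (- \<alpha> * \<delta>) \<le> f (t - u)" if "0 \<le> u" "u \<le> \<delta>" for u
    proof -
      have "f t * exp (- \<alpha> * \<delta>) \<le> f t * exp (- \<alpha> * (t - (t - u)))"
        using that \<alpha> f0 by (intro mult_left_mono) auto
      also have "\<dots> \<le> f (t - u)" using that by (intro mono) auto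
      finally show ?thesis .
    qed
    then have "(\<integral>u. f t * exp (- \<alpha> * \<delta>) * indicator {0..\<delta>} u \<partial>lborel) \<le> \<phi> \<delta> t"
      unfolding \<phi>_def using \<delta> by (intro integral_mono fint iint) (auto split: split_indicator)
    then have "f t * exp (- \<alpha> * \<delta>) * \<delta> \<le> \<phi> \<delta> t" using \<delta> by simp
    then show "f t \<le> exp (\<alpha> * \<delta>) * (\<phi> \<delta> t / \<delta>)"
      using \<delta> by (simp add: exp_minus field_simps)
    have "f (t + \<delta> - u) * exp (- \<alpha> * \<delta>) \<le> f t" if "0 \<le> u" "u \<le> \<delta>" for u
    proof -
      have "f (t + \<delta> - u) * exp (- \<alpha> * \<delta>) \<le> f (t + \<delta> - u) * exp (- \<alpha> * (t + \<delta> - u - t))"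
        using that \<alpha> f0 by (intro mult_left_mono) auto
      also have "\<dots> \<le> f t" using that by (intro mono) auto
      finally show ?thesis .
    qed
    then have "\<And>u. 0 \<le> u \<Longrightarrow> u \<le> \<delta> \<Longrightarrow> f (t + \<delta> - u) \<le> f t * exp (\<alpha> * \<delta>)"
      by (simp add: exp_minus field_simps)
    then have "\<phi> \<delta> (t + \<delta>) \<le> (\<integral>u. f t * exp (\<alpha> * \<delta>) * indicator {0..\<delta>} u \<partial>lborel)"
      unfolding \<phi>_def using \<delta> by (intro integral_mono fint iint) (auto split: split_indicator)
    then have "\<phi> \<delta> (t + \<delta>) \<le> f t * exp (\<alpha> * \<delta>) * \<delta>" using \<delta> by simp
    then show "exp (- \<alpha> * \<delta>) * (\<phi> \<delta> (t + \<delta>) / \<delta>) \<le> f t"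
      using \<delta> by (simp add: exp_minus field_simps)
  qed
  define c where "c = I / m"
  have "(f \<longlongrightarrow> c) at_top"
  proof (rule order_tendstoI)
    fix a assume a: "a < c"
    have "((\<lambda>\<delta>. exp (- \<alpha> * \<delta>) * c) \<longlongrightarrow> exp (- \<alpha> * 0) * c) (at_right 0)"
      by (intro tendsto_intros)
    then have "eventually (\<lambda>\<delta>. a < exp (- \<alpha> * \<delta>) * c) (at_right 0)"
      using a by (intro order_tendstoD) auto
    then have "eventually (\<lambda>\<delta>. a < exp (- \<alpha> * \<delta>) * c \<and> \<delta> > 0) (at_right 0)"
      using eventually_at_right_less[of 0] by (rule eventually_conj)
    then obtain \<delta> where \<delta>: "0 < \<delta>" "a < exp (- \<alpha> * \<delta>) * c"
      using eventually_happens'[of "at_right (0::real)"] by auto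
    have "filterlim (\<lambda>t. \<delta> + t) at_top at_top"
      by (rule filterlim_tendsto_add_at_top[OF tendsto_const filterlim_ident])
    from filterlim_compose[OF lim_\<phi>[OF \<delta>(1)] this]
    have "((\<lambda>t. \<phi> \<delta> (t + \<delta>)) \<longlongrightarrow> \<delta> * I / m) at_top" by (simp add: add.commute)
    then have "((\<lambda>t. exp (- \<alpha> * \<delta>) * (\<phi> \<delta> (t + \<delta>) / \<delta>)) \<longlongrightarrow> exp (- \<alpha> * \<delta>) * ((\<delta> * I / m) / \<delta>)) at_top"
      using \<delta> by (intro tendsto_intros) auto
    then have "eventually (\<lambda>t. a < exp (- \<alpha> * \<delta>) * (\<phi> \<delta> (t + \<delta>) / \<delta>)) at_top"
      using \<delta> by (intro order_tendstoD) (auto simp: c_def)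
    then show "eventually (\<lambda>t. a < f t) at_top"
      by eventually_elim (rule less_le_trans[OF _ lower[OF \<delta>(1)]])
  next
    fix a assume a: "c < a"
    have "((\<lambda>\<delta>. exp (\<alpha> * \<delta>) * c) \<longlongrightarrow> exp (\<alpha> * 0) * c) (at_right 0)"
      by (intro tendsto_intros)
    then have "eventually (\<lambda>\<delta>. exp (\<alpha> * \<delta>) * c < a) (at_right 0)"
      using a by (intro order_tendstoD) auto
    then have "eventually (\<lambda>\<delta>. exp (\<alpha> * \<delta>) * c < a \<and> \<delta> > 0) (at_right 0)"
      using eventually_at_right_less[of 0] by (rule eventually_conj)
    then obtain \<delta> where \<delta>: "0 < \<delta>" "exp (\<alpha> * \<delta>) * c < a"
      using eventually_happens'[of "at_right (0::real)"] by auto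
    have "((\<lambda>t. exp (\<alpha> * \<delta>) * (\<phi> \<delta> t / \<delta>)) \<longlongrightarrow> exp (\<alpha> * \<delta>) * ((\<delta> * I / m) / \<delta>)) at_top"
      using \<delta> by (intro tendsto_intros lim_\<phi>) auto
    then have "eventually (\<lambda>t. exp (\<alpha> * \<delta>) * (\<phi> \<delta> t / \<delta>) < a) at_top"
      using \<delta> by (intro order_tendstoD) (auto simp: c_def)
    then show "eventually (\<lambda>t. f t < a) at_top"
      by eventually_elim (rule le_less_trans[OF upper[OF \<delta>(1)]])
  qed
  then show ?thesis by (simp add: c_def I_def)
qed

end

section \<open>The implicit renewal theorem\<close>

lemma exp_eq_one_plus_iff: "exp u = 1 + u \<longleftrightarrow> u = (0::real)"
  using ln_eq_minus_one[of "exp u"] by auto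

text \<open>The weighted sum of the tangent inequalities of \<open>exp\<close> at \<open>\<theta> ln a\<close>.\<close>
lemma powr_interpolate:
  fixes a \<theta> \<alpha> :: real
  assumes a: "0 \<le> a" and \<theta>: "0 < \<theta>" "\<theta> < \<alpha>"
  shows "\<alpha> * a powr \<theta> \<le> \<theta> * a powr \<alpha> + (\<alpha> - \<theta>)"
    and "\<alpha> * a powr \<theta> = \<theta> * a powr \<alpha> + (\<alpha> - \<theta>) \<Longrightarrow> a = 1"
proof -
  have *: "\<alpha> * a powr \<theta> \<le> \<theta> * a powr \<alpha> + (\<alpha> - \<theta>) \<and> (\<alpha> * a powr \<theta> = \<theta> * a powr \<alpha> + (\<alpha> - \<theta>) \<longrightarrow> a = 1)"
  proof (cases "a = 0")
    case True then show ?thesis using \<theta> by simp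
  next
    case False
    define s where "s = ln a"
    have as: "a powr x = exp (x * s)" for x using False by (simp add: powr_def s_def)
    \<comment> \<open>With the weights \<open>\<theta>\<close> and
      \<open>\<alpha> - \<theta>\<close> the linear terms of the two tangent inequalities
      cancel.\<close>
    define u where "u = (\<alpha> - \<theta>) * s" define v where "v = - \<theta> * s"
    have e1: "exp (\<alpha> * s) = exp (\<theta> * s) * exp u" by (simp add: u_def exp_add[symmetric] algebra_simps)
    have e2: "1 = exp (\<theta> * s) * exp v" by (simp add: v_def exp_add[symmetric])
    have id: "\<theta> * a powr \<alpha> + (\<alpha> - \<theta>) - \<alpha> * a powr \<theta>
       = exp (\<theta> * s) * (\<theta> * (exp u - (1 + u)) + (\<alpha> - \<theta>) * (exp v - (1 + v)))"
    proof -
      have "\<theta> * a powr \<alpha> + (\<alpha> - \<theta>) * 1 - \<alpha> * a powr \<theta>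
        = exp (\<theta> * s) * (\<theta> * exp u + (\<alpha> - \<theta>) * exp v - \<alpha>)"
        unfolding as e1 by (subst e2) (simp add: algebra_simps)
      moreover have "\<theta> * exp u + (\<alpha> - \<theta>) * exp v - \<alpha> = \<theta> * (exp u - (1 + u)) + (\<alpha> - \<theta>) * (exp v - (1 + v))"
        by (simp add: u_def v_def algebra_simps)
      ultimately show ?thesis by simp
    qed
    have nn: "0 \<le> \<theta> * (exp u - (1 + u))" "0 \<le> (\<alpha> - \<theta>) * (exp v - (1 + v))"
      using \<theta> exp_ge_add_one_self[of u] exp_ge_add_one_self[of v] by auto
    have 1: "0 \<le> \<theta> * a powr \<alpha> + (\<alpha> - \<theta>) - \<alpha> * a powr \<theta>"
      unfolding id by (rule mult_nonneg_nonneg[OF exp_ge_zero add_nonneg_nonneg[OF nn]])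
    have "a = 1" if "\<theta> * a powr \<alpha> + (\<alpha> - \<theta>) - \<alpha> * a powr \<theta> = 0"
    proof -
      have "\<theta> * (exp u - (1 + u)) + (\<alpha> - \<theta>) * (exp v - (1 + v)) = 0"
        using that unfolding id by simp
      then have "\<theta> * (exp u - (1 + u)) = 0" using nn by linarith
      then have "exp u = 1 + u" using \<theta> by simp
      then have "s = 0" using \<theta> unfolding exp_eq_one_plus_iff u_def by simp
      then show ?thesis using a False by (simp add: s_def)
    qed
    with 1 show ?thesis by simp
  qed
  then show "\<alpha> * a powr \<theta> \<le> \<theta> * a powr \<alpha> + (\<alpha> - \<theta>)"
    "\<alpha> * a powr \<theta> = \<theta> * a powr \<alpha> + (\<alpha> - \<theta>) \<Longrightarrow> a = 1" by blast+
qed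

text \<open>For \<open>a = 1\<close> the logarithm is 0, which lies in every lattice. This excludes
  the equality case of the convexity inequalities.\<close>

lemma log_nonarithmetic_not_AE_1:
  assumes "log_nonarithmetic M a" shows "\<not> (AE \<omega> in M. a \<omega> = 1)"
proof
  assume "AE \<omega> in M. a \<omega> = 1"
  then have "AE \<omega> in M. a \<omega> > 0 \<longrightarrow> ln (a \<omega>) \<in> range (\<lambda>k::int. 1 * of_int k)"
    by eventually_elim (auto intro: range_eqI[of _ _ 0])
  with assms show False unfolding log_nonarithmetic_def using zero_less_one by blast
qed

context prob_space begin

lemma integrable_powr_less:
  fixes a :: "'a \<Rightarrow> real"
  assumes [measurable]: "a \<in> borel_measurable M" and a0: "\<And>\<omega>. 0 \<le> a \<omega>"
    and int: "integrable M (\<lambda>\<omega>. a \<omega> powr \<alpha>)" and \<theta>: "0 < \<theta>" "\<theta> \<le> \<alpha>"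
  shows "integrable M (\<lambda>\<omega>. a \<omega> powr \<theta>)"
proof (rule Bochner_Integration.integrable_bound[where f="\<lambda>\<omega>. 1 + a \<omega> powr \<alpha>"])
  have "a \<omega> powr \<theta> \<le> 1 + a \<omega> powr \<alpha>" for \<omega>
  proof (cases "a \<omega> \<le> 1")
    case True then show ?thesis using powr_le1[of \<theta> "a \<omega>"] \<theta> a0 by (simp add: add_increasing2)
  next
    case False then show ?thesis using powr_mono[of \<theta> \<alpha> "a \<omega>"] \<theta> by linarith
  qed
  then show "AE x in M. norm (a x powr \<theta>) \<le> norm (1 + a x powr \<alpha>)" by auto
qed (use int in auto)

text \<open>The moment function is convex in the exponent, tends to at most 1 at exponent 0 and
  equals 1 at \<open>\<alpha>\<close>; strictness in between fails only for \<open>a = 1\<close>.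
  Convexity enters through the gap \<open>d\<close>, whose mean is \<open>\<alpha>\<close> times
  \<open>1 - E a^\<theta>\<close>.\<close>

lemma expectation_powr_less_1:
  fixes a :: "'a \<Rightarrow> real"
  assumes [measurable]: "a \<in> borel_measurable M" and a0: "\<And>\<omega>. 0 \<le> a \<omega>"
    and int: "integrable M (\<lambda>\<omega>. a \<omega> powr \<alpha>)" and one: "(\<integral>\<omega>. a \<omega> powr \<alpha> \<partial>M) = 1"
    and \<theta>: "0 < \<theta>" "\<theta> < \<alpha>" and ne: "\<not> (AE \<omega> in M. a \<omega> = 1)"
  shows "(\<integral>\<omega>. a \<omega> powr \<theta> \<partial>M) < 1"
proof -
  have i\<theta>: "integrable M (\<lambda>\<omega>. a \<omega> powr \<theta>)" using integrable_powr_less[OF _ a0 int] \<theta> by auto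
  define d where "d \<omega> = \<theta> * a \<omega> powr \<alpha> + (\<alpha> - \<theta>) - \<alpha> * a \<omega> powr \<theta>" for \<omega>
  have d0: "0 \<le> d \<omega>" for \<omega> using powr_interpolate(1)[OF a0 \<theta>] by (simp add: d_def)
  have di: "integrable M d" unfolding d_def using int i\<theta> by auto
  have dv: "(\<integral>\<omega>. d \<omega> \<partial>M) = \<alpha> - \<alpha> * (\<integral>\<omega>. a \<omega> powr \<theta> \<partial>M)"
    unfolding d_def using int i\<theta> one by (simp add: prob_space)
  have "(\<integral>\<omega>. d \<omega> \<partial>M) \<noteq> 0"
  proof
    assume "(\<integral>\<omega>. d \<omega> \<partial>M) = 0"
    then have "AE \<omega> in M. d \<omega> = 0" using integral_nonneg_eq_0_iff_AE[OF di] d0 by auto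
    then have "AE \<omega> in M. a \<omega> = 1"
      by eventually_elim (rule powr_interpolate(2)[OF a0 \<theta>], simp add: d_def)
    with ne show False by simp
  qed
  moreover have "0 \<le> (\<integral>\<omega>. d \<omega> \<partial>M)" using d0 by (intro integral_nonneg_AE) auto
  ultimately have "0 < (\<integral>\<omega>. d \<omega> \<partial>M)" by linarith
  then have "0 < \<alpha> * (1 - (\<integral>\<omega>. a \<omega> powr \<theta> \<partial>M))" unfolding dv by (simp add: algebra_simps)
  then show ?thesis using \<theta> by (simp add: zero_less_mult_iff)
qed

text \<open>The product space models independence: the coefficient is read off the first coordinate
  and an independent copy of \<open>X\<close> off the second. A slice with \<open>a = 0\<close> is
  empty because \<open>y > 0\<close>.\<close>

lemma emeasure_pair_product_tail:
  fixes a X :: "'a \<Rightarrow> real"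
  assumes [measurable]: "a \<in> borel_measurable M" "X \<in> borel_measurable M" and a0: "\<And>\<omega>. 0 \<le> a \<omega>" and y: "0 < y"
  shows "emeasure (M \<Otimes>\<^sub>M M) {z \<in> space (M \<Otimes>\<^sub>M M). y < a (fst z) * X (snd z)}
    = (\<integral>\<^sup>+\<omega>. (if 0 < a \<omega> then ennreal (measure M {\<omega>' \<in> space M. y / a \<omega> < X \<omega>'}) else 0) \<partial>M)"
proof -
  have "emeasure (M \<Otimes>\<^sub>M M) {z \<in> space (M \<Otimes>\<^sub>M M). y < a (fst z) * X (snd z)}
    = (\<integral>\<^sup>+\<omega>. emeasure M (Pair \<omega> -` {z \<in> space (M \<Otimes>\<^sub>M M). y < a (fst z) * X (snd z)}) \<partial>M)"
    by (rule emeasure_pair_measure_alt) measurable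
  also have "\<dots> = (\<integral>\<^sup>+\<omega>. (if 0 < a \<omega> then ennreal (measure M {\<omega>' \<in> space M. y / a \<omega> < X \<omega>'}) else 0) \<partial>M)"
  proof (rule nn_integral_cong)
    fix \<omega> assume w: "\<omega> \<in> space M"
    have e: "Pair \<omega> -` {z \<in> space (M \<Otimes>\<^sub>M M). y < a (fst z) * X (snd z)} = {\<omega>' \<in> space M. y < a \<omega> * X \<omega>'}"
      using w by (auto simp: space_pair_measure)
    show "emeasure M (Pair \<omega> -` {z \<in> space (M \<Otimes>\<^sub>M M). y < a (fst z) * X (snd z)})
      = (if 0 < a \<omega> then ennreal (measure M {\<omega>' \<in> space M. y / a \<omega> < X \<omega>'}) else 0)"
    proof (cases "0 < a \<omega>")
      case True
      then show ?thesis unfolding e emeasure_eq_measure by (simp add: pos_divide_less_eq mult.commute)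
    next
      case False
      then have "a \<omega> = 0" using a0[of \<omega>] by simp
      then show ?thesis unfolding e using y by simp
    qed
  qed
  finally show ?thesis .
qed

lemma tail_less_eps:
  fixes X :: "'a \<Rightarrow> real"
  assumes [measurable]: "X \<in> borel_measurable M" and e: "0 < e"
  shows "\<exists>K>0. \<forall>x\<ge>K. measure M {\<omega> \<in> space M. x < X \<omega>} < e"
proof -
  have "(\<lambda>n. measure M {\<omega> \<in> space M. real n < X \<omega>}) \<longlonglongrightarrow> measure M (\<Inter>n. {\<omega> \<in> space M. real n < X \<omega>})"
    by (rule finite_Lim_measure_decseq) (auto simp: decseq_def)
  also have "(\<Inter>n. {\<omega> \<in> space M. real n < X \<omega>}) = {}"
  proof -
    have "\<exists>n. \<not> real n < X \<omega>" for \<omega> using real_arch_simple[of "X \<omega>"] by (auto simp: not_less)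
    then show ?thesis by auto
  qed
  finally have "eventually (\<lambda>n. measure M {\<omega> \<in> space M. real n < X \<omega>} < e) sequentially"
    using e by (intro order_tendstoD) auto
  then obtain N where N: "\<And>n. n \<ge> N \<Longrightarrow> measure M {\<omega> \<in> space M. real n < X \<omega>} < e"
    by (auto simp: eventually_sequentially)
  show ?thesis
  proof (intro exI[of _ "real (Suc N)"] conjI allI impI)
    fix x assume x: "real (Suc N) \<le> x"
    have "measure M {\<omega> \<in> space M. x < X \<omega>} \<le> measure M {\<omega> \<in> space M. real (Suc N) < X \<omega>}"
      using x by (intro finite_measure_mono) auto
    also have "\<dots> < e" by (rule N) simp
    finally show "measure M {\<omega> \<in> space M. x < X \<omega>} < e" .
  qed simp
qed

end

text \<open>\<open>I\<close> equals \<open>((y + d)^\<alpha> - y^\<alpha>) / \<alpha>\<close>, the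
  contribution of one sample to the integral of the renewal inhomogeneity. For
  \<open>y \<le> d\<close> the window lies below \<open>ln (2 d)\<close>; for \<open>d < y\<close>
  its length is \<open>ln (1 + d / y) \<le> (d / y)^\<kappa>\<close>, which keeps the exponent of
  \<open>y\<close> below \<open>\<alpha>\<close>. The second claim is the source of a strictly
  positive limit constant.\<close>

lemma exp_window_bounds:
  fixes y d \<alpha> \<kappa> :: real
  assumes y: "0 \<le> y" and d: "0 \<le> d" and \<alpha>: "0 < \<alpha>" and \<kappa>: "0 < \<kappa>" "\<kappa> \<le> 1"
  defines "I \<equiv> (\<integral>\<^sup>+t. ennreal (exp (\<alpha> * t)) * indicator {t. y \<le> exp t \<and> exp t < y + d} t \<partial>lborel)"
  shows "I \<le> ennreal (2 powr \<alpha> / \<alpha> * d powr \<alpha> + 2 powr \<alpha> * (d powr \<kappa> * y powr (\<alpha> - \<kappa>)))"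
    and "0 < d \<Longrightarrow> I \<noteq> 0"
proof -
  have [measurable]: "{t::real. y \<le> exp t \<and> exp t < y + d} \<in> sets borel" by measurable
  show "I \<le> ennreal (2 powr \<alpha> / \<alpha> * d powr \<alpha> + 2 powr \<alpha> * (d powr \<kappa> * y powr (\<alpha> - \<kappa>)))"
  proof (cases "d = 0")
    case True
    then have "{t. y \<le> exp t \<and> exp t < y + d} = {}" by auto
    then show ?thesis by (simp add: I_def)
  next
    case False
    then have d0: "0 < d" using d by simp
    show ?thesis
    proof (cases "y \<le> d")
      case True
      have "I \<le> (\<integral>\<^sup>+t. ennreal (exp (\<alpha> * t)) * indicator {..ln (2 * d)} t \<partial>lborel)"
        unfolding I_def
      proof (rule nn_integral_mono)
        fix t :: real
        have "t \<le> ln (2 * d)" if "exp t < y + d"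
          using that True d0 by (subst ln_ge_iff) auto
        then show "ennreal (exp (\<alpha> * t)) * indicator {t. y \<le> exp t \<and> exp t < y + d} t \<le> ennreal (exp (\<alpha> * t)) * indicator {..ln (2 * d)} t"
          by (auto split: split_indicator)
      qed
      also have "\<dots> = ennreal (exp (\<alpha> * ln (2 * d)) / \<alpha>)" by (rule nn_integral_exp_atMost[OF \<alpha>])
      also have "exp (\<alpha> * ln (2 * d)) / \<alpha> = 2 powr \<alpha> / \<alpha> * d powr \<alpha>"
        using d0 powr_mult[of 2 d \<alpha>] by (simp add: powr_def)
      also have "ennreal (2 powr \<alpha> / \<alpha> * d powr \<alpha>) \<le> ennreal (2 powr \<alpha> / \<alpha> * d powr \<alpha> + 2 powr \<alpha> * (d powr \<kappa> * y powr (\<alpha> - \<kappa>)))"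
        by (intro ennreal_leI) simp
      finally show ?thesis .
    next
      case False
      then have dy: "d < y" "0 < y" using d0 by auto
      have "I \<le> (\<integral>\<^sup>+t. ennreal ((2 * y) powr \<alpha>) * indicator {ln y..ln (y + d)} t \<partial>lborel)"
        unfolding I_def
      proof (rule nn_integral_mono)
        fix t :: real
        have "exp (\<alpha> * t) \<le> (2 * y) powr \<alpha> \<and> ln y \<le> t \<and> t \<le> ln (y + d)" if "y \<le> exp t" "exp t < y + d"
        proof (intro conjI)
          have "exp (\<alpha> * t) = exp t powr \<alpha>" by (simp add: powr_def)
          also have "\<dots> \<le> (2 * y) powr \<alpha>" using that dy \<alpha> by (intro powr_mono2) auto
          finally show "exp (\<alpha> * t) \<le> (2 * y) powr \<alpha>" .
          show "ln y \<le> t" using that dy ln_mono[of y "exp t"] by simp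
          show "t \<le> ln (y + d)" using that dy d0 by (subst ln_ge_iff) auto
        qed
        then show "ennreal (exp (\<alpha> * t)) * indicator {t. y \<le> exp t \<and> exp t < y + d} t \<le> ennreal ((2 * y) powr \<alpha>) * indicator {ln y..ln (y + d)} t"
          by (auto split: split_indicator intro!: ennreal_leI)
      qed
      also have "\<dots> = ennreal ((2 * y) powr \<alpha>) * ennreal (ln (y + d) - ln y)"
        using dy d0 by (simp add: nn_integral_cmult)
      also have "\<dots> = ennreal ((2 * y) powr \<alpha> * (ln (y + d) - ln y))"
        using dy d0 by (simp add: ennreal_mult)
      also have "\<dots> \<le> ennreal (2 powr \<alpha> / \<alpha> * d powr \<alpha> + 2 powr \<alpha> * (d powr \<kappa> * y powr (\<alpha> - \<kappa>)))"
      proof (intro ennreal_leI)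
        have "ln (y + d) - ln y = ln (1 + d / y)" using dy d0 ln_div[of "y + d" y] by (simp add: add_divide_distrib)
        also have "\<dots> \<le> d / y" using dy d0 by (intro ln_add_one_self_le_self) auto
        also have "\<dots> = (d / y) powr 1" using dy d0 by simp
        also have "\<dots> \<le> (d / y) powr \<kappa>" using dy d0 \<kappa> by (intro powr_mono') auto
        finally have "(2 * y) powr \<alpha> * (ln (y + d) - ln y) \<le> (2 * y) powr \<alpha> * (d / y) powr \<kappa>"
          by (intro mult_left_mono) auto
        also have "\<dots> = 2 powr \<alpha> * (d powr \<kappa> * y powr (\<alpha> - \<kappa>))"
          using dy d0 by (simp add: powr_mult powr_divide powr_diff)
        also have "\<dots> \<le> 2 powr \<alpha> / \<alpha> * d powr \<alpha> + 2 powr \<alpha> * (d powr \<kappa> * y powr (\<alpha> - \<kappa>))"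
          using \<alpha> by simp
        finally show "(2 * y) powr \<alpha> * (ln (y + d) - ln y) \<le> 2 powr \<alpha> / \<alpha> * d powr \<alpha> + 2 powr \<alpha> * (d powr \<kappa> * y powr (\<alpha> - \<kappa>))" .
      qed
      finally show ?thesis .
    qed
  qed
  show "I \<noteq> 0" if d0: "0 < d"
  proof
    assume "I = 0"
    then have "AE t in lborel. ennreal (exp (\<alpha> * t)) * indicator {t. y \<le> exp t \<and> exp t < y + d} t = 0"
      unfolding I_def by (subst (asm) nn_integral_0_iff_AE) auto
    \<comment> \<open>The smaller window starts at \<open>y + d / 3\<close> and not at
      \<open>y\<close>, so that \<open>exp\<close> inverts \<open>ln\<close> at its left end also
      for \<open>y = 0\<close>.\<close>
    then have ae: "AE t in lborel. t \<notin> {ln (y + d / 3)..ln (y + d / 2)}"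
    proof eventually_elim
      case (elim t)
      have "y \<le> exp t \<and> exp t < y + d" if "ln (y + d / 3) \<le> t" "t \<le> ln (y + d / 2)"
      proof
        have "y + d / 3 = exp (ln (y + d / 3))" using y d0 by simp
        also have "\<dots> \<le> exp t" using that by simp
        finally show "y \<le> exp t" using d0 by simp
        have "exp t \<le> exp (ln (y + d / 2))" using that by simp
        also have "\<dots> = y + d / 2" using y d0 by simp
        finally show "exp t < y + d" using d0 by simp
      qed
      with elim show ?case by (auto split: split_indicator_asm)
    qed
    have l: "ln (y + d / 3) < ln (y + d / 2)" using y d0 by (subst ln_less_cancel_iff) auto
    have "emeasure lborel {ln (y + d / 3)..ln (y + d / 2)} = 0"
      using ae by (subst (asm) AE_iff_measurable[where N="{ln (y + d / 3)..ln (y + d / 2)}"]) auto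
    with l show False by simp
  qed
qed

context prob_space begin

text \<open>On positive levels \<open>X\<close> has the tail of \<open>a X' + D\<close>, where
  \<open>X'\<close> is a copy of \<open>X\<close> independent of \<open>a\<close>. \<open>D\<close>
  may depend on both coordinates, since it will collect the other components of the same solution
  vector. As \<open>D \<ge> 0\<close>, the defect between the tails of \<open>X\<close> and
  \<open>a X'\<close> is nonnegative; \<open>mom1\<close> and \<open>mom2\<close> make it integrable
  with weight \<open>exp (\<alpha> t)\<close>, and \<open>mom2\<close> asks only for a power of
  \<open>X\<close> below \<open>\<alpha>\<close>.\<close>

theorem implicit_renewal:
  fixes a X :: "'a \<Rightarrow> real" and D :: "'a \<times> 'a \<Rightarrow> real" and \<alpha> \<kappa> :: real
  assumes a_meas [measurable]: "a \<in> borel_measurable M" and X_meas [measurable]: "X \<in> borel_measurable M"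
    and D_meas [measurable]: "D \<in> borel_measurable (M \<Otimes>\<^sub>M M)"
    and a0: "\<And>\<omega>. 0 \<le> a \<omega>" and X0: "\<And>\<omega>. 0 \<le> X \<omega>" and D0: "\<And>z. 0 \<le> D z"
    and \<alpha>: "0 < \<alpha>" and int: "integrable M (\<lambda>\<omega>. a \<omega> powr \<alpha>)" and one: "(\<integral>\<omega>. a \<omega> powr \<alpha> \<partial>M) = 1"
    and intlog: "integrable M (\<lambda>\<omega>. a \<omega> powr \<alpha> * max 0 (ln (a \<omega>)))"
    and nonarith: "log_nonarithmetic M a"
    and fix_eq: "\<And>x. 0 < x \<Longrightarrow> measure M {\<omega> \<in> space M. x < X \<omega>}
       = measure (M \<Otimes>\<^sub>M M) {z \<in> space (M \<Otimes>\<^sub>M M). x < a (fst z) * X (snd z) + D z}"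
    and \<kappa>: "0 < \<kappa>" "\<kappa> \<le> 1"
    and mom1: "(\<integral>\<^sup>+z. ennreal (D z powr \<alpha>) \<partial>(M \<Otimes>\<^sub>M M)) < \<infinity>"
    and mom2: "(\<integral>\<^sup>+z. ennreal (D z powr \<kappa> * (a (fst z) * X (snd z)) powr (\<alpha> - \<kappa>)) \<partial>(M \<Otimes>\<^sub>M M)) < \<infinity>"
    and Dpos: "0 < measure (M \<Otimes>\<^sub>M M) {z \<in> space (M \<Otimes>\<^sub>M M). 0 < D z}"
  shows "\<exists>C>0. ((\<lambda>x. x powr \<alpha> * measure M {\<omega> \<in> space M. x < X \<omega>}) \<longlongrightarrow> C) at_top"
    and "\<exists>K. \<forall>x>0. measure M {\<omega> \<in> space M. x < X \<omega>} \<le> K * x powr - \<alpha>"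
proof -
  interpret MM: pair_prob_space M M ..
  define M2 where "M2 = M \<Otimes>\<^sub>M M"
  interpret M2: prob_space M2 unfolding M2_def by (rule MM.prob_space_axioms)
  interpret LM2: pair_sigma_finite lborel M2 ..
  have [measurable]: "(\<lambda>z. a (fst z) * X (snd z)) \<in> borel_measurable M2" "D \<in> borel_measurable M2"
    unfolding M2_def by measurable
  define Y where "Y z = a (fst z) * X (snd z)" for z
  have Y_meas [measurable]: "Y \<in> borel_measurable M2" unfolding Y_def by measurable
  have Y0: "0 \<le> Y z" for z using a0 X0 by (simp add: Y_def)
  define G where "G x = measure M {\<omega> \<in> space M. x < X \<omega>}" for x
  have G_anti: "G y \<le> G x" if "x \<le> y" for x y unfolding G_def using that by (intro finite_measure_mono) auto
  have G01: "0 \<le> G x" "G x \<le> 1" for x by (auto simp: G_def)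
  have Gfix: "G x = measure M2 {z \<in> space M2. x < Y z + D z}" if "0 < x" for x
    unfolding G_def M2_def Y_def using fix_eq[OF that] .
  define H where "H x = measure M2 {z \<in> space M2. x < Y z}" for x
  have H_anti: "H y \<le> H x" if "x \<le> y" for x y unfolding H_def using that by (intro M2.finite_measure_mono) auto
  have [measurable]: "G \<in> borel_measurable borel"
  proof -
    have "(\<lambda>x. - G x) \<in> borel_measurable borel" by (rule borel_measurable_mono) (auto simp: mono_def G_anti)
    then show ?thesis by simp
  qed
  have [measurable]: "H \<in> borel_measurable borel"
  proof -
    have "(\<lambda>x. - H x) \<in> borel_measurable borel" by (rule borel_measurable_mono) (auto simp: mono_def H_anti)
    then show ?thesis by simp
  qed
  \<comment> \<open>The tilted law: the weight \<open>a^\<alpha>\<close> has total mass 1 and kills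
    \<open>a = 0\<close>, so the value of \<open>ln\<close> at 0 does not matter.\<close>
  define \<eta> where "\<eta> = distr (density M (\<lambda>\<omega>. ennreal (a \<omega> powr \<alpha>))) borel (\<lambda>\<omega>. ln (a \<omega>))"
  have nn_eta: "(\<integral>\<^sup>+s. h s \<partial>\<eta>) = (\<integral>\<^sup>+\<omega>. ennreal (a \<omega> powr \<alpha>) * h (ln (a \<omega>)) \<partial>M)" if "h \<in> borel_measurable borel" for h
    unfolding \<eta>_def using that by (subst nn_integral_distr) (auto simp: nn_integral_density)
  have nn_one: "(\<integral>\<^sup>+\<omega>. ennreal (a \<omega> powr \<alpha>) \<partial>M) = 1"
    using nn_integral_eq_integral[OF int] one by simp
  interpret eta: prob_space \<eta>
  proof
    have "emeasure \<eta> (space \<eta>) = (\<integral>\<^sup>+s. 1 \<partial>\<eta>)" by simp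
    also have "\<dots> = 1" by (subst nn_eta) (auto simp: nn_one)
    finally show "emeasure \<eta> (space \<eta>) = 1" .
  qed
  interpret eta: step_law \<eta>
    by standard (simp add: \<eta>_def)
  \<comment> \<open>The hypothesis controls \<open>ln a\<close> only from above; for
    \<open>0 < a < 1\<close> the bound \<open>a^\<alpha> |ln a| \<le> 1 / \<alpha>\<close> takes
    care of the rest.\<close>
  have alog: "integrable M (\<lambda>\<omega>. a \<omega> powr \<alpha> * ln (a \<omega>))"
  proof (rule Bochner_Integration.integrable_bound[where f="\<lambda>\<omega>. a \<omega> powr \<alpha> * max 0 (ln (a \<omega>)) + 1 / \<alpha>"])
    have "\<bar>a \<omega> powr \<alpha> * ln (a \<omega>)\<bar> \<le> a \<omega> powr \<alpha> * max 0 (ln (a \<omega>)) + 1 / \<alpha>" for \<omega>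
    proof -
      consider "a \<omega> = 0" | "1 \<le> a \<omega>" | "0 < a \<omega>" "a \<omega> < 1" using a0[of \<omega>] by linarith
      then show ?thesis
      proof cases
        case 3
        have "- ln (a \<omega>) * \<alpha> = ln (a \<omega> powr (- \<alpha>))" using 3 by (simp add: ln_powr)
        also have "\<dots> \<le> a \<omega> powr (- \<alpha>)" using 3 ln_le_minus_one[of "a \<omega> powr (- \<alpha>)"] by simp
        finally have "a \<omega> powr \<alpha> * (- ln (a \<omega>) * \<alpha>) \<le> a \<omega> powr \<alpha> * a \<omega> powr (- \<alpha>)" by (intro mult_left_mono) auto
        also have "\<dots> = 1" using 3 by (simp add: powr_add[symmetric])
        finally have "a \<omega> powr \<alpha> * (- ln (a \<omega>)) \<le> 1 / \<alpha>" using \<alpha> by (simp add: field_simps)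
        moreover have "ln (a \<omega>) < 0" using 3 by simp
        ultimately show ?thesis using 3 by (simp add: abs_mult max_def)
      qed (use \<alpha> in \<open>auto simp: abs_mult max_def\<close>)
    qed
    then show "AE \<omega> in M. norm (a \<omega> powr \<alpha> * ln (a \<omega>)) \<le> norm (a \<omega> powr \<alpha> * max 0 (ln (a \<omega>)) + 1 / \<alpha>)"
      by (intro AE_I2) (auto intro: order_trans[OF _ abs_ge_self])
  qed (use intlog in auto)
  have int_eta: "integrable \<eta> (\<lambda>s. s)"
  proof -
    have "integrable (density M (\<lambda>\<omega>. ennreal (a \<omega> powr \<alpha>))) (\<lambda>\<omega>. ln (a \<omega>))"
      by (subst integrable_density) (simp_all add: alog)
    then show ?thesis
      unfolding \<eta>_def by (subst integrable_distr_eq) simp_all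
  qed
  define m where "m = (\<integral>s. s \<partial>\<eta>)"
  have m_eq: "m = (\<integral>\<omega>. a \<omega> powr \<alpha> * ln (a \<omega>) \<partial>M)"
    unfolding m_def \<eta>_def by (subst integral_distr) (auto simp: integral_density)
  have m_pos: "0 < m"
  proof -
    \<comment> \<open>Subtracting a term of mean zero makes the integrand nonnegative: for
      \<open>a > 0\<close> and \<open>y = a^-\<alpha>\<close> it is
      \<open>(a^\<alpha> / \<alpha>) (y - 1 - ln y)\<close>, which vanishes only at
      \<open>a = 1\<close>; at \<open>a = 0\<close> it is \<open>1 / \<alpha>\<close>.\<close>
    define q where "q \<omega> = a \<omega> powr \<alpha> * ln (a \<omega>) - (a \<omega> powr \<alpha> - 1) / \<alpha>" for \<omega>
    have q: "0 \<le> q \<omega> \<and> (q \<omega> = 0 \<longrightarrow> a \<omega> = 1)" for \<omega>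
    proof (cases "a \<omega> = 0")
      case True then show ?thesis using \<alpha> by (simp add: q_def)
    next
      case False
      then have ap: "0 < a \<omega>" using a0[of \<omega>] by simp
      define y where "y = a \<omega> powr (- \<alpha>)"
      have y: "0 < y" "ln y = - \<alpha> * ln (a \<omega>)" "a \<omega> powr \<alpha> * y = 1"
        using ap by (auto simp: y_def ln_powr powr_add[symmetric])
      have "q \<omega> = (a \<omega> powr \<alpha> / \<alpha>) * (\<alpha> * ln (a \<omega>) - 1) + a \<omega> powr \<alpha> * y / \<alpha>"
        unfolding q_def y(3) using \<alpha> by (simp add: field_simps)
      also have "\<dots> = (a \<omega> powr \<alpha> / \<alpha>) * (y - 1 - ln y)"
        using y(2) \<alpha> by (simp add: field_simps)
      finally have q_eq: "q \<omega> = (a \<omega> powr \<alpha> / \<alpha>) * (y - 1 - ln y)" .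
      have "0 \<le> q \<omega>" unfolding q_eq using \<alpha> ln_le_minus_one[OF y(1)] by simp
      moreover have "a \<omega> = 1" if "q \<omega> = 0"
      proof -
        have "ln y = y - 1" using that ap \<alpha> unfolding q_eq by simp
        then have "y = 1" using ln_eq_minus_one[OF y(1)] by simp
        then have "\<alpha> * ln (a \<omega>) = 0" using y(2) by simp
        then show ?thesis using \<alpha> ap by simp
      qed
      ultimately show ?thesis by blast
    qed
    have qi: "integrable M q" unfolding q_def using alog int by auto
    have qv: "(\<integral>\<omega>. q \<omega> \<partial>M) = m" unfolding q_def m_eq using alog int one by (simp add: prob_space)
    have "m \<noteq> 0"
    proof
      assume "m = 0"
      then have "AE \<omega> in M. q \<omega> = 0" using integral_nonneg_eq_0_iff_AE[OF qi] q qv by auto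
      then have "AE \<omega> in M. a \<omega> = 1" by eventually_elim (use q in auto)
      then show False using log_nonarithmetic_not_AE_1[OF nonarith] by simp
    qed
    moreover have "0 \<le> m" unfolding qv[symmetric] using q by (intro integral_nonneg_AE) auto
    ultimately show ?thesis by simp
  qed
  have na: "\<not> (AE s in \<eta>. s \<in> range (\<lambda>k::int. h * of_int k))" if h: "0 < h" for h
  proof
    assume ae: "AE s in \<eta>. s \<in> range (\<lambda>k::int. h * of_int k)"
    have "countable (range (\<lambda>k::int. h * of_int k))" by simp
    then have [measurable]: "range (\<lambda>k::int. h * of_int k) \<in> sets borel"
      by (rule sets.countable[rotated]) simp
    have "AE \<omega> in density M (\<lambda>\<omega>. ennreal (a \<omega> powr \<alpha>)). ln (a \<omega>) \<in> range (\<lambda>k::int. h * of_int k)"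
      using ae unfolding \<eta>_def by (subst (asm) AE_distr_iff) simp_all
    then have "AE \<omega> in M. 0 < ennreal (a \<omega> powr \<alpha>) \<longrightarrow> ln (a \<omega>) \<in> range (\<lambda>k::int. h * of_int k)"
      by (subst (asm) AE_density) simp_all
    then have "AE \<omega> in M. a \<omega> > 0 \<longrightarrow> ln (a \<omega>) \<in> range (\<lambda>k::int. h * of_int k)"
      by eventually_elim auto
    with nonarith h show False unfolding log_nonarithmetic_def by blast
  qed
  \<comment> \<open>The tilt is undone: the transform at \<open>\<alpha>\<close> is the probability
    of \<open>a > 0\<close>.\<close>
  have ealpha: "(\<integral>\<^sup>+s. ennreal (exp (- \<alpha> * s)) \<partial>\<eta>) \<le> 1"
  proof -
    have "(\<integral>\<^sup>+s. ennreal (exp (- \<alpha> * s)) \<partial>\<eta>) = (\<integral>\<^sup>+\<omega>. ennreal (a \<omega> powr \<alpha>) * ennreal (exp (- \<alpha> * ln (a \<omega>))) \<partial>M)"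
      by (rule nn_eta) auto
    also have "\<dots> \<le> (\<integral>\<^sup>+\<omega>. 1 \<partial>M)"
    proof (rule nn_integral_mono)
      fix \<omega>
      show "ennreal (a \<omega> powr \<alpha>) * ennreal (exp (- \<alpha> * ln (a \<omega>))) \<le> 1"
        using a0[of \<omega>] by (cases "a \<omega> = 0") (auto simp: powr_def ennreal_mult[symmetric] exp_add[symmetric])
    qed
    also have "\<dots> = 1" by (simp add: emeasure_space_1)
    finally show ?thesis .
  qed
  \<comment> \<open>The transform of \<open>\<eta>\<close> at \<open>\<theta>\<close> is the moment
    of \<open>a\<close> of order \<open>\<alpha> - \<theta>\<close>, hence below 1 for any
    \<open>\<theta>\<close> strictly between 0 and \<open>\<alpha>\<close>.\<close>
  define \<theta> where "\<theta> = \<alpha> / 2"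
  have \<theta>: "0 < \<theta>" "\<theta> < \<alpha>" using \<alpha> by (auto simp: \<theta>_def)
  define \<rho> where "\<rho> = (\<integral>\<omega>. a \<omega> powr (\<alpha> - \<theta>) \<partial>M)"
  have \<rho>1: "\<rho> < 1" unfolding \<rho>_def
    by (rule expectation_powr_less_1[OF a_meas a0 int one]) (use \<theta> log_nonarithmetic_not_AE_1[OF nonarith] in auto)
  have \<rho>0: "0 \<le> \<rho>" unfolding \<rho>_def by (intro integral_nonneg_AE) auto
  have etheta: "(\<integral>\<^sup>+s. ennreal (exp (- \<theta> * s)) \<partial>\<eta>) \<le> ennreal \<rho>"
  proof -
    have "(\<integral>\<^sup>+s. ennreal (exp (- \<theta> * s)) \<partial>\<eta>) = (\<integral>\<^sup>+\<omega>. ennreal (a \<omega> powr \<alpha>) * ennreal (exp (- \<theta> * ln (a \<omega>))) \<partial>M)"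
      by (rule nn_eta) auto
    also have "\<dots> = (\<integral>\<^sup>+\<omega>. ennreal (a \<omega> powr (\<alpha> - \<theta>)) \<partial>M)"
    proof (rule nn_integral_cong)
      fix \<omega>
      show "ennreal (a \<omega> powr \<alpha>) * ennreal (exp (- \<theta> * ln (a \<omega>))) = ennreal (a \<omega> powr (\<alpha> - \<theta>))"
        using a0[of \<omega>] by (cases "a \<omega> = 0") (auto simp: powr_def ennreal_mult[symmetric] exp_add[symmetric] algebra_simps)
    qed
    also have "\<dots> = ennreal \<rho>"
      unfolding \<rho>_def using integrable_powr_less[OF a_meas a0 int, of "\<alpha> - \<theta>"] \<theta> by (intro nn_integral_eq_integral) auto
    finally show ?thesis by simp
  qed
  define f where "f t = exp (\<alpha> * t) * G (exp t)" for t
  define g where "g t = exp (\<alpha> * t) * (G (exp t) - H (exp t))" for t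
  have f_meas [measurable]: "f \<in> borel_measurable borel" unfolding f_def by measurable
  have g_meas [measurable]: "g \<in> borel_measurable borel" unfolding g_def by measurable
  have f0: "0 \<le> f t" for t using G01 by (simp add: f_def)
  have f_le: "f t \<le> exp (\<alpha> * t)" for t using G01 by (simp add: f_def mult_left_le)
  \<comment> \<open>\<open>D \<ge> 0\<close> makes the tail event of \<open>Y\<close> a part of that
    of \<open>Y + D\<close>, so the defect is itself a probability.\<close>
  have GH: "G (exp t) - H (exp t) = measure M2 {z \<in> space M2. Y z \<le> exp t \<and> exp t < Y z + D z}" for t
  proof -
    have "measure M2 ({z \<in> space M2. exp t < Y z + D z} - {z \<in> space M2. exp t < Y z})
      = measure M2 {z \<in> space M2. exp t < Y z + D z} - measure M2 {z \<in> space M2. exp t < Y z}"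
      using D0 by (intro M2.finite_measure_Diff) (auto intro: less_le_trans simp: add_increasing2)
    also have "{z \<in> space M2. exp t < Y z + D z} - {z \<in> space M2. exp t < Y z} = {z \<in> space M2. Y z \<le> exp t \<and> exp t < Y z + D z}"
      by auto
    finally show ?thesis by (simp add: Gfix H_def)
  qed
  have g0: "0 \<le> g t" for t unfolding g_def GH by simp
  \<comment> \<open>The weight \<open>a^\<alpha>\<close> cancels the factor
    \<open>exp (- \<alpha> ln a)\<close> in \<open>f (t - ln a)\<close>; what is left is the tail of
    the product of \<open>a\<close> with an independent copy of \<open>X\<close>.\<close>
  have conv: "step_conv \<eta> (\<lambda>t. ennreal (f t)) t = ennreal (exp (\<alpha> * t) * H (exp t))" for t
  proof -
    have "step_conv \<eta> (\<lambda>t. ennreal (f t)) t = (\<integral>\<^sup>+\<omega>. ennreal (a \<omega> powr \<alpha>) * ennreal (f (t - ln (a \<omega>))) \<partial>M)"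
      unfolding step_conv_def by (rule nn_eta) measurable
    also have "\<dots> = (\<integral>\<^sup>+\<omega>. ennreal (exp (\<alpha> * t)) * (if 0 < a \<omega> then ennreal (G (exp t / a \<omega>)) else 0) \<partial>M)"
    proof (rule nn_integral_cong)
      fix \<omega>
      show "ennreal (a \<omega> powr \<alpha>) * ennreal (f (t - ln (a \<omega>))) = ennreal (exp (\<alpha> * t)) * (if 0 < a \<omega> then ennreal (G (exp t / a \<omega>)) else 0)"
      proof (cases "0 < a \<omega>")
        case True
        have "a \<omega> powr \<alpha> * f (t - ln (a \<omega>)) = exp (\<alpha> * t) * G (exp t / a \<omega>)"
          using True by (simp add: f_def powr_def exp_diff algebra_simps)
        then show ?thesis using True G01 f0 by (simp add: ennreal_mult[symmetric])
      next
        case False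
        then have "a \<omega> = 0" using a0[of \<omega>] by simp
        then show ?thesis by simp
      qed
    qed
    also have "\<dots> = ennreal (exp (\<alpha> * t)) * (\<integral>\<^sup>+\<omega>. (if 0 < a \<omega> then ennreal (G (exp t / a \<omega>)) else 0) \<partial>M)"
      by (rule nn_integral_cmult) measurable
    also have "(\<integral>\<^sup>+\<omega>. (if 0 < a \<omega> then ennreal (G (exp t / a \<omega>)) else 0) \<partial>M) = ennreal (H (exp t))"
      unfolding G_def H_def M2.emeasure_eq_measure[symmetric] unfolding M2_def Y_def
      by (rule emeasure_pair_product_tail[symmetric]) (auto simp: a0)
    finally show ?thesis by (simp add: ennreal_mult H_def)
  qed
  have eq: "ennreal (f t) = step_conv \<eta> (\<lambda>t. ennreal (f t)) t + ennreal (g t)" for t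
    unfolding conv using g0[of t]
    by (subst ennreal_plus[symmetric]) (auto simp: H_def f_def g_def algebra_simps)
  have mono: "f t * exp (- \<alpha> * (t - r)) \<le> f r" if "r \<le> t" for r t
  proof -
    have "f t * exp (- \<alpha> * (t - r)) = exp (\<alpha> * r) * G (exp t)"
      by (simp add: f_def exp_add[symmetric] mult_ac algebra_simps exp_diff exp_minus field_simps)
    also have "\<dots> \<le> f r" unfolding f_def using that by (intro mult_left_mono G_anti) auto
    finally show ?thesis .
  qed
  have decay: "\<exists>K\<ge>0. \<forall>r. f r \<le> \<delta> * exp (\<alpha> * r) + K * exp (\<theta> * r)" if \<delta>: "0 < \<delta>" for \<delta>
  proof -
    obtain K where K: "0 < K" "\<forall>x\<ge>K. G x < \<delta>" using tail_less_eps[OF X_meas \<delta>] unfolding G_def by auto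
    show ?thesis
    \<comment> \<open>From \<open>K\<close> on the tail is below \<open>\<delta>\<close>; for
      \<open>exp r < K\<close> the factor \<open>exp ((\<alpha> - \<theta>) r)\<close> is at most
      this constant.\<close>
    proof (intro exI[of _ "K powr (\<alpha> - \<theta>)"] conjI allI)
      fix r
      show "f r \<le> \<delta> * exp (\<alpha> * r) + K powr (\<alpha> - \<theta>) * exp (\<theta> * r)"
      proof (cases "K \<le> exp r")
        case True
        then have "G (exp r) \<le> \<delta>" using K by (auto intro: less_imp_le)
        then have "f r \<le> \<delta> * exp (\<alpha> * r)" unfolding f_def by (simp add: mult.commute)
        then show ?thesis by (simp add: add_increasing2)
      next
        case False
        have "exp (\<alpha> * r) = exp r powr (\<alpha> - \<theta>) * exp (\<theta> * r)"
          by (simp add: powr_def exp_add[symmetric] algebra_simps)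
        also have "\<dots> \<le> K powr (\<alpha> - \<theta>) * exp (\<theta> * r)"
          using False \<theta> by (intro mult_right_mono powr_mono2) auto
        finally show ?thesis using f_le[of r] \<delta> by (simp add: add_increasing)
      qed
    qed simp
  qed
  \<comment> \<open>Fubini exchanges the average over samples with the integral over
    \<open>t\<close>, so that the window bounds apply to each sample separately.\<close>
  have nng: "(\<integral>\<^sup>+t. ennreal (g t) \<partial>lborel) = (\<integral>\<^sup>+z. (\<integral>\<^sup>+t. ennreal (exp (\<alpha> * t)) * indicator {t. Y z \<le> exp t \<and> exp t < Y z + D z} t \<partial>lborel) \<partial>M2)"
  proof -
    have "(\<integral>\<^sup>+t. ennreal (g t) \<partial>lborel) = (\<integral>\<^sup>+t. (\<integral>\<^sup>+z. ennreal (exp (\<alpha> * t)) * indicator {t. Y z \<le> exp t \<and> exp t < Y z + D z} t \<partial>M2) \<partial>lborel)"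
    proof (rule nn_integral_cong)
      fix t :: real
      have "(\<integral>\<^sup>+z. ennreal (exp (\<alpha> * t)) * indicator {t. Y z \<le> exp t \<and> exp t < Y z + D z} t \<partial>M2)
         = (\<integral>\<^sup>+z. ennreal (exp (\<alpha> * t)) * indicator {z \<in> space M2. Y z \<le> exp t \<and> exp t < Y z + D z} z \<partial>M2)"
        by (intro nn_integral_cong) (auto split: split_indicator)
      also have "\<dots> = ennreal (exp (\<alpha> * t)) * emeasure M2 {z \<in> space M2. Y z \<le> exp t \<and> exp t < Y z + D z}"
        by (rule nn_integral_cmult_indicator) measurable
      also have "\<dots> = ennreal (g t)" unfolding g_def GH by (simp add: M2.emeasure_eq_measure ennreal_mult)
      finally show "ennreal (g t) = (\<integral>\<^sup>+z. ennreal (exp (\<alpha> * t)) * indicator {t. Y z \<le> exp t \<and> exp t < Y z + D z} t \<partial>M2)" by simp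
    qed
    also have "\<dots> = (\<integral>\<^sup>+z. (\<integral>\<^sup>+t. ennreal (exp (\<alpha> * t)) * indicator {t. Y z \<le> exp t \<and> exp t < Y z + D z} t \<partial>lborel) \<partial>M2)"
    proof (rule LM2.Fubini'[symmetric])
      have "(\<lambda>(t, z). ennreal (exp (\<alpha> * t)) * indicator {t. Y z \<le> exp t \<and> exp t < Y z + D z} t)
        = (\<lambda>x. ennreal (exp (\<alpha> * fst x)) * (if Y (snd x) \<le> exp (fst x) \<and> exp (fst x) < Y (snd x) + D (snd x) then 1 else 0))"
        by (auto simp: fun_eq_iff)
      also have "\<dots> \<in> borel_measurable (lborel \<Otimes>\<^sub>M M2)" by measurable
      finally show "(\<lambda>(t, z). ennreal (exp (\<alpha> * t)) * indicator {t. Y z \<le> exp t \<and> exp t < Y z + D z} t) \<in> borel_measurable (lborel \<Otimes>\<^sub>M M2)" .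
    qed
    finally show ?thesis .
  qed
  have nng_fin: "(\<integral>\<^sup>+t. ennreal (g t) \<partial>lborel) < \<infinity>"
  proof -
    have "(\<integral>\<^sup>+t. ennreal (g t) \<partial>lborel) \<le> (\<integral>\<^sup>+z. ennreal (2 powr \<alpha> / \<alpha> * D z powr \<alpha> + 2 powr \<alpha> * (D z powr \<kappa> * Y z powr (\<alpha> - \<kappa>))) \<partial>M2)"
      unfolding nng by (intro nn_integral_mono exp_window_bounds(1) Y0 D0 \<alpha> \<kappa>)
    also have "\<dots> = (\<integral>\<^sup>+z. ennreal (2 powr \<alpha> / \<alpha>) * ennreal (D z powr \<alpha>) + ennreal (2 powr \<alpha>) * ennreal (D z powr \<kappa> * Y z powr (\<alpha> - \<kappa>)) \<partial>M2)"
      using \<alpha> by (intro nn_integral_cong) (simp add: ennreal_mult[symmetric])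
    also have "\<dots> = ennreal (2 powr \<alpha> / \<alpha>) * (\<integral>\<^sup>+z. ennreal (D z powr \<alpha>) \<partial>M2) + ennreal (2 powr \<alpha>) * (\<integral>\<^sup>+z. ennreal (D z powr \<kappa> * Y z powr (\<alpha> - \<kappa>)) \<partial>M2)"
      by (subst nn_integral_add) (auto simp: nn_integral_cmult)
    also have "\<dots> < \<infinity>"
      using mom1 mom2 unfolding M2_def Y_def by (auto simp: ennreal_mult_less_top ennreal_add_eq_top less_top[symmetric] ennreal_mult_eq_top_iff)
    finally show ?thesis .
  qed
  have g_int: "integrable lborel g" using nng_fin g0 by (intro integrableI_nonneg) auto
  \<comment> \<open>Every sample with \<open>D > 0\<close> contributes a window of positive mass, so
    \<open>g\<close> cannot vanish almost everywhere.\<close>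
  have I_pos: "0 < (\<integral>t. g t \<partial>lborel)"
  proof -
    have "(\<integral>\<^sup>+t. ennreal (g t) \<partial>lborel) \<noteq> 0"
    proof
      assume "(\<integral>\<^sup>+t. ennreal (g t) \<partial>lborel) = 0"
      moreover have "(\<lambda>z. \<integral>\<^sup>+t. ennreal (exp (\<alpha> * t)) * indicator {t. Y z \<le> exp t \<and> exp t < Y z + D z} t \<partial>lborel) \<in> borel_measurable M2"
      proof -
        have "(\<lambda>z. \<integral>\<^sup>+t. ennreal (exp (\<alpha> * t)) * indicator {t. Y z \<le> exp t \<and> exp t < Y z + D z} t \<partial>lborel)
          = (\<lambda>z. \<integral>\<^sup>+t. ennreal (exp (\<alpha> * t)) * (if Y z \<le> exp t \<and> exp t < Y z + D z then 1 else 0) \<partial>lborel)"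
          by (intro ext nn_integral_cong) auto
        also have "\<dots> \<in> borel_measurable M2" by measurable
        finally show ?thesis .
      qed
      ultimately have "AE z in M2. (\<integral>\<^sup>+t. ennreal (exp (\<alpha> * t)) * indicator {t. Y z \<le> exp t \<and> exp t < Y z + D z} t \<partial>lborel) = 0"
        unfolding nng by (subst (asm) nn_integral_0_iff_AE) auto
      then have "AE z in M2. \<not> 0 < D z"
        by eventually_elim (use exp_window_bounds(2)[OF Y0 D0 \<alpha> \<kappa>] in blast)
      then have "measure M2 {z \<in> space M2. 0 < D z} = 0"
        by (subst M2.prob_eq_0) auto
      with Dpos show False by (simp add: M2_def)
    qed
    then have "(\<integral>t. g t \<partial>lborel) \<noteq> 0"
      using nn_integral_eq_integral[OF g_int] g0 by auto
    moreover have "0 \<le> (\<integral>t. g t \<partial>lborel)" using g0 by (intro integral_nonneg_AE) auto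
    ultimately show ?thesis by simp
  qed
  have lim: "(f \<longlongrightarrow> (\<integral>r. g r \<partial>lborel) / m) at_top"
    by (rule eta.renewal_theorem[OF int_eta m_def _ na f_meas g_meas f0 f_le g0 g_int eq \<alpha> ealpha \<theta>(1) etheta \<rho>0 \<rho>1 mono decay])
       (use m_pos in auto)
  have bound: "f t \<le> exp \<alpha> * (exp \<theta> / (1 - \<rho>) * (\<integral>r. g r \<partial>lborel))" for t
    by (rule eta.renewal_solution_bounded[OF f_meas g_meas f0 g0 g_int eq \<alpha> ealpha \<theta>(1) etheta \<rho>0 \<rho>1 mono decay])
  have fx: "f (ln x) = x powr \<alpha> * measure M {\<omega> \<in> space M. x < X \<omega>}" if "0 < x" for x
    using that by (simp add: f_def G_def powr_def)
  show "\<exists>C>0. ((\<lambda>x. x powr \<alpha> * measure M {\<omega> \<in> space M. x < X \<omega>}) \<longlongrightarrow> C) at_top"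
  proof (intro exI[of _ "(\<integral>r. g r \<partial>lborel) / m"] conjI)
    show "0 < (\<integral>r. g r \<partial>lborel) / m" using I_pos m_pos by simp
    have "((\<lambda>x. f (ln x)) \<longlongrightarrow> (\<integral>r. g r \<partial>lborel) / m) at_top"
      by (rule filterlim_compose[OF lim ln_at_top])
    then show "((\<lambda>x. x powr \<alpha> * measure M {\<omega> \<in> space M. x < X \<omega>}) \<longlongrightarrow> (\<integral>r. g r \<partial>lborel) / m) at_top"
      by (rule Lim_transform_eventually) (rule eventually_mono[OF eventually_gt_at_top[of 0]], rule fx)
  qed
  show "\<exists>K. \<forall>x>0. measure M {\<omega> \<in> space M. x < X \<omega>} \<le> K * x powr - \<alpha>"
  proof (intro exI[of _ "exp \<alpha> * (exp \<theta> / (1 - \<rho>) * (\<integral>r. g r \<partial>lborel))"] allI impI)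
    fix x :: real assume x: "0 < x"
    have "measure M {\<omega> \<in> space M. x < X \<omega>} = x powr \<alpha> * measure M {\<omega> \<in> space M. x < X \<omega>} * x powr - \<alpha>"
      using x by (simp add: powr_minus)
    also have "\<dots> \<le> exp \<alpha> * (exp \<theta> / (1 - \<rho>) * (\<integral>r. g r \<partial>lborel)) * x powr - \<alpha>"
      using bound[of "ln x"] unfolding fx[OF x] by (intro mult_right_mono) auto
    finally show "measure M {\<omega> \<in> space M. x < X \<omega>} \<le> exp \<alpha> * (exp \<theta> / (1 - \<rho>) * (\<integral>r. g r \<partial>lborel)) * x powr - \<alpha>" .
  qed
qed

end

section \<open>Triangular fixed point equations\<close>

context prob_space begin

text \<open>One iteration turns a bound \<open>C x^-\<beta>\<close> into the same bound with
  \<open>C \<rho> + K\<close>. No power bound is available to start from, only that \<open>F\<close>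
  becomes small; hence the additive \<open>e\<close> in the claim, which an iteration does not
  enlarge because the average is over a probability measure. The factor \<open>c\<close> leaves room
  for cutting the level \<open>x\<close>.\<close>

lemma tail_contraction:
  fixes F :: "real \<Rightarrow> real" and a :: "'a \<Rightarrow> real" and \<beta> c K \<rho> x :: real
  assumes [measurable]: "a \<in> borel_measurable M" and a0: "\<And>\<omega>. 0 \<le> a \<omega>" and \<beta>: "0 < \<beta>" and c: "0 < c" and K: "0 \<le> K"
    and F1: "\<And>x. F x \<le> 1" and F_lim: "\<And>e. 0 < e \<Longrightarrow> \<exists>K>0. \<forall>x\<ge>K. F x < e"
    and iter: "\<And>x. 0 < x \<Longrightarrow> ennreal (F x) \<le> (\<integral>\<^sup>+\<omega>. (if 0 < a \<omega> then ennreal (F (c * x / a \<omega>)) else 0) \<partial>M) + ennreal (K * x powr - \<beta>)"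
    and ea: "(\<integral>\<^sup>+\<omega>. ennreal (a \<omega> powr \<beta>) \<partial>M) \<le> ennreal (\<rho> * c powr \<beta>)" and \<rho>: "0 \<le> \<rho>" "\<rho> < 1"
    and x: "0 < x"
  shows "F x \<le> K / (1 - \<rho>) * x powr - \<beta>"
proof -
  \<comment> \<open>\<open>K0 powr \<beta>\<close> is the price of the start: below
    \<open>K0\<close> the trivial bound 1 is at most \<open>(K0 / x)^\<beta>\<close>.\<close>
  have claim: "F x \<le> e + (K0 powr \<beta> * \<rho> ^ k + K / (1 - \<rho>)) * x powr - \<beta>"
    if x: "0 < x" and e: "0 < e" and K0: "0 < K0" "\<forall>x\<ge>K0. F x < e" for e K0 k x
    using x
  proof (induction k arbitrary: x)
    case 0
    have nn: "0 \<le> K / (1 - \<rho>) * x powr - \<beta>" using K \<rho> by simp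
    show ?case
    proof (cases "K0 \<le> x")
      case True
      then have "F x \<le> e" using K0 by (auto intro: less_imp_le)
      also have "e \<le> e + (K0 powr \<beta> * \<rho> ^ 0 + K / (1 - \<rho>)) * x powr - \<beta>" using nn by (simp add: distrib_right)
      finally show ?thesis .
    next
      case False
      have "1 \<le> (K0 / x) powr \<beta>" using False 0 \<beta> by (intro ge_one_powr_ge_zero) auto
      also have "(K0 / x) powr \<beta> = K0 powr \<beta> * x powr - \<beta>" using False 0 K0 by (simp add: powr_divide powr_minus_divide)
      finally show ?thesis using F1[of x] nn e by (simp add: distrib_right)
    qed
  next
    case (Suc k)
    define C where "C = K0 powr \<beta> * \<rho> ^ k + K / (1 - \<rho>)"
    have C0: "0 \<le> C" unfolding C_def using K \<rho> by simp
    have "(\<integral>\<^sup>+\<omega>. (if 0 < a \<omega> then ennreal (F (c * x / a \<omega>)) else 0) \<partial>M) \<le> (\<integral>\<^sup>+\<omega>. ennreal e + ennreal (C * (c * x) powr - \<beta>) * ennreal (a \<omega> powr \<beta>) \<partial>M)"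
    proof (rule nn_integral_mono)
      fix \<omega>
      show "(if 0 < a \<omega> then ennreal (F (c * x / a \<omega>)) else 0) \<le> ennreal e + ennreal (C * (c * x) powr - \<beta>) * ennreal (a \<omega> powr \<beta>)"
      proof (cases "0 < a \<omega>")
        case True
        then have p: "0 < c * x / a \<omega>" using c Suc.prems by simp
        have "F (c * x / a \<omega>) \<le> e + C * (c * x / a \<omega>) powr - \<beta>" unfolding C_def by (rule Suc.IH[OF p])
        also have "(c * x / a \<omega>) powr - \<beta> = (c * x) powr - \<beta> * a \<omega> powr \<beta>"
          using True c Suc.prems by (simp add: powr_divide powr_minus_divide powr_mult)
        finally have "ennreal (F (c * x / a \<omega>)) \<le> ennreal (e + C * (c * x) powr - \<beta> * a \<omega> powr \<beta>)"
          by (intro ennreal_leI) (simp add: mult.assoc)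
        also have "\<dots> = ennreal e + ennreal (C * (c * x) powr - \<beta>) * ennreal (a \<omega> powr \<beta>)"
          using C0 e by (simp add: ennreal_mult[symmetric])
        finally show ?thesis using True by simp
      qed simp
    qed
    also have "\<dots> = ennreal e + ennreal (C * (c * x) powr - \<beta>) * (\<integral>\<^sup>+\<omega>. ennreal (a \<omega> powr \<beta>) \<partial>M)"
      by (subst nn_integral_add) (auto simp: nn_integral_cmult emeasure_space_1)
    also have "\<dots> \<le> ennreal e + ennreal (C * (c * x) powr - \<beta>) * ennreal (\<rho> * c powr \<beta>)"
      by (intro add_mono mult_left_mono ea) auto
    also have "\<dots> = ennreal (e + C * (c * x) powr - \<beta> * (\<rho> * c powr \<beta>))"
      using C0 e \<rho> by (simp add: ennreal_mult[symmetric])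
    also have "C * (c * x) powr - \<beta> * (\<rho> * c powr \<beta>) = C * \<rho> * x powr - \<beta>"
      using c Suc.prems by (simp add: powr_mult powr_minus field_simps)
    finally have "ennreal (F x) \<le> ennreal (e + C * \<rho> * x powr - \<beta>) + ennreal (K * x powr - \<beta>)"
      using iter[OF Suc.prems] by (meson add_mono order_refl order_trans)
    also have "\<dots> = ennreal (e + (C * \<rho> + K) * x powr - \<beta>)"
      using C0 e \<rho> K by (subst ennreal_plus[symmetric]) (auto simp: algebra_simps)
    finally have "F x \<le> e + (C * \<rho> + K) * x powr - \<beta>"
      using C0 e \<rho> K by (subst (asm) ennreal_le_iff) auto
    also have "C * \<rho> + K = K0 powr \<beta> * \<rho> ^ Suc k + K / (1 - \<rho>)"
      unfolding C_def using \<rho> by (simp add: field_simps)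
    finally show ?case .
  qed
  have claim2: "F x \<le> e + K / (1 - \<rho>) * x powr - \<beta>" if e: "0 < e" for e
  proof -
    obtain K0 where K0: "0 < K0" "\<forall>x\<ge>K0. F x < e" using F_lim[OF e] by auto
    have "(\<lambda>k. e + (K0 powr \<beta> * \<rho> ^ k + K / (1 - \<rho>)) * x powr - \<beta>) \<longlonglongrightarrow> e + (K0 powr \<beta> * 0 + K / (1 - \<rho>)) * x powr - \<beta>"
      using \<rho> by (intro tendsto_intros LIMSEQ_power_zero) auto
    then show ?thesis
      using claim[OF x e K0] by (intro LIMSEQ_le_const[where X="\<lambda>k. e + (K0 powr \<beta> * \<rho> ^ k + K / (1 - \<rho>)) * x powr - \<beta>"]) auto
  qed
  show ?thesis
    by (rule field_le_epsilon) (use claim2 in \<open>simp add: add.commute\<close>)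
qed

text \<open>A power tail passes through an independent factor at the price of the moment of that
  factor of the same order, since the level becomes \<open>y / a\<close>.\<close>

lemma product_tail_bound:
  fixes a X :: "'a \<Rightarrow> real"
  assumes [measurable]: "a \<in> borel_measurable M" "X \<in> borel_measurable M" and a0: "\<And>\<omega>. 0 \<le> a \<omega>"
    and int: "integrable M (\<lambda>\<omega>. a \<omega> powr \<beta>)" and K: "0 \<le> K"
    and bound: "\<And>x. 0 < x \<Longrightarrow> measure M {\<omega> \<in> space M. x < X \<omega>} \<le> K * x powr - \<beta>" and y: "0 < y"
  shows "emeasure (M \<Otimes>\<^sub>M M) {z \<in> space (M \<Otimes>\<^sub>M M). y < a (fst z) * X (snd z)} \<le> ennreal (K * (\<integral>\<omega>. a \<omega> powr \<beta> \<partial>M) * y powr - \<beta>)"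
proof -
  have "emeasure (M \<Otimes>\<^sub>M M) {z \<in> space (M \<Otimes>\<^sub>M M). y < a (fst z) * X (snd z)}
    = (\<integral>\<^sup>+\<omega>. (if 0 < a \<omega> then ennreal (measure M {\<omega>' \<in> space M. y / a \<omega> < X \<omega>'}) else 0) \<partial>M)"
    by (rule emeasure_pair_product_tail) (use a0 y in auto)
  also have "\<dots> \<le> (\<integral>\<^sup>+\<omega>. ennreal (K * y powr - \<beta> * a \<omega> powr \<beta>) \<partial>M)"
  proof (rule nn_integral_mono)
    fix \<omega>
    show "(if 0 < a \<omega> then ennreal (measure M {\<omega>' \<in> space M. y / a \<omega> < X \<omega>'}) else 0) \<le> ennreal (K * y powr - \<beta> * a \<omega> powr \<beta>)"
    proof (cases "0 < a \<omega>")
      case True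
      have "measure M {\<omega>' \<in> space M. y / a \<omega> < X \<omega>'} \<le> K * (y / a \<omega>) powr - \<beta>"
        using True y by (intro bound) auto
      also have "(y / a \<omega>) powr - \<beta> = y powr - \<beta> * a \<omega> powr \<beta>"
        using True y by (simp add: powr_divide powr_minus_divide)
      finally show ?thesis using True by (simp add: mult.assoc ennreal_leI)
    qed simp
  qed
  also have "\<dots> = ennreal (\<integral>\<omega>. K * y powr - \<beta> * a \<omega> powr \<beta> \<partial>M)"
    using int K by (intro nn_integral_eq_integral) auto
  also have "(\<integral>\<omega>. K * y powr - \<beta> * a \<omega> powr \<beta> \<partial>M) = K * (\<integral>\<omega>. a \<omega> powr \<beta> \<partial>M) * y powr - \<beta>"
    by simp
  finally show ?thesis .
qed

text \<open>Dyadic decomposition: where \<open>X\<close> lies between \<open>2^k\<close> and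
  \<open>2^(k+1)\<close> its power is at most \<open>2^((k+1) q)\<close>, and the tail bound turns
  the expectation into a geometric series of ratio \<open>2^(q - \<gamma>)\<close>.\<close>

lemma tail_bound_moment:
  fixes X :: "'a \<Rightarrow> real"
  assumes [measurable]: "X \<in> borel_measurable M" and X0: "\<And>\<omega>. 0 \<le> X \<omega>" and K: "0 \<le> K"
    and bound: "\<And>x. 0 < x \<Longrightarrow> measure M {\<omega> \<in> space M. x < X \<omega>} \<le> K * x powr - \<gamma>" and q: "0 < q" "q < \<gamma>"
  shows "integrable M (\<lambda>\<omega>. X \<omega> powr q)"
proof -
  define f where "f k \<omega> = ennreal ((2 ^ Suc k) powr q) * indicator {\<omega> \<in> space M. 2 ^ k < X \<omega>} \<omega>" for k :: nat and \<omega>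
  have [measurable]: "f k \<in> borel_measurable M" for k unfolding f_def by measurable
  have pt: "ennreal (X \<omega> powr q) \<le> 1 + (\<Sum>k. f k \<omega>)" if w: "\<omega> \<in> space M" for \<omega>
  proof (cases "X \<omega> \<le> 1")
    case True
    then have "X \<omega> powr q \<le> 1" using X0 q by (intro powr_le1) auto
    then have "ennreal (X \<omega> powr q) \<le> 1" by simp
    then show ?thesis by (rule order_trans) simp
  next
    case False
    obtain N where "X \<omega> < 2 ^ N" using real_arch_pow[of 2 "X \<omega>"] by auto
    then have ex: "\<exists>N. X \<omega> \<le> 2 ^ N" by (auto intro: less_imp_le)
    define k where "k = (LEAST N. X \<omega> \<le> 2 ^ N)"
    have k: "X \<omega> \<le> 2 ^ k" unfolding k_def by (rule LeastI_ex[OF ex])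
    have "k \<noteq> 0" using k False by (intro notI) simp
    then obtain l where l: "k = Suc l" by (cases k) auto
    have "\<not> X \<omega> \<le> 2 ^ l" using not_less_Least[of l "\<lambda>N. X \<omega> \<le> 2 ^ N"] l k_def by simp
    then have fl: "f l \<omega> = ennreal ((2 ^ Suc l) powr q)" using w by (simp add: f_def)
    have "ennreal (X \<omega> powr q) \<le> f l \<omega>"
      unfolding fl using k l X0 q by (intro ennreal_leI powr_mono2) auto
    also have "\<dots> \<le> (\<Sum>k. f k \<omega>)" using sum_le_suminf[of "\<lambda>k. f k \<omega>" "{l}"] by (simp add: summableI)
    finally show ?thesis by (rule order_trans) simp
  qed
  have f_int: "(\<integral>\<^sup>+\<omega>. f k \<omega> \<partial>M) \<le> ennreal (2 powr q * K * (2 powr (q - \<gamma>)) ^ k)" for k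
  proof -
    have "(\<integral>\<^sup>+\<omega>. f k \<omega> \<partial>M) = ennreal ((2 ^ Suc k) powr q) * emeasure M {\<omega> \<in> space M. 2 ^ k < X \<omega>}"
      unfolding f_def by (rule nn_integral_cmult_indicator) measurable
    also have "\<dots> = ennreal ((2 ^ Suc k) powr q * measure M {\<omega> \<in> space M. 2 ^ k < X \<omega>})"
      by (simp add: emeasure_eq_measure ennreal_mult)
    also have "\<dots> \<le> ennreal ((2 ^ Suc k) powr q * (K * (2 ^ k) powr - \<gamma>))"
      by (intro ennreal_leI mult_left_mono bound) auto
    also have "(2 ^ Suc k) powr q * (K * (2 ^ k) powr - \<gamma>) = 2 powr q * K * (2 powr (q - \<gamma>)) ^ k"
    proof -
      have "(2 ^ k :: real) powr y = (2 powr y) ^ k" for y :: real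
        by (simp add: powr_realpow[symmetric] powr_powr mult.commute)
      moreover have "(2 ^ Suc k :: real) powr q = 2 powr q * (2 ^ k) powr q" by (simp add: powr_mult)
      moreover have "(2::real) powr (q - \<gamma>) = 2 powr q * 2 powr - \<gamma>" by (simp add: powr_add[symmetric])
      ultimately show ?thesis by (simp add: power_mult_distrib)
    qed
    finally show ?thesis .
  qed
  have r: "2 powr (q - \<gamma>) < (1::real)" "0 \<le> (2::real) powr (q - \<gamma>)"
    using q powr_less_mono[of "q - \<gamma>" 0 2] by auto
  have summ: "summable (\<lambda>k. 2 powr q * K * (2 powr (q - \<gamma>)) ^ k)"
    using r by (intro summable_mult summable_geometric) auto
  have "(\<integral>\<^sup>+\<omega>. ennreal (X \<omega> powr q) \<partial>M) \<le> (\<integral>\<^sup>+\<omega>. 1 + (\<Sum>k. f k \<omega>) \<partial>M)"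
    by (rule nn_integral_mono) (rule pt)
  also have "\<dots> = 1 + (\<Sum>k. \<integral>\<^sup>+\<omega>. f k \<omega> \<partial>M)"
    by (subst nn_integral_add) (auto simp: nn_integral_suminf emeasure_space_1)
  also have "\<dots> \<le> 1 + (\<Sum>k. ennreal (2 powr q * K * (2 powr (q - \<gamma>)) ^ k))"
    by (intro add_mono order_refl suminf_le f_int summableI)
  also have "\<dots> = 1 + ennreal (\<Sum>k. 2 powr q * K * (2 powr (q - \<gamma>)) ^ k)"
    using K r summ by (subst suminf_ennreal2) auto
  also have "\<dots> < \<infinity>" by simp
  finally show ?thesis by (intro integrableI_nonneg) auto
qed

end

text \<open>The affine equation in homogeneous form: index \<open>n\<close> carries the constant 1
  and column \<open>n\<close> the inhomogeneous term, so exponents concern \<open>{1..<n}\<close>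
  only. \<open>fix_eq\<close> expresses the fixed point property through tails of nonnegative
  combinations, with the matrix in the first coordinate and an independent copy of \<open>w\<close>
  in the second.\<close>

locale triangular_fixpoint = prob_space M for M :: "'a measure" +
  fixes n :: nat and a :: "nat \<Rightarrow> nat \<Rightarrow> 'a \<Rightarrow> real" and w :: "nat \<Rightarrow> 'a \<Rightarrow> real" and \<alpha> :: "nat \<Rightarrow> real"
  assumes a_meas [measurable]: "\<And>i j. a i j \<in> borel_measurable M"
    and w_meas [measurable]: "\<And>i. w i \<in> borel_measurable M"
    and a0: "\<And>i j \<omega>. 0 \<le> a i j \<omega>" and w0: "\<And>i \<omega>. 0 \<le> w i \<omega>"
    and upper: "\<And>i j \<omega>. j < i \<Longrightarrow> a i j \<omega> = 0"
    and w_last: "\<And>\<omega>. w n \<omega> = 1" and a_last: "\<And>\<omega>. a n n \<omega> = 1"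
    and \<alpha>0: "\<And>i. i \<in> {1..<n} \<Longrightarrow> 0 < \<alpha> i"
    and crit: "\<And>i. i \<in> {1..<n} \<Longrightarrow> (\<integral>\<omega>. a i i \<omega> powr \<alpha> i \<partial>M) = 1"
    and moment: "\<And>i j. i \<in> {1..<n} \<Longrightarrow> j \<in> {1..n} \<Longrightarrow> integrable M (\<lambda>\<omega>. a i j \<omega> powr \<alpha> i)"
    and log_moment: "\<And>i. i \<in> {1..<n} \<Longrightarrow> integrable M (\<lambda>\<omega>. a i i \<omega> powr \<alpha> i * max 0 (ln (a i i \<omega>)))"
    and nonarith: "\<And>i. i \<in> {1..<n} \<Longrightarrow> log_nonarithmetic M (a i i)"
    and last_pos: "\<And>i. i \<in> {1..<n} \<Longrightarrow> 0 < measure M {\<omega> \<in> space M. 0 < a i n \<omega>}"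
    and fix_eq: "\<And>p x. (\<And>j. 0 \<le> p j) \<Longrightarrow> measure M {\<omega> \<in> space M. x < (\<Sum>j=1..n. p j * w j \<omega>)}
       = measure (M \<Otimes>\<^sub>M M) {z \<in> space (M \<Otimes>\<^sub>M M). x < (\<Sum>j=1..n. p j * (\<Sum>l=1..n. a j l (fst z) * w l (snd z)))}"
begin

sublocale MM: pair_prob_space M M ..

definition tail_bound :: "real \<Rightarrow> nat \<Rightarrow> bool" where
  "tail_bound \<beta> i \<longleftrightarrow> (\<exists>K\<ge>0. \<forall>x>0. measure M {\<omega> \<in> space M. x < w i \<omega>} \<le> K * x powr - \<beta>)"

lemma tail_bound_last: "0 < \<beta> \<Longrightarrow> tail_bound \<beta> n"
  unfolding tail_bound_def
proof (intro exI[of _ 1] conjI allI impI)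
  fix x :: real assume \<beta>: "0 < \<beta>" and x: "0 < x"
  show "measure M {\<omega> \<in> space M. x < w n \<omega>} \<le> 1 * x powr - \<beta>"
  proof (cases "x < 1")
    case True
    then have "1 \<le> x powr - \<beta>" using x \<beta> powr_mono'[of "-\<beta>" 0 x] by simp
    then show ?thesis using prob_le_1 order_trans by auto
  qed (simp add: w_last)
qed simp

lemma tail_bound_mono:
  assumes tb: "tail_bound \<beta> i" and \<gamma>: "0 < \<gamma>" "\<gamma> \<le> \<beta>"
  shows "tail_bound \<gamma> i"
proof -
  obtain K where K: "0 \<le> K" "\<forall>x>0. measure M {\<omega> \<in> space M. x < w i \<omega>} \<le> K * x powr - \<beta>"
    using tb unfolding tail_bound_def by auto
  show ?thesis unfolding tail_bound_def
  proof (intro exI[of _ "max K 1"] conjI allI impI)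
    fix x :: real assume x: "0 < x"
    show "measure M {\<omega> \<in> space M. x < w i \<omega>} \<le> max K 1 * x powr - \<gamma>"
    proof (cases "x < 1")
      case True
      then have "1 \<le> x powr - \<gamma>" using x \<gamma> powr_mono'[of "-\<gamma>" 0 x] by simp
      then have "1 * 1 \<le> max K 1 * x powr - \<gamma>" by (intro mult_mono) auto
      then show ?thesis using prob_le_1 order_trans by auto
    next
      case False
      have "measure M {\<omega> \<in> space M. x < w i \<omega>} \<le> K * x powr - \<beta>" using K x by auto
      also have "\<dots> \<le> max K 1 * x powr - \<gamma>"
        using False K \<gamma> by (intro mult_mono powr_mono) auto
      finally show ?thesis .
    qed
  qed simp
qed

lemma fix_eq_single:
  assumes i: "i \<in> {1..n}"
  shows "measure M {\<omega> \<in> space M. x < w i \<omega>}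
     = measure (M \<Otimes>\<^sub>M M) {z \<in> space (M \<Otimes>\<^sub>M M). x < a i i (fst z) * w i (snd z) + (\<Sum>l\<in>{i<..n}. a i l (fst z) * w l (snd z))}"
proof -
  define p :: "nat \<Rightarrow> real" where "p j = (if j = i then 1 else 0)" for j
  have s: "(\<Sum>j=1..n. p j * f j) = f i" for f :: "nat \<Rightarrow> real"
    using i by (simp add: p_def if_distrib[of "\<lambda>x. x * _"] sum.delta cong: if_cong)
  have split: "(\<Sum>l=1..n. a i l \<omega> * w l \<omega>') = a i i \<omega> * w i \<omega>' + (\<Sum>l\<in>{i<..n}. a i l \<omega> * w l \<omega>')" for \<omega> \<omega>'
  proof -
    have "(\<Sum>l=1..n. a i l \<omega> * w l \<omega>') = (\<Sum>l=i..n. a i l \<omega> * w l \<omega>')"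
      using i by (intro sum.mono_neutral_right) (auto simp: upper)
    also have "{i..n} = insert i {i<..n}" using i by auto
    finally show ?thesis by simp
  qed
  have "measure M {\<omega> \<in> space M. x < (\<Sum>j=1..n. p j * w j \<omega>)}
       = measure (M \<Otimes>\<^sub>M M) {z \<in> space (M \<Otimes>\<^sub>M M). x < (\<Sum>j=1..n. p j * (\<Sum>l=1..n. a j l (fst z) * w l (snd z)))}"
    by (rule fix_eq) (simp add: p_def)
  then show ?thesis unfolding s split .
qed

lemma moment_le:
  assumes "i \<in> {1..<n}" "j \<in> {1..n}" "0 < \<beta>" "\<beta> \<le> \<alpha> i"
  shows "integrable M (\<lambda>\<omega>. a i j \<omega> powr \<beta>)"
  by (rule integrable_powr_less[OF a_meas a0 moment]) (use assms in auto)

lemma diag_moment_less_1: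
  assumes "i \<in> {1..<n}" "0 < \<beta>" "\<beta> < \<alpha> i"
  shows "(\<integral>\<omega>. a i i \<omega> powr \<beta> \<partial>M) < 1"
  by (rule expectation_powr_less_1[OF a_meas a0 moment crit]) (use assms nonarith log_nonarithmetic_not_AE_1 in auto)

text \<open>Below its critical exponent the diagonal entry contracts, as
  \<open>E a_ii^\<beta> < 1\<close>. If the whole sum exceeds \<open>x\<close>, then the diagonal
  term exceeds \<open>c x\<close> or one of the others exceeds \<open>\<epsilon> x\<close>; the
  latter events have probability of order \<open>x^-\<beta>\<close>, which gives the inequality
  iterated in \<open>tail_contraction\<close>.\<close>

lemma tail_bound_step:
  assumes i: "i \<in> {1..<n}" and \<beta>: "0 < \<beta>" "\<beta> < \<alpha> i"
    and tb: "\<And>j. j \<in> {i<..n} \<Longrightarrow> (\<exists>\<omega>. a i j \<omega> \<noteq> 0) \<Longrightarrow> tail_bound \<beta> j"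
  shows "tail_bound \<beta> i"
proof -
  define \<rho>0 where "\<rho>0 = (\<integral>\<omega>. a i i \<omega> powr \<beta> \<partial>M)"
  have \<rho>0: "0 \<le> \<rho>0" "\<rho>0 < 1" unfolding \<rho>0_def using diag_moment_less_1[OF i \<beta>] by (auto intro!: integral_nonneg_AE)
  \<comment> \<open>\<open>s\<close> lies strictly between the diagonal moment and 1, and
    \<open>c\<close> is chosen with \<open>c^\<beta> = s\<close>: after the loss
    \<open>c^-\<beta>\<close> the contraction ratio is still \<open>\<rho>0 / s < 1\<close>.\<close>
  define s where "s = (1 + \<rho>0) / 2"
  have s: "0 < s" "s < 1" "\<rho>0 < s" using \<rho>0 by (auto simp: s_def)
  define c where "c = s powr (1 / \<beta>)"
  have c: "0 < c" "c powr \<beta> = s" using s \<beta> by (auto simp: c_def powr_powr)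
  have c1: "c < 1" using s \<beta> powr_less_mono'[of s 0 "1/\<beta>"] by (simp add: c_def)
  define \<rho> where "\<rho> = \<rho>0 / s"
  have \<rho>: "0 \<le> \<rho>" "\<rho> < 1" using \<rho>0 s by (auto simp: \<rho>_def)
  \<comment> \<open>The room \<open>1 - c\<close> is shared among at most \<open>n\<close>
    off-diagonal terms.\<close>
  define \<epsilon> where "\<epsilon> = (1 - c) / real n"
  have n0: "0 < real n" using i by simp
  have \<epsilon>: "0 < \<epsilon>" using c1 n0 by (simp add: \<epsilon>_def)
  let ?N = "M \<Otimes>\<^sub>M M"
  have "\<exists>K\<ge>0. \<forall>x>0. emeasure ?N {z \<in> space ?N. \<epsilon> * x < a i l (fst z) * w l (snd z)} \<le> ennreal (K * x powr - \<beta>)" if l: "l \<in> {i<..n}" for l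
  proof (cases "\<exists>\<omega>. a i l \<omega> \<noteq> 0")
    case True
    then obtain K where K: "0 \<le> K" "\<forall>x>0. measure M {\<omega> \<in> space M. x < w l \<omega>} \<le> K * x powr - \<beta>"
      using tb[OF l] unfolding tail_bound_def by auto
    define E where "E = (\<integral>\<omega>. a i l \<omega> powr \<beta> \<partial>M)"
    have E0: "0 \<le> E" unfolding E_def by (intro integral_nonneg_AE) auto
    show ?thesis
    proof (intro exI[of _ "K * E * \<epsilon> powr - \<beta>"] conjI allI impI)
      show "0 \<le> K * E * \<epsilon> powr - \<beta>" using K E0 by simp
      fix x :: real assume x: "0 < x"
      have "emeasure ?N {z \<in> space ?N. \<epsilon> * x < a i l (fst z) * w l (snd z)} \<le> ennreal (K * E * (\<epsilon> * x) powr - \<beta>)"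
        unfolding E_def using i l \<beta> K x \<epsilon> by (intro product_tail_bound moment_le a0) auto
      then show "emeasure ?N {z \<in> space ?N. \<epsilon> * x < a i l (fst z) * w l (snd z)} \<le> ennreal (K * E * \<epsilon> powr - \<beta> * x powr - \<beta>)"
        using x \<epsilon> by (simp add: powr_mult mult.assoc)
    qed
  next
    case False
    have "emeasure ?N {z \<in> space ?N. \<epsilon> * x < a i l (fst z) * w l (snd z)} \<le> ennreal (0 * x powr - \<beta>)" if "0 < x" for x
    proof -
      have "{z \<in> space ?N. \<epsilon> * x < a i l (fst z) * w l (snd z)} = {}" using that \<epsilon> False by (auto simp: not_less)
      then show ?thesis by (simp only: emeasure_empty) simp
    qed
    then show ?thesis by (intro exI[of _ 0] conjI allI impI order_refl)
  qed
  then have "\<forall>l\<in>{i<..n}. \<exists>K. 0 \<le> K \<and> (\<forall>x>0. emeasure ?N {z \<in> space ?N. \<epsilon> * x < a i l (fst z) * w l (snd z)} \<le> ennreal (K * x powr - \<beta>))"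
    by blast
  from bchoice[OF this] obtain K where K0: "\<And>l. l \<in> {i<..n} \<Longrightarrow> 0 \<le> K l"
    and K: "\<And>l x. l \<in> {i<..n} \<Longrightarrow> 0 < x \<Longrightarrow> emeasure ?N {z \<in> space ?N. \<epsilon> * x < a i l (fst z) * w l (snd z)} \<le> ennreal (K l * x powr - \<beta>)"
    by blast
  define K' where "K' = (\<Sum>l\<in>{i<..n}. K l)"
  have K'0: "0 \<le> K'" unfolding K'_def using K0 by (intro sum_nonneg) auto
  define F where "F x = measure M {\<omega> \<in> space M. x < w i \<omega>}" for x
  have "F x \<le> K' / (1 - \<rho>) * x powr - \<beta>" if x: "0 < x" for x
  proof (rule tail_contraction[where a="a i i" and c=c and F=F])
    show "\<exists>K>0. \<forall>x\<ge>K. F x < e" if "0 < e" for e unfolding F_def using that by (intro tail_less_eps) auto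
    show "(\<integral>\<^sup>+\<omega>. ennreal (a i i \<omega> powr \<beta>) \<partial>M) \<le> ennreal (\<rho> * c powr \<beta>)"
    proof -
      have "(\<integral>\<^sup>+\<omega>. ennreal (a i i \<omega> powr \<beta>) \<partial>M) = ennreal \<rho>0"
        unfolding \<rho>0_def using i \<beta> by (intro nn_integral_eq_integral moment_le) auto
      then show ?thesis using s c by (simp add: \<rho>_def)
    qed
    fix x :: real assume x: "0 < x"
    have sub: "{z \<in> space ?N. x < a i i (fst z) * w i (snd z) + (\<Sum>l\<in>{i<..n}. a i l (fst z) * w l (snd z))}
       \<subseteq> {z \<in> space ?N. c * x < a i i (fst z) * w i (snd z)} \<union> (\<Union>l\<in>{i<..n}. {z \<in> space ?N. \<epsilon> * x < a i l (fst z) * w l (snd z)})"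
    proof
      fix z assume z: "z \<in> {z \<in> space ?N. x < a i i (fst z) * w i (snd z) + (\<Sum>l\<in>{i<..n}. a i l (fst z) * w l (snd z))}"
      show "z \<in> {z \<in> space ?N. c * x < a i i (fst z) * w i (snd z)} \<union> (\<Union>l\<in>{i<..n}. {z \<in> space ?N. \<epsilon> * x < a i l (fst z) * w l (snd z)})"
      proof (rule ccontr)
        assume n: "\<not> ?thesis"
        have "(\<Sum>l\<in>{i<..n}. a i l (fst z) * w l (snd z)) \<le> (\<Sum>l\<in>{i<..n}. \<epsilon> * x)"
          using n z by (intro sum_mono) (auto simp: not_less)
        also have "\<dots> = real (n - i) * (\<epsilon> * x)" by simp
        also have "\<dots> \<le> real n * (\<epsilon> * x)" using \<epsilon> x by (intro mult_right_mono) auto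
        also have "\<dots> = (1 - c) * x" using n0 by (simp add: \<epsilon>_def)
        finally show False using n z by (auto simp: not_less algebra_simps)
      qed
    qed
    have "ennreal (F x) = emeasure ?N {z \<in> space ?N. x < a i i (fst z) * w i (snd z) + (\<Sum>l\<in>{i<..n}. a i l (fst z) * w l (snd z))}"
      unfolding F_def using i by (subst fix_eq_single) (auto simp: MM.emeasure_eq_measure)
    also have "\<dots> \<le> emeasure ?N ({z \<in> space ?N. c * x < a i i (fst z) * w i (snd z)} \<union> (\<Union>l\<in>{i<..n}. {z \<in> space ?N. \<epsilon> * x < a i l (fst z) * w l (snd z)}))"
      by (rule emeasure_mono[OF sub]) measurable
    also have "\<dots> \<le> emeasure ?N {z \<in> space ?N. c * x < a i i (fst z) * w i (snd z)} + emeasure ?N (\<Union>l\<in>{i<..n}. {z \<in> space ?N. \<epsilon> * x < a i l (fst z) * w l (snd z)})"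
      by (rule emeasure_subadditive) measurable
    also have "emeasure ?N (\<Union>l\<in>{i<..n}. {z \<in> space ?N. \<epsilon> * x < a i l (fst z) * w l (snd z)}) \<le> (\<Sum>l\<in>{i<..n}. emeasure ?N {z \<in> space ?N. \<epsilon> * x < a i l (fst z) * w l (snd z)})"
      by (rule emeasure_subadditive_finite) auto
    also have "(\<Sum>l\<in>{i<..n}. emeasure ?N {z \<in> space ?N. \<epsilon> * x < a i l (fst z) * w l (snd z)}) \<le> (\<Sum>l\<in>{i<..n}. ennreal (K l * x powr - \<beta>))"
      using x by (intro sum_mono K) auto
    also have "\<dots> = ennreal (K' * x powr - \<beta>)"
      unfolding K'_def sum_distrib_right using K0 by (intro sum_ennreal) auto
    also have "emeasure ?N {z \<in> space ?N. c * x < a i i (fst z) * w i (snd z)} = (\<integral>\<^sup>+\<omega>. (if 0 < a i i \<omega> then ennreal (F (c * x / a i i \<omega>)) else 0) \<partial>M)"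
      unfolding F_def using c x by (intro emeasure_pair_product_tail a0) auto
    finally show "ennreal (F x) \<le> (\<integral>\<^sup>+\<omega>. (if 0 < a i i \<omega> then ennreal (F (c * x / a i i \<omega>)) else 0) \<partial>M) + ennreal (K' * x powr - \<beta>)"
      by (simp add: add_mono)
  qed (use \<beta> c K'0 \<rho> x a0 in \<open>auto simp: F_def\<close>)
  then show ?thesis
    unfolding tail_bound_def F_def using K'0 \<rho> by (intro exI[of _ "K' / (1 - \<rho>)"]) auto
qed

end

section \<open>Mixed moments and the critical index\<close>

lemma sum_powr_le:
  fixes y :: "'b \<Rightarrow> real"
  assumes "finite S" "card S \<le> N" "\<And>l. l \<in> S \<Longrightarrow> 0 \<le> y l" "0 < q"
  shows "(\<Sum>l\<in>S. y l) powr q \<le> real N powr q * (\<Sum>l\<in>S. y l powr q)"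
proof (cases "S = {}")
  case False
  define m where "m = Max (y ` S)"
  have mS: "m \<in> y ` S" unfolding m_def using assms False by (intro Max_in) auto
  then obtain l where l: "l \<in> S" "m = y l" by auto
  have m0: "0 \<le> m" using l assms by auto
  have "(\<Sum>l\<in>S. y l) \<le> (\<Sum>l\<in>S. m)" unfolding m_def using assms by (intro sum_mono Max_ge) auto
  also have "\<dots> \<le> real N * m" using assms m0 by (simp add: mult_right_mono)
  finally have "(\<Sum>l\<in>S. y l) powr q \<le> (real N * m) powr q"
    using assms by (intro powr_mono2 sum_nonneg) auto
  also have "\<dots> = real N powr q * m powr q" using m0 by (simp add: powr_mult)
  also have "m powr q \<le> (\<Sum>l\<in>S. y l powr q)"
    using l assms member_le_sum[of l S "\<lambda>l. y l powr q"] by auto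
  finally show ?thesis by (simp add: mult_left_mono)
qed auto

text \<open>A Young inequality without constants: whichever of \<open>u^(\<kappa> \<tau>)\<close>
  and \<open>v^s\<close> is larger absorbs the other. The parameter \<open>\<tau>\<close>
  distributes the exponents between the two factors.\<close>

lemma powr_mult_powr_le:
  fixes u v :: real
  assumes u: "0 \<le> u" and v: "0 \<le> v" and \<kappa>: "0 < \<kappa>" and s: "0 < s" and \<tau>: "0 < \<tau>"
  shows "u powr \<kappa> * v powr s \<le> u powr (\<kappa> * (1 + \<tau>)) + v powr (s * (1 + 1 / \<tau>))"
proof (cases "v powr s \<le> u powr (\<kappa> * \<tau>)")
  case True
  then have "u powr \<kappa> * v powr s \<le> u powr \<kappa> * u powr (\<kappa> * \<tau>)" by (intro mult_left_mono) auto
  also have "\<dots> = u powr (\<kappa> * (1 + \<tau>))" by (simp add: powr_add[symmetric] distrib_left)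
  finally show ?thesis by (simp add: add_increasing2)
next
  case False
  have "u powr \<kappa> = (u powr (\<kappa> * \<tau>)) powr (1 / \<tau>)" using \<tau> by (simp add: powr_powr)
  also have "\<dots> \<le> (v powr s) powr (1 / \<tau>)" using False \<tau> by (intro powr_mono2) auto
  also have "\<dots> = v powr (s * (1 / \<tau>))" by (simp add: powr_powr)
  finally have "u powr \<kappa> * v powr s \<le> v powr (s * (1 / \<tau>)) * v powr s" by (intro mult_right_mono) auto
  also have "\<dots> = v powr (s * (1 + 1 / \<tau>))" by (simp add: powr_add[symmetric] distrib_left add.commute)
  finally show ?thesis by (simp add: add_increasing)
qed

lemma (in prob_space) nn_integral_pair_mult:
  assumes [measurable]: "u \<in> borel_measurable M" "v \<in> borel_measurable M"
  shows "(\<integral>\<^sup>+z. u (fst z) * v (snd z) \<partial>(M \<Otimes>\<^sub>M M)) = (\<integral>\<^sup>+\<omega>. u \<omega> \<partial>M) * (\<integral>\<^sup>+\<omega>. v \<omega> \<partial>M)"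
proof -
  interpret MM: pair_prob_space M M ..
  have "(\<integral>\<^sup>+z. u (fst z) * v (snd z) \<partial>(M \<Otimes>\<^sub>M M)) = (\<integral>\<^sup>+\<omega>. \<integral>\<^sup>+\<omega>'. u \<omega> * v \<omega>' \<partial>M \<partial>M)"
    by (subst nn_integral_fst[symmetric]) auto
  then show ?thesis by (simp add: nn_integral_cmult nn_integral_multc)
qed

lemma exists_exponent_above:
  assumes "finite S" "\<And>s. s \<in> S \<Longrightarrow> x < s"
  shows "\<exists>y::real. x < y \<and> (\<forall>s\<in>S. y < s)"
proof (cases "S = {}")
  case True then show ?thesis using lt_ex gt_ex by blast
next
  case False
  then obtain y where "x < y" "y < Min S" using assms dense[of x "Min S"] by (auto)
  then show ?thesis using assms False by auto
qed

context triangular_fixpoint begin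

text \<open>Closed under successors in the graph of the matrix. An edge means that the entry is not
  identically zero, a pointwise condition, so that entries without an edge drop out of sums with no
  exceptional null set.\<close>

definition closed_set :: "nat set \<Rightarrow> bool" where
  "closed_set R \<longleftrightarrow> R \<subseteq> {1..n} \<and> (\<forall>i\<in>R. \<forall>j\<in>{1..n}. (\<exists>\<omega>. a i j \<omega> \<noteq> 0) \<longrightarrow> j \<in> R)"

lemma closed_set_above:
  assumes R: "closed_set R" shows "closed_set (R \<inter> {i<..})" "closed_set (R \<inter> {i..})"
proof -
  have *: "k \<le> l" if "a k l \<omega> \<noteq> 0" for k l \<omega> using upper[of l k \<omega>] that by (cases "l < k") auto
  show "closed_set (R \<inter> {i<..})" "closed_set (R \<inter> {i..})"
    using R unfolding closed_set_def by (auto dest: * intro: less_le_trans le_trans)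
qed

text \<open>Descending induction along the triangular order: an off-diagonal term of row
  \<open>j\<close> with nonvanishing coefficient belongs to an index of \<open>R\<close> beyond
  \<open>j\<close>.\<close>

lemma tail_bound_closed:
  assumes R: "closed_set R" and \<beta>: "0 < \<beta>"
    and *: "\<And>j. j \<in> R \<Longrightarrow> j < n \<Longrightarrow> \<beta> < \<alpha> j \<or> tail_bound \<beta> j"
    and j: "j \<in> R"
  shows "tail_bound \<beta> j"
  using j
proof (induction "n - j" arbitrary: j rule: less_induct)
  case less
  have jn: "j \<in> {1..n}" using less.prems R by (auto simp: closed_set_def)
  show ?case
  proof (cases "j = n")
    case True then show ?thesis using tail_bound_last[OF \<beta>] by simp
  next
    case False
    then have jn': "j \<in> {1..<n}" using jn by auto
    show ?thesis
    proof (cases "tail_bound \<beta> j")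
      case False
      then have b: "\<beta> < \<alpha> j" using *[OF less.prems] jn' by auto
      show ?thesis
      proof (rule tail_bound_step[OF jn' \<beta> b])
        fix l assume l: "l \<in> {j<..n}" "\<exists>\<omega>. a j l \<omega> \<noteq> 0"
        then have "l \<in> R" using less.prems R by (auto simp: closed_set_def)
        then show "tail_bound \<beta> l" using l by (intro less.hyps) auto
      qed
    qed
  qed
qed

lemma tail_bound_integrable:
  assumes "tail_bound \<beta> i" "0 < q" "q < \<beta>"
  shows "integrable M (\<lambda>\<omega>. w i \<omega> powr q)"
  using assms tail_bound_moment[OF w_meas w0] unfolding tail_bound_def by blast

text \<open>All components of \<open>R\<close> beyond \<open>i\<close> have tails of a common order
  \<open>\<beta> > \<alpha> i\<close>, so the sum \<open>D\<close> of their contributions has a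
  moment of order \<open>\<alpha> i\<close>, while \<open>w i\<close> has moments of every smaller
  positive order. The implicit renewal theorem applies once the mixed moment of \<open>D\<close> and
  the diagonal term is split by the Young inequality with unequal exponents.\<close>

theorem critical_tail:
  assumes i: "i \<in> {1..<n}" and R: "closed_set R" "i \<in> R"
    and \<alpha>_less: "\<And>j. j \<in> R \<Longrightarrow> i < j \<Longrightarrow> j < n \<Longrightarrow> \<alpha> i < \<alpha> j"
  shows "\<exists>C>0. ((\<lambda>x. x powr \<alpha> i * measure M {\<omega> \<in> space M. x < w i \<omega>}) \<longlongrightarrow> C) at_top"
    and "tail_bound (\<alpha> i) i"
    and "\<exists>\<beta>>\<alpha> i. \<forall>j\<in>R \<inter> {i<..}. tail_bound \<beta> j"
proof -
  have ai: "0 < \<alpha> i" using \<alpha>0[OF i] .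
  obtain \<beta> where \<beta>: "\<alpha> i < \<beta>" "\<And>j. j \<in> R \<inter> {i<..} \<Longrightarrow> j < n \<Longrightarrow> \<beta> < \<alpha> j"
  proof -
    have "finite (\<alpha> ` (R \<inter> {i<..<n}))" using R by auto
    then have "\<exists>y>\<alpha> i. \<forall>s\<in>\<alpha> ` (R \<inter> {i<..<n}). y < s"
      by (rule exists_exponent_above) (use \<alpha>_less in auto)
    then obtain y where y: "\<alpha> i < y" "\<forall>s\<in>\<alpha> ` (R \<inter> {i<..<n}). y < s" by blast
    show ?thesis by (rule that[OF y(1)]) (use y(2) in auto)
  qed
  have tb\<beta>: "tail_bound \<beta> j" if "j \<in> R \<inter> {i<..}" for j
    using that \<beta> ai by (intro tail_bound_closed[OF closed_set_above(1)[OF R(1), of i], of \<beta> j]) auto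
  then show "\<exists>\<beta>>\<alpha> i. \<forall>j\<in>R \<inter> {i<..}. tail_bound \<beta> j" using \<beta> by blast
  have succ: "j \<in> R \<inter> {i<..}" if "j \<in> {i<..n}" "\<exists>\<omega>. a i j \<omega> \<noteq> 0" for j
    using that R unfolding closed_set_def by auto
  have tb\<gamma>: "tail_bound \<gamma> i" if "0 < \<gamma>" "\<gamma> < \<alpha> i" for \<gamma>
  proof (rule tail_bound_step[OF i that])
    fix j assume "j \<in> {i<..n}" "\<exists>\<omega>. a i j \<omega> \<noteq> 0"
    then have "tail_bound \<beta> j" by (intro tb\<beta> succ)
    then show "tail_bound \<gamma> j" by (rule tail_bound_mono) (use that \<beta> in auto)
  qed
  let ?N = "M \<Otimes>\<^sub>M M"
  define D where "D z = (\<Sum>l\<in>{i<..n}. a i l (fst z) * w l (snd z))" for z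
  \<comment> \<open>\<open>implicit_renewal\<close> wants \<open>\<kappa> \<le> 1\<close>, and
    \<open>\<kappa> < \<alpha> i\<close> leaves a positive power for the diagonal term.\<close>
  define \<kappa> where "\<kappa> = min 1 (\<alpha> i / 2)"
  have \<kappa>: "0 < \<kappa>" "\<kappa> \<le> 1" "\<kappa> < \<alpha> i" using ai by (auto simp: \<kappa>_def)
  define p where "p = (\<alpha> i + \<beta>) / 2"
  have p: "\<alpha> i < p" "p < \<beta>" "0 < p" using \<beta> ai by (auto simp: p_def)
  \<comment> \<open>The Young exponent paired with \<open>p\<close>: for
    \<open>\<kappa> (1 + \<tau>) = p\<close> it equals
    \<open>(\<alpha> i - \<kappa>) p / (p - \<kappa>)\<close>, which is below
    \<open>\<alpha> i\<close> because \<open>p > \<alpha> i\<close>. Thus the excess moment of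
    \<open>w l\<close> pays for the missing moment of \<open>w i\<close>.\<close>
  define q where "q = (\<alpha> i - \<kappa>) * (1 + 1 / (p / \<kappa> - 1))"
  have pk: "0 < p / \<kappa> - 1" using p \<kappa> by (simp add: field_simps)
  have q: "0 < q" "q < \<alpha> i"
  proof -
    show "0 < q" unfolding q_def using \<kappa> pk by (intro mult_pos_pos add_pos_pos) auto
    have "1 + 1 / (p / \<kappa> - 1) = p / (p - \<kappa>)" using pk p \<kappa> by (simp add: field_simps)
    then have q_eq: "q = (\<alpha> i - \<kappa>) * p / (p - \<kappa>)" by (simp add: q_def)
    have "(\<alpha> i - \<kappa>) * p < \<alpha> i * (p - \<kappa>)" using p \<kappa> by (simp add: algebra_simps)
    then show "q < \<alpha> i" unfolding q_eq using p \<kappa> by (simp add: divide_less_eq)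
  qed
  \<comment> \<open>Between \<open>q\<close> and \<open>\<alpha> i\<close>: a tail of order
    \<open>\<gamma>\<close> gives the moment of order \<open>q\<close>.\<close>
  define \<gamma> where "\<gamma> = (q + \<alpha> i) / 2"
  have \<gamma>: "0 < \<gamma>" "q < \<gamma>" "\<gamma> < \<alpha> i" using q by (auto simp: \<gamma>_def)
  have wq: "integrable M (\<lambda>\<omega>. w i \<omega> powr q)"
    by (rule tail_bound_integrable[OF tb\<gamma>]) (use \<gamma> q in auto)
  have fin: "(\<integral>\<^sup>+\<omega>. ennreal (h \<omega>) \<partial>M) < \<infinity>" if "integrable M h" for h :: "'a \<Rightarrow> real"
  proof -
    have "(\<integral>\<^sup>+\<omega>. ennreal (h \<omega>) \<partial>M) \<le> (\<integral>\<^sup>+\<omega>. ennreal (norm (h \<omega>)) \<partial>M)"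
      by (intro nn_integral_mono ennreal_leI) simp
    also have "\<dots> < \<infinity>" using that unfolding integrable_iff_bounded by (rule conjunct2)
    finally show ?thesis .
  qed
  have fin_prod: "(\<integral>\<^sup>+z. ennreal (u (fst z) * v (snd z)) \<partial>?N) < \<infinity>"
    if "integrable M u" "integrable M v" "\<And>\<omega>. 0 \<le> u \<omega>" "\<And>\<omega>. 0 \<le> v \<omega>" for u v :: "'a \<Rightarrow> real"
  proof -
    have "(\<integral>\<^sup>+z. ennreal (u (fst z) * v (snd z)) \<partial>?N) = (\<integral>\<^sup>+z. ennreal (u (fst z)) * ennreal (v (snd z)) \<partial>?N)"
      using that by (simp add: ennreal_mult)
    also have "\<dots> = (\<integral>\<^sup>+\<omega>. ennreal (u \<omega>) \<partial>M) * (\<integral>\<^sup>+\<omega>. ennreal (v \<omega>) \<partial>M)"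
      using that by (intro nn_integral_pair_mult) auto
    also have "\<dots> < \<infinity>" using fin[OF that(1)] fin[OF that(2)] by (simp add: ennreal_mult_less_top)
    finally show ?thesis .
  qed
  have term1: "(\<integral>\<^sup>+z. ennreal ((a i l (fst z) * w l (snd z)) powr \<alpha> i) \<partial>?N) < \<infinity>" if l: "l \<in> {i<..n}" for l
  proof (cases "\<exists>\<omega>. a i l \<omega> \<noteq> 0")
    case True
    have "integrable M (\<lambda>\<omega>. w l \<omega> powr \<alpha> i)"
      by (rule tail_bound_integrable[OF tb\<beta>[OF succ[OF l True]] ai \<beta>(1)])
    moreover have "integrable M (\<lambda>\<omega>. a i l \<omega> powr \<alpha> i)" using i l by (intro moment) auto
    ultimately show ?thesis
      using fin_prod[of "\<lambda>\<omega>. a i l \<omega> powr \<alpha> i" "\<lambda>\<omega>. w l \<omega> powr \<alpha> i"] a0 w0 by (simp add: powr_mult)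
  qed simp
  have term2: "(\<integral>\<^sup>+z. ennreal ((a i l (fst z) * w l (snd z)) powr \<kappa> * (a i i (fst z) * w i (snd z)) powr (\<alpha> i - \<kappa>)) \<partial>?N) < \<infinity>"
    if l: "l \<in> {i<..n}" for l
  proof (cases "\<exists>\<omega>. a i l \<omega> \<noteq> 0")
    case True
    have wl: "integrable M (\<lambda>\<omega>. w l \<omega> powr p)"
      by (rule tail_bound_integrable[OF tb\<beta>[OF succ[OF l True]] p(3,2)])
    have al: "integrable M (\<lambda>\<omega>. a i l \<omega> powr \<alpha> i)" "integrable M (\<lambda>\<omega>. a i i \<omega> powr \<alpha> i)" using i l by (auto intro!: moment)
    \<comment> \<open>Both matrix entries have moments of order \<open>\<alpha> i\<close>, and
      \<open>\<tau> = (\<alpha> i - \<kappa>) / \<kappa>\<close> makes both Young exponents equal to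
      it.\<close>
    have 1: "integrable M (\<lambda>\<omega>. a i l \<omega> powr \<kappa> * a i i \<omega> powr (\<alpha> i - \<kappa>))"
    proof (rule Bochner_Integration.integrable_bound[OF Bochner_Integration.integrable_add[OF al]])
      have e: "\<kappa> * (1 + (\<alpha> i - \<kappa>) / \<kappa>) = \<alpha> i" "(\<alpha> i - \<kappa>) * (1 + 1 / ((\<alpha> i - \<kappa>) / \<kappa>)) = \<alpha> i"
        using \<kappa> by (simp_all add: field_simps)
      have "a i l \<omega> powr \<kappa> * a i i \<omega> powr (\<alpha> i - \<kappa>) \<le> a i l \<omega> powr \<alpha> i + a i i \<omega> powr \<alpha> i" for \<omega>
        using powr_mult_powr_le[OF a0[of i l \<omega>] a0[of i i \<omega>] \<kappa>(1), of "\<alpha> i - \<kappa>" "(\<alpha> i - \<kappa>) / \<kappa>"] \<kappa> unfolding e by simp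
      then show "AE \<omega> in M. norm (a i l \<omega> powr \<kappa> * a i i \<omega> powr (\<alpha> i - \<kappa>)) \<le> norm (a i l \<omega> powr \<alpha> i + a i i \<omega> powr \<alpha> i)"
        by (simp add: abs_mult)
    qed auto
    have 2: "integrable M (\<lambda>\<omega>. w l \<omega> powr \<kappa> * w i \<omega> powr (\<alpha> i - \<kappa>))"
    proof (rule Bochner_Integration.integrable_bound[OF Bochner_Integration.integrable_add[OF wl wq]])
      have e: "\<kappa> * (1 + (p / \<kappa> - 1)) = p" using \<kappa> by simp
      have "w l \<omega> powr \<kappa> * w i \<omega> powr (\<alpha> i - \<kappa>) \<le> w l \<omega> powr p + w i \<omega> powr q" for \<omega>
        using powr_mult_powr_le[OF w0[of l \<omega>] w0[of i \<omega>] \<kappa>(1), of "\<alpha> i - \<kappa>" "p / \<kappa> - 1"] \<kappa> pk unfolding e q_def by simp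
      then show "AE \<omega> in M. norm (w l \<omega> powr \<kappa> * w i \<omega> powr (\<alpha> i - \<kappa>)) \<le> norm (w l \<omega> powr p + w i \<omega> powr q)"
        by (simp add: abs_mult)
    qed auto
    show ?thesis
      using fin_prod[OF 1 2] a0 w0 by (simp add: powr_mult mult_ac)
  qed simp
  have card: "card {i<..n} \<le> n" by simp
  have sum_fin: "(\<Sum>l\<in>{i<..n}. f l) < (\<infinity>::ennreal)" if "\<And>l. l \<in> {i<..n} \<Longrightarrow> f l < \<infinity>" for f
    using that by (simp add: less_top[symmetric])
  have mom1: "(\<integral>\<^sup>+z. ennreal (D z powr \<alpha> i) \<partial>?N) < \<infinity>"
  proof -
    have "(\<integral>\<^sup>+z. ennreal (D z powr \<alpha> i) \<partial>?N) \<le> (\<integral>\<^sup>+z. ennreal (real n powr \<alpha> i) * (\<Sum>l\<in>{i<..n}. ennreal ((a i l (fst z) * w l (snd z)) powr \<alpha> i)) \<partial>?N)"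
    proof (rule nn_integral_mono)
      fix z
      have "D z powr \<alpha> i \<le> real n powr \<alpha> i * (\<Sum>l\<in>{i<..n}. (a i l (fst z) * w l (snd z)) powr \<alpha> i)"
        unfolding D_def using a0 w0 ai card by (intro sum_powr_le) auto
      then have "ennreal (D z powr \<alpha> i) \<le> ennreal (real n powr \<alpha> i * (\<Sum>l\<in>{i<..n}. (a i l (fst z) * w l (snd z)) powr \<alpha> i))"
        by (rule ennreal_leI)
      also have "\<dots> = ennreal (real n powr \<alpha> i) * (\<Sum>l\<in>{i<..n}. ennreal ((a i l (fst z) * w l (snd z)) powr \<alpha> i))"
        by (subst sum_ennreal) (auto simp: ennreal_mult sum_nonneg)
      finally show "ennreal (D z powr \<alpha> i) \<le> ennreal (real n powr \<alpha> i) * (\<Sum>l\<in>{i<..n}. ennreal ((a i l (fst z) * w l (snd z)) powr \<alpha> i))" .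
    qed
    also have "\<dots> = ennreal (real n powr \<alpha> i) * (\<Sum>l\<in>{i<..n}. \<integral>\<^sup>+z. ennreal ((a i l (fst z) * w l (snd z)) powr \<alpha> i) \<partial>?N)"
      by (subst nn_integral_cmult) (auto simp: nn_integral_sum simp del: sum_ennreal)
    also have "\<dots> < \<infinity>"
    proof -
      have "(\<Sum>l\<in>{i<..n}. \<integral>\<^sup>+z. ennreal ((a i l (fst z) * w l (snd z)) powr \<alpha> i) \<partial>?N) < \<infinity>"
        by (rule sum_fin) (rule term1)
      then show ?thesis by (simp add: ennreal_mult_less_top)
    qed
    finally show ?thesis .
  qed
  have mom2: "(\<integral>\<^sup>+z. ennreal (D z powr \<kappa> * (a i i (fst z) * w i (snd z)) powr (\<alpha> i - \<kappa>)) \<partial>?N) < \<infinity>"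
  proof -
    have "(\<integral>\<^sup>+z. ennreal (D z powr \<kappa> * (a i i (fst z) * w i (snd z)) powr (\<alpha> i - \<kappa>)) \<partial>?N)
      \<le> (\<integral>\<^sup>+z. ennreal (real n powr \<kappa>) * (\<Sum>l\<in>{i<..n}. ennreal ((a i l (fst z) * w l (snd z)) powr \<kappa> * (a i i (fst z) * w i (snd z)) powr (\<alpha> i - \<kappa>))) \<partial>?N)"
    proof (rule nn_integral_mono)
      fix z
      have "D z powr \<kappa> \<le> real n powr \<kappa> * (\<Sum>l\<in>{i<..n}. (a i l (fst z) * w l (snd z)) powr \<kappa>)"
        unfolding D_def using a0 w0 \<kappa> card by (intro sum_powr_le) auto
      then have "D z powr \<kappa> * (a i i (fst z) * w i (snd z)) powr (\<alpha> i - \<kappa>) \<le> real n powr \<kappa> * (\<Sum>l\<in>{i<..n}. (a i l (fst z) * w l (snd z)) powr \<kappa>) * (a i i (fst z) * w i (snd z)) powr (\<alpha> i - \<kappa>)"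
        by (rule mult_right_mono) simp
      then have "ennreal (D z powr \<kappa> * (a i i (fst z) * w i (snd z)) powr (\<alpha> i - \<kappa>)) \<le> ennreal (real n powr \<kappa> * (\<Sum>l\<in>{i<..n}. (a i l (fst z) * w l (snd z)) powr \<kappa> * (a i i (fst z) * w i (snd z)) powr (\<alpha> i - \<kappa>)))"
        by (intro ennreal_leI) (simp add: sum_distrib_right mult.assoc)
      also have "\<dots> = ennreal (real n powr \<kappa>) * (\<Sum>l\<in>{i<..n}. ennreal ((a i l (fst z) * w l (snd z)) powr \<kappa> * (a i i (fst z) * w i (snd z)) powr (\<alpha> i - \<kappa>)))"
        by (subst sum_ennreal) (auto simp: ennreal_mult sum_nonneg)
      finally show "ennreal (D z powr \<kappa> * (a i i (fst z) * w i (snd z)) powr (\<alpha> i - \<kappa>)) \<le> ennreal (real n powr \<kappa>) * (\<Sum>l\<in>{i<..n}. ennreal ((a i l (fst z) * w l (snd z)) powr \<kappa> * (a i i (fst z) * w i (snd z)) powr (\<alpha> i - \<kappa>)))" .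
    qed
    also have "\<dots> = ennreal (real n powr \<kappa>) * (\<Sum>l\<in>{i<..n}. \<integral>\<^sup>+z. ennreal ((a i l (fst z) * w l (snd z)) powr \<kappa> * (a i i (fst z) * w i (snd z)) powr (\<alpha> i - \<kappa>)) \<partial>?N)"
      by (subst nn_integral_cmult) (auto simp: nn_integral_sum simp del: sum_ennreal)
    also have "\<dots> < \<infinity>"
    proof -
      have "(\<Sum>l\<in>{i<..n}. \<integral>\<^sup>+z. ennreal ((a i l (fst z) * w l (snd z)) powr \<kappa> * (a i i (fst z) * w i (snd z)) powr (\<alpha> i - \<kappa>)) \<partial>?N) < \<infinity>"
        by (rule sum_fin) (rule term2)
      then show ?thesis by (simp add: ennreal_mult_less_top)
    qed
    finally show ?thesis .
  qed
  \<comment> \<open>The term \<open>l = n\<close> of \<open>D\<close> is the inhomogeneous part,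
    which is positive with positive probability.\<close>
  have Dpos: "0 < measure ?N {z \<in> space ?N. 0 < D z}"
  proof -
    have "measure M {\<omega> \<in> space M. 0 < a i n \<omega>} = measure ?N ({\<omega> \<in> space M. 0 < a i n \<omega>} \<times> space M)"
      by (simp add: measure_def emeasure_pair_measure_Times emeasure_space_1)
    also have "\<dots> \<le> measure ?N {z \<in> space ?N. 0 < D z}"
    proof (rule MM.finite_measure_mono)
      show "{\<omega> \<in> space M. 0 < a i n \<omega>} \<times> space M \<subseteq> {z \<in> space ?N. 0 < D z}"
      proof clarsimp
        fix \<omega> \<omega>' assume z: "\<omega> \<in> space M" "0 < a i n \<omega>" "\<omega>' \<in> space M"
        have "a i n \<omega> * w n \<omega>' \<le> D (\<omega>, \<omega>')"
          unfolding D_def using i a0 w0 member_le_sum[of n "{i<..n}" "\<lambda>l. a i l \<omega> * w l \<omega>'"] by auto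
        with z show "(\<omega>, \<omega>') \<in> space ?N \<and> 0 < D (\<omega>, \<omega>')" by (auto simp: w_last space_pair_measure)
      qed
    qed (simp add: D_def)
    finally show ?thesis using last_pos[OF i] by linarith
  qed
  have i1: "i \<in> {1..n}" using i by auto
  have D_meas: "D \<in> borel_measurable ?N" unfolding D_def by measurable
  have D0: "0 \<le> D z" for z unfolding D_def using a0 w0 by (intro sum_nonneg) auto
  have int: "integrable M (\<lambda>\<omega>. a i i \<omega> powr \<alpha> i)" using i by (intro moment) auto
  have fx: "measure M {\<omega> \<in> space M. x < w i \<omega>} = measure ?N {z \<in> space ?N. x < a i i (fst z) * w i (snd z) + D z}" for x
    unfolding D_def by (rule fix_eq_single[OF i1])
  note G = implicit_renewal[OF a_meas w_meas D_meas a0 w0 D0 ai int crit[OF i] log_moment[OF i] nonarith[OF i] fx \<kappa>(1,2) mom1 mom2 Dpos]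
  show "\<exists>C>0. ((\<lambda>x. x powr \<alpha> i * measure M {\<omega> \<in> space M. x < w i \<omega>}) \<longlongrightarrow> C) at_top" by (rule G(1))
  obtain K where K: "\<forall>x>0. measure M {\<omega> \<in> space M. x < w i \<omega>} \<le> K * x powr - \<alpha> i" using G(2) by auto
  \<comment> \<open>Evaluating the bound at \<open>x = 1\<close> shows \<open>K \<ge> 0\<close>, as
    \<open>tail_bound\<close> demands.\<close>
  have "0 \<le> measure M {\<omega> \<in> space M. 1 < w i \<omega>}" by simp
  also have "\<dots> \<le> K * 1 powr - \<alpha> i" using K by (metis zero_less_one)
  finally show "tail_bound (\<alpha> i) i" unfolding tail_bound_def using K by (intro exI[of _ K]) auto
qed

end

section \<open>Components with a dominating successor\<close>

lemma limsup_affine_ennreal: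
  fixes u :: "nat \<Rightarrow> ennreal"
  assumes "0 \<le> c"
  shows "limsup (\<lambda>k. ennreal c * u k + b) = ennreal c * limsup u + b"
proof (rule Limsup_compose_continuous_mono[where f="\<lambda>x. ennreal c * x + b"])
  show "continuous_on UNIV (\<lambda>x. ennreal c * x + b)"
    unfolding continuous_on_def by (auto intro!: tendsto_add ennreal_tendsto_cmult)
  show "mono (\<lambda>x. ennreal c * x + b)" by (auto simp: mono_def intro!: add_mono mult_left_mono)
qed simp

context triangular_fixpoint begin

definition lin_tail :: "(nat \<Rightarrow> real) \<Rightarrow> real \<Rightarrow> real" where
  "lin_tail p x = measure M {\<omega> \<in> space M. x < (\<Sum>j=1..n. p j * w j \<omega>)}"

definition row_mult :: "(nat \<Rightarrow> real) \<Rightarrow> 'a \<Rightarrow> nat \<Rightarrow> real" where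
  "row_mult p \<omega> l = (\<Sum>j=1..n. p j * a j l \<omega>)"

lemma lin_tail_nonneg [simp]: "0 \<le> lin_tail p x"
  by (simp add: lin_tail_def)

lemma row_mult_nonneg: "(\<And>j. 0 \<le> p j) \<Longrightarrow> 0 \<le> row_mult p \<omega> l"
  unfolding row_mult_def using a0 by (intro sum_nonneg) auto

lemma measurable_row_mult [measurable]: "(\<lambda>\<omega>. row_mult p \<omega> l) \<in> borel_measurable M"
  unfolding row_mult_def by measurable

text \<open>Conditioning on the matrix: \<open>p \<cdot> (A W)\<close> is
  \<open>(p A) \<cdot> W\<close> with \<open>W\<close> independent of the row vector
  \<open>p A\<close>. The second claim is recorded because measurability in the random row vector is
  inherited from the slices of a measurable set of the product space.\<close>

lemma lin_tail_step:
  assumes p: "\<And>j. 0 \<le> p j"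
  shows "ennreal (lin_tail p x) = (\<integral>\<^sup>+\<omega>. ennreal (lin_tail (row_mult p \<omega>) x) \<partial>M)"
    and "(\<lambda>\<omega>. ennreal (lin_tail (row_mult p \<omega>) x)) \<in> borel_measurable M"
proof -
  let ?N = "M \<Otimes>\<^sub>M M"
  define Q where "Q = {z \<in> space ?N. x < (\<Sum>j=1..n. p j * (\<Sum>l=1..n. a j l (fst z) * w l (snd z)))}"
  have [measurable]: "Q \<in> sets ?N" unfolding Q_def by measurable
  have swap: "(\<Sum>j=1..n. p j * (\<Sum>l=1..n. a j l \<omega> * w l \<omega>')) = (\<Sum>l=1..n. row_mult p \<omega> l * w l \<omega>')" for \<omega> \<omega>'
    unfolding row_mult_def sum_distrib_left sum_distrib_right by (subst sum.swap) (simp add: mult.assoc)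
  have slice: "emeasure M (Pair \<omega> -` Q) = ennreal (lin_tail (row_mult p \<omega>) x)" if "\<omega> \<in> space M" for \<omega>
  proof -
    have "Pair \<omega> -` Q = {\<omega>' \<in> space M. x < (\<Sum>j=1..n. p j * (\<Sum>l=1..n. a j l \<omega> * w l \<omega>'))}"
      using that by (auto simp: Q_def space_pair_measure)
    then show ?thesis unfolding swap by (simp add: lin_tail_def emeasure_eq_measure)
  qed
  have "ennreal (lin_tail p x) = emeasure ?N Q"
    unfolding lin_tail_def fix_eq[OF p] Q_def by (simp add: MM.emeasure_eq_measure)
  also have "\<dots> = (\<integral>\<^sup>+\<omega>. emeasure M (Pair \<omega> -` Q) \<partial>M)" by (rule emeasure_pair_measure_alt) measurable
  also have "\<dots> = (\<integral>\<^sup>+\<omega>. ennreal (lin_tail (row_mult p \<omega>) x) \<partial>M)" by (intro nn_integral_cong slice)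
  finally show "ennreal (lin_tail p x) = (\<integral>\<^sup>+\<omega>. ennreal (lin_tail (row_mult p \<omega>) x) \<partial>M)" .
  have "(\<lambda>\<omega>. emeasure M (Pair \<omega> -` Q)) \<in> borel_measurable M"
    by (rule measurable_emeasure_Pair) measurable
  then show "(\<lambda>\<omega>. ennreal (lin_tail (row_mult p \<omega>) x)) \<in> borel_measurable M"
    by (subst (asm) measurable_cong[OF slice]) auto
qed

lemma lin_tail_single:
  assumes i: "i \<in> {1..n}" shows "lin_tail (\<lambda>j. if j = i then 1 else 0) x = measure M {\<omega> \<in> space M. x < w i \<omega>}"
proof -
  have "(\<Sum>j=1..n. (if j = i then 1 else 0) * w j \<omega>) = w i \<omega>" for \<omega>
    using i by (simp add: if_distrib[of "\<lambda>x. x * _"] sum.delta cong: if_cong)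
  then show ?thesis by (simp add: lin_tail_def)
qed

text \<open>If the sum exceeds \<open>x\<close>, one of its at most \<open>n\<close> terms exceeds
  \<open>x / n\<close>. The bound does not depend on \<open>x\<close>, so it can serve as a majorant
  for all levels at once.\<close>

lemma lin_tail_bound:
  assumes p: "\<And>j. 0 \<le> p j" and R: "R \<subseteq> {1..n}" and supp: "\<And>j. j \<notin> R \<Longrightarrow> p j = 0" and K: "0 \<le> K"
    and bound: "\<And>l x. l \<in> R \<Longrightarrow> 0 < x \<Longrightarrow> measure M {\<omega> \<in> space M. x < w l \<omega>} \<le> K * x powr - \<beta>"
    and x: "0 < x"
  shows "x powr \<beta> * lin_tail p x \<le> K * real n powr \<beta> * (\<Sum>l\<in>R. p l powr \<beta>)"
proof (cases "R = {}")
  case True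
  then have "p = (\<lambda>_. 0)" using supp by auto
  then show ?thesis using x True by (simp add: lin_tail_def)
next
  case False
  have fR: "finite R" using R by (rule finite_subset) simp
  have n0: "0 < real n" using False R by auto
  have cR: "card R \<le> n" using card_mono[OF _ R] by simp
  have eqs: "(\<Sum>j=1..n. p j * w j \<omega>) = (\<Sum>j\<in>R. p j * w j \<omega>)" for \<omega>
    using R supp by (intro sum.mono_neutral_right) auto
  have sub: "{\<omega> \<in> space M. x < (\<Sum>j=1..n. p j * w j \<omega>)} \<subseteq> (\<Union>l\<in>R. {\<omega> \<in> space M. x / real n < p l * w l \<omega>})"
  proof (rule ccontr)
    assume "\<not> ?thesis"
    then obtain \<omega> where "\<omega> \<in> {\<omega> \<in> space M. x < (\<Sum>j\<in>R. p j * w j \<omega>)}" "\<omega> \<notin> (\<Union>l\<in>R. {\<omega> \<in> space M. x / real n < p l * w l \<omega>})"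
      unfolding eqs by blast
    then have w: "x < (\<Sum>j\<in>R. p j * w j \<omega>)" "\<And>l. l \<in> R \<Longrightarrow> p l * w l \<omega> \<le> x / real n"
      by (auto simp: not_less)
    have "(\<Sum>j\<in>R. p j * w j \<omega>) \<le> (\<Sum>j\<in>R. x / real n)" by (intro sum_mono w)
    also have "\<dots> = real (card R) * (x / real n)" by simp
    also have "\<dots> \<le> real n * (x / real n)" using cR x n0 by (intro mult_right_mono) auto
    also have "\<dots> = x" using n0 by simp
    finally show False using w by simp
  qed
  have single: "measure M {\<omega> \<in> space M. x / real n < p l * w l \<omega>} \<le> K * real n powr \<beta> * p l powr \<beta> * x powr - \<beta>" if l: "l \<in> R" for l
  proof (cases "p l = 0")
    case True
    have "0 \<le> x / real n" using x by simp
    then show ?thesis using True by (simp add: not_less[symmetric])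
  next
    case False
    then have pl: "0 < p l" using p[of l] by simp
    have "measure M {\<omega> \<in> space M. x / real n < p l * w l \<omega>} = measure M {\<omega> \<in> space M. x / (real n * p l) < w l \<omega>}"
      using pl n0 by (simp add: field_simps)
    also have "\<dots> \<le> K * (x / (real n * p l)) powr - \<beta>" using pl n0 x by (intro bound l) auto
    also have "(x / (real n * p l)) powr - \<beta> = real n powr \<beta> * p l powr \<beta> * x powr - \<beta>"
      using pl n0 x by (simp add: powr_divide powr_minus_divide powr_mult)
    finally show ?thesis by (simp add: mult.assoc)
  qed
  have "lin_tail p x \<le> measure M (\<Union>l\<in>R. {\<omega> \<in> space M. x / real n < p l * w l \<omega>})"
    unfolding lin_tail_def using fR by (intro finite_measure_mono sub) measurable
  also have "\<dots> \<le> (\<Sum>l\<in>R. measure M {\<omega> \<in> space M. x / real n < p l * w l \<omega>})"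
    using fR by (intro measure_UNION_le) auto
  also have "\<dots> \<le> (\<Sum>l\<in>R. K * real n powr \<beta> * p l powr \<beta> * x powr - \<beta>)" by (intro sum_mono single)
  also have "\<dots> = K * real n powr \<beta> * (\<Sum>l\<in>R. p l powr \<beta>) * x powr - \<beta>"
    by (simp add: sum_distrib_left sum_distrib_right)
  finally have "x powr \<beta> * lin_tail p x \<le> x powr \<beta> * (K * real n powr \<beta> * (\<Sum>l\<in>R. p l powr \<beta>) * x powr - \<beta>)"
    by (intro mult_left_mono) auto
  also have "\<dots> = K * real n powr \<beta> * (\<Sum>l\<in>R. p l powr \<beta>)" using x by (simp add: powr_minus)
  finally show ?thesis .
qed

lemma lin_tail_upd_le: "(\<And>j. 0 \<le> p j) \<Longrightarrow> lin_tail (p(i := 0)) x \<le> lin_tail p x"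
  unfolding lin_tail_def
proof (rule finite_measure_mono)
  assume p: "\<And>j. 0 \<le> p j"
  have "(\<Sum>j=1..n. (p(i := 0)) j * w j \<omega>) \<le> (\<Sum>j=1..n. p j * w j \<omega>)" for \<omega>
    using p w0 by (intro sum_mono) auto
  then show "{\<omega> \<in> space M. x < (\<Sum>j=1..n. (p(i := 0)) j * w j \<omega>)} \<subseteq> {\<omega> \<in> space M. x < (\<Sum>j=1..n. p j * w j \<omega>)}"
    by (auto intro: less_le_trans)
qed simp

lemma lin_tail_split:
  assumes i: "i \<in> {1..n}"
  shows "lin_tail p (y + z) \<le> lin_tail (p(i := 0)) y + measure M {\<omega> \<in> space M. z < p i * w i \<omega>}"
proof -
  have s: "(\<Sum>j=1..n. p j * w j \<omega>) = p i * w i \<omega> + (\<Sum>j=1..n. (p(i := 0)) j * w j \<omega>)" for \<omega>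
    using i by (simp add: sum.remove[of _ i])
  have "lin_tail p (y + z) \<le> measure M ({\<omega> \<in> space M. y < (\<Sum>j=1..n. (p(i := 0)) j * w j \<omega>)} \<union> {\<omega> \<in> space M. z < p i * w i \<omega>})"
    unfolding lin_tail_def s by (rule finite_measure_mono) auto
  also have "\<dots> \<le> lin_tail (p(i := 0)) y + measure M {\<omega> \<in> space M. z < p i * w i \<omega>}"
    unfolding lin_tail_def by (rule measure_Un_le) auto
  finally show ?thesis .
qed

lemma scaled_tail_bound:
  assumes bound: "\<And>x. 0 < x \<Longrightarrow> measure M {\<omega> \<in> space M. x < w i \<omega>} \<le> K * x powr - \<beta>" and K: "0 \<le> K" and c: "0 \<le> c" and x: "0 < x"
  shows "x powr \<beta> * measure M {\<omega> \<in> space M. x < c * w i \<omega>} \<le> K * c powr \<beta>"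
proof (cases "c = 0")
  case True
  have "\<not> x < 0" using x by simp
  then show ?thesis using True by simp
next
  case False
  then have c0: "0 < c" using c by simp
  have "measure M {\<omega> \<in> space M. x < c * w i \<omega>} = measure M {\<omega> \<in> space M. x / c < w i \<omega>}"
    using c0 by (simp add: field_simps)
  also have "\<dots> \<le> K * (x / c) powr - \<beta>" using c0 x by (intro bound) auto
  also have "(x / c) powr - \<beta> = c powr \<beta> * x powr - \<beta>" using c0 x by (simp add: powr_divide powr_minus_divide)
  finally have "x powr \<beta> * measure M {\<omega> \<in> space M. x < c * w i \<omega>} \<le> x powr \<beta> * (K * (c powr \<beta> * x powr - \<beta>))"
    by (intro mult_left_mono) auto
  also have "\<dots> = K * c powr \<beta>" using x by (simp add: powr_minus)
  finally show ?thesis .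
qed

text \<open>Limits along a sequence, since Fatou's lemma and the measurability of these limits in a
  random row vector concern countably many levels. The sequence is a parameter because cutting the
  level replaces \<open>x\<close> by \<open>(1 - \<delta>) x\<close>.\<close>

definition upper_tail :: "real \<Rightarrow> (nat \<Rightarrow> real) \<Rightarrow> (nat \<Rightarrow> real) \<Rightarrow> ennreal" where
  "upper_tail \<beta> X p = limsup (\<lambda>k. ennreal (X k powr \<beta> * lin_tail p (X k)))"

definition lower_tail :: "real \<Rightarrow> (nat \<Rightarrow> real) \<Rightarrow> (nat \<Rightarrow> real) \<Rightarrow> ennreal" where
  "lower_tail \<beta> X p = liminf (\<lambda>k. ennreal (X k powr \<beta> * lin_tail p (X k)))"

lemma measurable_scaled_lin_tail:
  assumes p: "\<And>j. 0 \<le> p j"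
  shows "(\<lambda>\<omega>. ennreal (x powr \<beta> * lin_tail (row_mult p \<omega>) x)) \<in> borel_measurable M"
  using lin_tail_step(2)[where x=x, OF p] by (simp add: ennreal_mult)

lemma scaled_lin_tail_step:
  assumes p: "\<And>j. 0 \<le> p j"
  shows "(\<integral>\<^sup>+\<omega>. ennreal (x powr \<beta> * lin_tail (row_mult p \<omega>) x) \<partial>M) = ennreal (x powr \<beta> * lin_tail p x)"
  using lin_tail_step[where x=x, OF p] by (simp add: ennreal_mult nn_integral_cmult)

lemma measurable_lower_tail:
  assumes p: "\<And>j. 0 \<le> p j"
  shows "(\<lambda>\<omega>. lower_tail \<beta> X (row_mult p \<omega>)) \<in> borel_measurable M"
  unfolding lower_tail_def by (intro borel_measurable_liminf measurable_scaled_lin_tail p)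

lemma lower_tail_step:
  assumes p: "\<And>j. 0 \<le> p j"
  shows "(\<integral>\<^sup>+\<omega>. lower_tail \<beta> X (row_mult p \<omega>) \<partial>M) \<le> lower_tail \<beta> X p"
proof -
  have "(\<integral>\<^sup>+\<omega>. lower_tail \<beta> X (row_mult p \<omega>) \<partial>M)
    \<le> liminf (\<lambda>k. \<integral>\<^sup>+\<omega>. ennreal (X k powr \<beta> * lin_tail (row_mult p \<omega>) (X k)) \<partial>M)"
    unfolding lower_tail_def by (intro nn_integral_liminf measurable_scaled_lin_tail p)
  then show ?thesis unfolding scaled_lin_tail_step[OF p] lower_tail_def .
qed

lemma row_mult_supp:
  assumes R: "closed_set R" and supp: "\<And>j. j \<notin> R \<Longrightarrow> p j = 0" and l: "l \<in> {1..n} - R"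
  shows "row_mult p \<omega> l = 0"
  unfolding row_mult_def
proof (rule sum.neutral, rule ballI)
  fix j assume j: "j \<in> {1..n}"
  show "p j * a j l \<omega> = 0"
  proof (cases "j \<in> R")
    case True
    then have "a j l \<omega> = 0" using R l unfolding closed_set_def by blast
    then show ?thesis by simp
  qed (simp add: supp)
qed

lemma lin_tail_cong: "(\<And>j. j \<in> {1..n} \<Longrightarrow> p j = q j) \<Longrightarrow> lin_tail p x = lin_tail q x"
  by (simp add: lin_tail_def)

lemma integrable_row_mult:
  assumes R: "closed_set R" and supp: "\<And>j. j \<notin> R \<Longrightarrow> p j = 0" and p: "\<And>j. 0 \<le> p j"
    and \<beta>: "0 < \<beta>" "\<And>j. j \<in> R \<Longrightarrow> j < n \<Longrightarrow> \<beta> \<le> \<alpha> j" and l: "l \<in> {1..n}"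
  shows "integrable M (\<lambda>\<omega>. row_mult p \<omega> l powr \<beta>)"
proof (rule Bochner_Integration.integrable_bound[where f="\<lambda>\<omega>. real n powr \<beta> * (\<Sum>j=1..n. p j powr \<beta> * a j l \<omega> powr \<beta>)"])
  have "integrable M (\<lambda>\<omega>. p j powr \<beta> * a j l \<omega> powr \<beta>)" if j: "j \<in> {1..n}" for j
  proof (cases "j \<in> R")
    case True
    show ?thesis
    proof (cases "j < n")
      case True
      then show ?thesis using \<open>j \<in> R\<close> j l \<beta> by (intro integrable_mult_right moment_le) auto
    next
      case False
      \<comment> \<open>Row \<open>n\<close> is deterministic: 1 at \<open>n\<close> and 0 before
        it.\<close>
      then have "j = n" using j by simp
      then have "a j l \<omega> = (if l = n then 1 else 0)" for \<omega> using l upper[of l n \<omega>] a_last by auto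
      then show ?thesis by simp
    qed
  qed (simp add: supp)
  then show "integrable M (\<lambda>\<omega>. real n powr \<beta> * (\<Sum>j=1..n. p j powr \<beta> * a j l \<omega> powr \<beta>))"
    by (intro integrable_mult_right Bochner_Integration.integrable_sum) auto
  have "row_mult p \<omega> l powr \<beta> \<le> real n powr \<beta> * (\<Sum>j=1..n. p j powr \<beta> * a j l \<omega> powr \<beta>)" for \<omega>
  proof -
    have "row_mult p \<omega> l powr \<beta> \<le> real n powr \<beta> * (\<Sum>j=1..n. (p j * a j l \<omega>) powr \<beta>)"
      unfolding row_mult_def using p a0 \<beta> by (intro sum_powr_le) auto
    then show ?thesis using p a0 by (simp add: powr_mult)
  qed
  then show "AE \<omega> in M. norm (row_mult p \<omega> l powr \<beta>) \<le> norm (real n powr \<beta> * (\<Sum>j=1..n. p j powr \<beta> * a j l \<omega> powr \<beta>))"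
    by (intro AE_I2) (auto intro: order_trans[OF _ abs_ge_self])
qed measurable

text \<open>Reverse Fatou needs an integrable majorant of the scaled tails that is valid for every
  level: it is \<open>u\<close>, the bound of \<open>lin_tail_bound\<close> for the random row
  vector, integrable because \<open>\<beta>\<close> does not exceed the exponents in
  \<open>R\<close>.\<close>

lemma upper_tail_step:
  assumes R: "closed_set R" and supp: "\<And>j. j \<notin> R \<Longrightarrow> p j = 0" and p: "\<And>j. 0 \<le> p j"
    and \<beta>: "0 < \<beta>" "\<And>j. j \<in> R \<Longrightarrow> j < n \<Longrightarrow> \<beta> \<le> \<alpha> j" and K: "0 \<le> K"
    and bound: "\<And>l x. l \<in> R \<Longrightarrow> 0 < x \<Longrightarrow> measure M {\<omega> \<in> space M. x < w l \<omega>} \<le> K * x powr - \<beta>"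
    and X: "\<And>k. 0 < X k"
  shows "upper_tail \<beta> X p \<le> (\<integral>\<^sup>+\<omega>. upper_tail \<beta> X (row_mult p \<omega>) \<partial>M)"
proof -
  have R1: "R \<subseteq> {1..n}" using R by (simp add: closed_set_def)
  have fR: "finite R" using R1 by (rule finite_subset) simp
  define u where "u \<omega> = K * real n powr \<beta> * (\<Sum>l\<in>R. row_mult p \<omega> l powr \<beta>)" for \<omega>
  have ui: "integrable M u"
    unfolding u_def using R1 by (intro integrable_mult_right Bochner_Integration.integrable_sum integrable_row_mult[OF R supp p \<beta>]) auto
  have u0: "0 \<le> u \<omega>" for \<omega> unfolding u_def using K by (simp add: sum_nonneg)
  have "upper_tail \<beta> X p = limsup (\<lambda>k. \<integral>\<^sup>+\<omega>. ennreal (X k powr \<beta> * lin_tail (row_mult p \<omega>) (X k)) \<partial>M)"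
    unfolding upper_tail_def scaled_lin_tail_step[OF p] ..
  also have "\<dots> \<le> (\<integral>\<^sup>+\<omega>. limsup (\<lambda>k. ennreal (X k powr \<beta> * lin_tail (row_mult p \<omega>) (X k))) \<partial>M)"
  proof (rule nn_integral_limsup[where w="\<lambda>\<omega>. ennreal (u \<omega>)"])
    fix k
    show "(\<lambda>\<omega>. ennreal (X k powr \<beta> * lin_tail (row_mult p \<omega>) (X k))) \<in> borel_measurable M"
      by (rule measurable_scaled_lin_tail[OF p])
    show "AE \<omega> in M. ennreal (X k powr \<beta> * lin_tail (row_mult p \<omega>) (X k)) \<le> ennreal (u \<omega>)"
    proof (intro AE_I2 ennreal_leI)
      fix \<omega>
      \<comment> \<open>\<open>row_mult\<close> is unconstrained at indices outside
        \<open>{1..n}\<close>; clearing it off \<open>R\<close> gives the support condition without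
        changing the tail.\<close>
      define q where "q j = (if j \<in> R then row_mult p \<omega> j else 0)" for j
      have "lin_tail (row_mult p \<omega>) (X k) = lin_tail q (X k)"
        using row_mult_supp[OF R supp] by (intro lin_tail_cong) (auto simp: q_def)
      also have "X k powr \<beta> * lin_tail q (X k) \<le> K * real n powr \<beta> * (\<Sum>l\<in>R. q l powr \<beta>)"
        by (rule lin_tail_bound[OF _ R1 _ K bound X]) (auto simp: q_def row_mult_nonneg p)
      finally show "X k powr \<beta> * lin_tail (row_mult p \<omega>) (X k) \<le> u \<omega>" by (simp add: u_def q_def)
    qed
  next
    show "(\<integral>\<^sup>+\<omega>. ennreal (u \<omega>) \<partial>M) < \<infinity>"
      using nn_integral_eq_integral[OF ui] u0 by simp
    show "(\<lambda>\<omega>. ennreal (u \<omega>)) \<in> borel_measurable M" using ui by simp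
  qed
  finally show ?thesis unfolding upper_tail_def .
qed

end

lemma powr_rescale:
  "0 < c \<Longrightarrow> 0 < x \<Longrightarrow> c powr - \<beta> * ((c * x) powr \<beta> * t) = x powr \<beta> * (t::real)"
  by (simp add: powr_mult powr_minus)

section \<open>Agreement of upper and lower limits\<close>

context triangular_fixpoint begin

lemma uniform_tail_bound:
  assumes "finite R" "\<And>j. j \<in> R \<Longrightarrow> tail_bound \<beta> j"
  shows "\<exists>K\<ge>0. \<forall>l\<in>R. \<forall>x>0. measure M {\<omega> \<in> space M. x < w l \<omega>} \<le> K * x powr - \<beta>"
proof -
  have "\<forall>j\<in>R. \<exists>K. 0 \<le> K \<and> (\<forall>x>0. measure M {\<omega> \<in> space M. x < w j \<omega>} \<le> K * x powr - \<beta>)"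
    using assms(2) unfolding tail_bound_def by blast
  from bchoice[OF this] obtain K where K: "\<And>j. j \<in> R \<Longrightarrow> 0 \<le> K j"
    "\<And>j x. j \<in> R \<Longrightarrow> 0 < x \<Longrightarrow> measure M {\<omega> \<in> space M. x < w j \<omega>} \<le> K j * x powr - \<beta>" by blast
  show ?thesis
  proof (intro exI[of _ "\<Sum>j\<in>R. K j"] conjI ballI allI impI)
    show "0 \<le> (\<Sum>j\<in>R. K j)" using K by (intro sum_nonneg) auto
    fix l and x :: real assume l: "l \<in> R" and x: "0 < x"
    have "measure M {\<omega> \<in> space M. x < w l \<omega>} \<le> K l * x powr - \<beta>" by (rule K(2)[OF l x])
    also have "\<dots> \<le> (\<Sum>j\<in>R. K j) * x powr - \<beta>"
      using K l assms(1) by (intro mult_right_mono member_le_sum) auto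
    finally show "measure M {\<omega> \<in> space M. x < w l \<omega>} \<le> (\<Sum>j\<in>R. K j) * x powr - \<beta>" .
  qed
qed

text \<open>The coordinates of \<open>p\<close> beyond \<open>i\<close> have tails of the smaller
  order \<open>x^-\<beta>'\<close>, so only the term at \<open>i\<close> is felt. It alone gives the
  lower bound; for the upper bound the level is cut into \<open>\<delta> x\<close> for the light
  part and \<open>(1 - \<delta>) x\<close> for the heavy one, and \<open>\<delta>\<close> tends to 0
  after \<open>x\<close> has gone to infinity.\<close>

lemma lin_tail_limit_critical:
  assumes i: "i \<in> {1..n}" and R: "R \<subseteq> {1..n}" and \<beta>: "0 < \<beta>" "\<beta> < \<beta>'"
    and lim: "((\<lambda>x. x powr \<beta> * measure M {\<omega> \<in> space M. x < w i \<omega>}) \<longlongrightarrow> C) at_top"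
    and light: "\<And>j. j \<in> R \<inter> {i<..} \<Longrightarrow> tail_bound \<beta>' j"
    and p: "\<And>j. 0 \<le> p j" and supp: "\<And>j. j \<notin> R \<inter> {i..} \<Longrightarrow> p j = 0"
  shows "((\<lambda>x. x powr \<beta> * lin_tail p x) \<longlongrightarrow> p i powr \<beta> * C) at_top"
proof -
  define q where "q = p(i := 0)"
  have q0: "\<And>j. 0 \<le> q j" using p by (simp add: q_def)
  have qs: "q j = 0" if "j \<notin> R \<inter> {i<..}" for j using that supp[of j] by (cases "j = i") (auto simp: q_def)
  define h where "h x = x powr \<beta> * measure M {\<omega> \<in> space M. x < p i * w i \<omega>}" for x
  define A where "A x = x powr \<beta> * lin_tail q x" for x
  have scale: "filterlim (\<lambda>x. c * x) at_top at_top" if "0 < c" for c :: real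
    using that by (intro filterlim_tendsto_pos_mult_at_top[OF tendsto_const] filterlim_ident)
  have A_lim: "(A \<longlongrightarrow> 0) at_top"
  proof -
    have "finite (R \<inter> {i<..})" using R by (auto intro: finite_subset)
    from uniform_tail_bound[OF this light] obtain K where K: "0 \<le> K"
      "\<And>l x. l \<in> R \<inter> {i<..} \<Longrightarrow> 0 < x \<Longrightarrow> measure M {\<omega> \<in> space M. x < w l \<omega>} \<le> K * x powr - \<beta>'" by blast
    define K' where "K' = K * real n powr \<beta>' * (\<Sum>l\<in>R \<inter> {i<..}. q l powr \<beta>')"
    have b: "A x \<le> K' * x powr (- (\<beta>' - \<beta>))" if x: "0 < x" for x
    proof -
      have "x powr \<beta>' * lin_tail q x \<le> K'"
        unfolding K'_def using R by (intro lin_tail_bound[OF q0 _ qs K(1) K(2) x]) auto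
      then have "x powr (- (\<beta>' - \<beta>)) * (x powr \<beta>' * lin_tail q x) \<le> x powr (- (\<beta>' - \<beta>)) * K'"
        by (rule mult_left_mono) simp
      moreover have "x powr (- (\<beta>' - \<beta>)) * (x powr \<beta>' * lin_tail q x) = A x"
        unfolding A_def mult.assoc[symmetric] powr_add[symmetric] by simp
      ultimately show ?thesis by (simp add: mult.commute)
    qed
    have z: "((\<lambda>x::real. x powr (- (\<beta>' - \<beta>))) \<longlongrightarrow> 0) at_top"
      using \<beta> by (intro tendsto_neg_powr filterlim_ident) auto
    have lim0: "((\<lambda>x. K' * x powr (- (\<beta>' - \<beta>))) \<longlongrightarrow> 0) at_top"
      using tendsto_mult_right_zero[OF z, of K'] by simp
    show ?thesis
    proof (rule tendsto_sandwich[OF _ _ tendsto_const lim0])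
      show "\<forall>\<^sub>F x in at_top. 0 \<le> A x" by (simp add: A_def)
      show "\<forall>\<^sub>F x in at_top. A x \<le> K' * x powr (- (\<beta>' - \<beta>))"
        by (rule eventually_mono[OF eventually_gt_at_top[of 0]]) (rule b)
    qed
  qed
  have h_lim: "(h \<longlongrightarrow> p i powr \<beta> * C) at_top"
  proof (cases "p i = 0")
    case True
    have "h x = 0" if "0 < x" for x
    proof -
      have "\<not> x < 0" using that by simp
      then show ?thesis by (simp add: h_def True)
    qed
    then have "eventually (\<lambda>x. 0 = h x) at_top"
      by (intro eventually_mono[OF eventually_gt_at_top[of 0]]) auto
    then have "(h \<longlongrightarrow> 0) at_top" by (rule Lim_transform_eventually[OF tendsto_const])
    then show ?thesis using True by simp
  next
    case False
    then have pi: "0 < p i" using p[of i] by simp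
    have "((\<lambda>x. (1 / p i * x) powr \<beta> * measure M {\<omega> \<in> space M. 1 / p i * x < w i \<omega>}) \<longlongrightarrow> C) at_top"
      using pi by (intro filterlim_compose[OF lim scale]) auto
    then have l: "((\<lambda>x. p i powr \<beta> * ((1 / p i * x) powr \<beta> * measure M {\<omega> \<in> space M. 1 / p i * x < w i \<omega>})) \<longlongrightarrow> p i powr \<beta> * C) at_top"
      by (intro tendsto_mult tendsto_const)
    have "p i powr \<beta> * ((1 / p i * x) powr \<beta> * measure M {\<omega> \<in> space M. 1 / p i * x < w i \<omega>}) = h x" if "0 < x" for x
    proof -
      have "{\<omega> \<in> space M. 1 / p i * x < w i \<omega>} = {\<omega> \<in> space M. x < p i * w i \<omega>}" using pi by (auto simp: field_simps)
      then show ?thesis using pi that by (simp add: h_def powr_divide powr_mult)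
    qed
    then show ?thesis
      by (intro Lim_transform_eventually[OF l] eventually_mono[OF eventually_gt_at_top[of 0]])
  qed
  define c where "c = p i powr \<beta> * C"
  have low: "h x \<le> x powr \<beta> * lin_tail p x" for x
  proof -
    have "p i * w i \<omega> \<le> (\<Sum>j=1..n. p j * w j \<omega>)" for \<omega>
      using i p w0 by (intro member_le_sum[of i _ "\<lambda>j. p j * w j \<omega>"]) auto
    then have "measure M {\<omega> \<in> space M. x < p i * w i \<omega>} \<le> lin_tail p x"
      unfolding lin_tail_def by (intro finite_measure_mono) (auto intro: less_le_trans)
    then show ?thesis unfolding h_def by (intro mult_left_mono) auto
  qed
  have up: "x powr \<beta> * lin_tail p x \<le> \<delta> powr - \<beta> * A (\<delta> * x) + (1 - \<delta>) powr - \<beta> * h ((1 - \<delta>) * x)"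
    if x: "0 < x" and \<delta>: "0 < \<delta>" "\<delta> < 1" for x \<delta>
  proof -
    have "x powr \<beta> * lin_tail p (\<delta> * x + (1 - \<delta>) * x) \<le> x powr \<beta> * (lin_tail q (\<delta> * x) + measure M {\<omega> \<in> space M. (1 - \<delta>) * x < p i * w i \<omega>})"
      unfolding q_def by (intro mult_left_mono lin_tail_split[OF i]) auto
    also have "\<dots> = \<delta> powr - \<beta> * A (\<delta> * x) + (1 - \<delta>) powr - \<beta> * h ((1 - \<delta>) * x)"
      using x \<delta> by (simp only: A_def h_def powr_rescale distrib_left diff_gt_0_iff_gt)
    finally show ?thesis by (simp add: algebra_simps)
  qed
  show ?thesis unfolding c_def[symmetric]
  proof (rule order_tendstoI)
    fix b assume "b < c"
    then have "eventually (\<lambda>x. b < h x) at_top" using h_lim unfolding c_def[symmetric] by (rule order_tendstoD(1)[rotated])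
    then show "eventually (\<lambda>x. b < x powr \<beta> * lin_tail p x) at_top"
      by eventually_elim (rule less_le_trans[OF _ low])
  next
    fix b assume b: "c < b"
    have "((\<lambda>\<delta>. (1 - \<delta>) powr - \<beta> * c) \<longlongrightarrow> (1 - 0) powr - \<beta> * c) (at_right 0)"
      by (intro tendsto_intros) auto
    then have "eventually (\<lambda>\<delta>. (1 - \<delta>) powr - \<beta> * c < b) (at_right 0)"
      using b by (intro order_tendstoD) auto
    moreover have "eventually (\<lambda>\<delta>::real. \<delta> > 0 \<and> \<delta> < 1) (at_right 0)"
      using eventually_at_right_less[of 0] eventually_at_right_real[of 0 1] by (auto elim: eventually_mono)
    ultimately have "eventually (\<lambda>\<delta>. (1 - \<delta>) powr - \<beta> * c < b \<and> \<delta> > 0 \<and> \<delta> < 1) (at_right 0)"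
      by (rule eventually_conj)
    then obtain \<delta> where \<delta>: "0 < \<delta>" "\<delta> < 1" "(1 - \<delta>) powr - \<beta> * c < b"
      using eventually_happens'[of "at_right (0::real)"] by auto
    have "((\<lambda>x. \<delta> powr - \<beta> * A (\<delta> * x) + (1 - \<delta>) powr - \<beta> * h ((1 - \<delta>) * x)) \<longlongrightarrow> \<delta> powr - \<beta> * 0 + (1 - \<delta>) powr - \<beta> * c) at_top"
      unfolding c_def using \<delta>
      by (intro tendsto_add tendsto_mult tendsto_const filterlim_compose[OF A_lim] filterlim_compose[OF h_lim] scale) auto
    then have "eventually (\<lambda>x. \<delta> powr - \<beta> * A (\<delta> * x) + (1 - \<delta>) powr - \<beta> * h ((1 - \<delta>) * x) < b) at_top"
      using \<delta> by (intro order_tendstoD) auto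
    then show "eventually (\<lambda>x. x powr \<beta> * lin_tail p x < b) at_top"
      using eventually_gt_at_top[of 0]
      by eventually_elim (rule le_less_trans[OF up], use \<delta> in auto)
  qed
qed

lemma upper_tail_le_lower_tail_of_limit:
  assumes lim: "((\<lambda>x. x powr \<beta> * lin_tail p x) \<longlongrightarrow> c) at_top"
    and X: "filterlim X at_top sequentially" and Y: "filterlim Y at_top sequentially"
  shows "upper_tail \<beta> X p \<le> lower_tail \<beta> Y p"
proof -
  have "upper_tail \<beta> X p = ennreal c"
    unfolding upper_tail_def by (intro lim_imp_Limsup tendsto_ennrealI filterlim_compose[OF lim X]) simp
  moreover have "lower_tail \<beta> Y p = ennreal c"
    unfolding lower_tail_def by (intro lim_imp_Liminf tendsto_ennrealI filterlim_compose[OF lim Y]) simp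
  ultimately show ?thesis by simp
qed

text \<open>Passes from vectors supported beyond \<open>i\<close> to those that also charge
  \<open>i\<close>, where \<open>E a_ii^\<beta> < 1\<close>. In \<open>key\<close> the level is cut
  only for \<open>k = 0\<close>. Each further \<open>k\<close> replaces \<open>p\<close> by the
  random row \<open>p A\<close> and averages: the upper limit grows and the lower limit shrinks in
  the right directions, the factor in front stays, and the error is multiplied by
  \<open>\<rho>\<close>.\<close>

lemma upper_tail_le_lower_tail_step:
  assumes R: "closed_set R" and i: "i \<in> {1..<n}"
    and \<beta>: "0 < \<beta>" "\<And>j. j \<in> R \<Longrightarrow> j < n \<Longrightarrow> \<beta> \<le> \<alpha> j" "\<beta> < \<alpha> i" and iR: "i \<in> R" and K: "0 \<le> K"
    and bound: "\<And>l x. l \<in> R \<Longrightarrow> 0 < x \<Longrightarrow> measure M {\<omega> \<in> space M. x < w l \<omega>} \<le> K * x powr - \<beta>"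
    and IH: "\<And>q X Y. (\<And>j. 0 \<le> q j) \<Longrightarrow> (\<And>j. j \<notin> R \<inter> {Suc i..} \<Longrightarrow> q j = 0) \<Longrightarrow> (\<And>k. 0 < X k) \<Longrightarrow> (\<And>k. 0 < Y k)
        \<Longrightarrow> filterlim X at_top sequentially \<Longrightarrow> filterlim Y at_top sequentially \<Longrightarrow> upper_tail \<beta> X q \<le> lower_tail \<beta> Y q"
    and p: "\<And>j. 0 \<le> p j" and supp: "\<And>j. j \<notin> R \<inter> {i..} \<Longrightarrow> p j = 0"
    and X: "\<And>k. 0 < X k" "filterlim X at_top sequentially" and Y: "\<And>k. 0 < Y k" "filterlim Y at_top sequentially"
  shows "upper_tail \<beta> X p \<le> lower_tail \<beta> Y p"
proof -
  define R' where "R' = R \<inter> {i..}"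
  have R': "closed_set R'" unfolding R'_def by (rule closed_set_above(2)[OF R])
  define \<rho> where "\<rho> = (\<integral>\<omega>. a i i \<omega> powr \<beta> \<partial>M)"
  have \<rho>: "0 \<le> \<rho>" "\<rho> < 1" unfolding \<rho>_def using diag_moment_less_1[OF i \<beta>(1,3)] by (auto intro!: integral_nonneg_AE)
  have i1: "i \<in> {1..n}" using i by auto
  have key: "upper_tail \<beta> X p \<le> ennreal ((1 - \<delta>) powr - \<beta>) * lower_tail \<beta> Y p + ennreal (\<delta> powr - \<beta> * K * \<rho> ^ k * p i powr \<beta>)"
    if \<delta>: "0 < \<delta>" "\<delta> < 1" and p: "\<And>j. 0 \<le> p j" and supp: "\<And>j. j \<notin> R' \<Longrightarrow> p j = 0" for \<delta> k p
    using p supp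
  proof (induction k arbitrary: p)
    case 0
    note p = 0(1) and supp = 0(2)
    define q where "q = p(i := 0)"
    \<comment> \<open>The cut moves the levels from \<open>X k\<close> to \<open>X' k\<close>;
      \<open>IH\<close> compares arbitrary pairs of sequences and so absorbs the change.\<close>
    define X' where "X' k = (1 - \<delta>) * X k" for k
    have X': "\<And>k. 0 < X' k" "filterlim X' at_top sequentially"
      unfolding X'_def using \<delta> X by (auto intro!: filterlim_tendsto_pos_mult_at_top[OF tendsto_const])
    have q0: "0 \<le> q j" for j using p by (simp add: q_def)
    have qs: "q j = 0" if "j \<notin> R \<inter> {Suc i..}" for j
      using that supp[of j] by (cases "j = i") (auto simp: q_def R'_def)
    have "upper_tail \<beta> X p \<le> limsup (\<lambda>k. ennreal ((1 - \<delta>) powr - \<beta>) * ennreal (X' k powr \<beta> * lin_tail q (X' k)) + ennreal (\<delta> powr - \<beta> * K * p i powr \<beta>))"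
      unfolding upper_tail_def
    proof (intro Limsup_mono always_eventually allI)
      fix k
      have dX: "0 < \<delta> * X k" using \<delta> X by simp
      have "X k powr \<beta> * lin_tail p ((1 - \<delta>) * X k + \<delta> * X k) \<le> X k powr \<beta> * (lin_tail q ((1 - \<delta>) * X k) + measure M {\<omega> \<in> space M. \<delta> * X k < p i * w i \<omega>})"
        unfolding q_def by (intro mult_left_mono lin_tail_split[OF i1]) auto
      also have "\<dots> = (1 - \<delta>) powr - \<beta> * (X' k powr \<beta> * lin_tail q (X' k)) + \<delta> powr - \<beta> * ((\<delta> * X k) powr \<beta> * measure M {\<omega> \<in> space M. \<delta> * X k < p i * w i \<omega>})"
        using X(1)[of k] \<delta> by (simp only: X'_def powr_rescale distrib_left diff_gt_0_iff_gt)
      also have "\<dots> \<le> (1 - \<delta>) powr - \<beta> * (X' k powr \<beta> * lin_tail q (X' k)) + \<delta> powr - \<beta> * (K * p i powr \<beta>)"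
        by (intro add_left_mono mult_left_mono scaled_tail_bound[OF bound[OF iR] K p dX]) auto
      finally have "X k powr \<beta> * lin_tail p (X k) \<le> (1 - \<delta>) powr - \<beta> * (X' k powr \<beta> * lin_tail q (X' k)) + \<delta> powr - \<beta> * (K * p i powr \<beta>)"
        by (simp add: algebra_simps)
      then have "ennreal (X k powr \<beta> * lin_tail p (X k)) \<le> ennreal ((1 - \<delta>) powr - \<beta> * (X' k powr \<beta> * lin_tail q (X' k)) + \<delta> powr - \<beta> * (K * p i powr \<beta>))"
        by (rule ennreal_leI)
      also have "\<dots> = ennreal ((1 - \<delta>) powr - \<beta>) * ennreal (X' k powr \<beta> * lin_tail q (X' k)) + ennreal (\<delta> powr - \<beta> * K * p i powr \<beta>)"
        using K by (subst ennreal_plus) (auto simp: ennreal_mult[symmetric] mult.assoc)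
      finally show "ennreal (X k powr \<beta> * lin_tail p (X k)) \<le> ennreal ((1 - \<delta>) powr - \<beta>) * ennreal (X' k powr \<beta> * lin_tail q (X' k)) + ennreal (\<delta> powr - \<beta> * K * p i powr \<beta>)" .
    qed
    also have "\<dots> = ennreal ((1 - \<delta>) powr - \<beta>) * upper_tail \<beta> X' q + ennreal (\<delta> powr - \<beta> * K * p i powr \<beta>)"
      unfolding upper_tail_def by (rule limsup_affine_ennreal) simp
    also have "upper_tail \<beta> X' q \<le> lower_tail \<beta> Y q"
      by (rule IH[OF q0 qs X'(1) Y(1) X'(2) Y(2)])
    also have "lower_tail \<beta> Y q \<le> lower_tail \<beta> Y p"
      unfolding lower_tail_def q_def using p
      by (intro Liminf_mono always_eventually allI ennreal_leI mult_left_mono lin_tail_upd_le) auto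
    finally show ?case by (simp add: add_mono mult_left_mono)
  next
    case (Suc k)
    note p = Suc.prems(1) and supp = Suc.prems(2)
    define c where "c = ennreal ((1 - \<delta>) powr - \<beta>)"
    define b where "b = \<delta> powr - \<beta> * K * \<rho> ^ k"
    have b0: "0 \<le> b" using K \<rho> by (simp add: b_def)
    \<comment> \<open>\<open>p\<close> vanishes before \<open>i\<close> and the matrix is upper
      triangular, so coordinate \<open>i\<close> of the new row vector comes from the diagonal
      alone.\<close>
    have diag: "row_mult p \<omega> i = p i * a i i \<omega>" for \<omega>
    proof -
      have "p j * a j i \<omega> = 0" if "j \<noteq> i" for j
        using that supp[of j] upper[of i j \<omega>] by (cases "j < i") (auto simp: R'_def)
      then have "(\<Sum>j=1..n. p j * a j i \<omega>) = (\<Sum>j\<in>{i}. p j * a j i \<omega>)"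
        using i1 by (intro sum.mono_neutral_right) auto
      then show ?thesis by (simp add: row_mult_def)
    qed
    define q where "q \<omega> j = (if j \<in> R' then row_mult p \<omega> j else 0)" for \<omega> j
    have q_eq: "lin_tail (row_mult p \<omega>) x = lin_tail (q \<omega>) x" for \<omega> x
      using row_mult_supp[OF R' supp] by (intro lin_tail_cong) (auto simp: q_def)
    have ul: "upper_tail \<beta> X (row_mult p \<omega>) \<le> c * lower_tail \<beta> Y (row_mult p \<omega>) + ennreal (b * (p i powr \<beta> * a i i \<omega> powr \<beta>))" for \<omega>
    proof -
      have "upper_tail \<beta> X (q \<omega>) \<le> c * lower_tail \<beta> Y (q \<omega>) + ennreal (b * q \<omega> i powr \<beta>)"
        unfolding c_def b_def by (rule Suc.IH) (auto simp: q_def row_mult_nonneg p)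
      moreover have "q \<omega> i = p i * a i i \<omega>" using iR by (simp add: q_def R'_def diag)
      ultimately show ?thesis
        unfolding upper_tail_def lower_tail_def q_eq using p a0 by (simp add: powr_mult)
    qed
    have \<beta>R': "\<And>j. j \<in> R' \<Longrightarrow> j < n \<Longrightarrow> \<beta> \<le> \<alpha> j" using \<beta>(2) by (auto simp: R'_def)
    have bR': "\<And>l x. l \<in> R' \<Longrightarrow> 0 < x \<Longrightarrow> measure M {\<omega> \<in> space M. x < w l \<omega>} \<le> K * x powr - \<beta>"
      using bound by (auto simp: R'_def)
    have "upper_tail \<beta> X p \<le> (\<integral>\<^sup>+\<omega>. upper_tail \<beta> X (row_mult p \<omega>) \<partial>M)"
      by (rule upper_tail_step[OF R' supp p \<beta>(1) \<beta>R' K bR' X(1)])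
    also have "\<dots> \<le> (\<integral>\<^sup>+\<omega>. c * lower_tail \<beta> Y (row_mult p \<omega>) + ennreal (b * (p i powr \<beta> * a i i \<omega> powr \<beta>)) \<partial>M)"
      by (intro nn_integral_mono ul)
    also have "\<dots> = c * (\<integral>\<^sup>+\<omega>. lower_tail \<beta> Y (row_mult p \<omega>) \<partial>M) + (\<integral>\<^sup>+\<omega>. ennreal (b * (p i powr \<beta> * a i i \<omega> powr \<beta>)) \<partial>M)"
      using measurable_lower_tail[OF p, of \<beta> Y] by (subst nn_integral_add) (auto simp: nn_integral_cmult)
    also have "(\<integral>\<^sup>+\<omega>. ennreal (b * (p i powr \<beta> * a i i \<omega> powr \<beta>)) \<partial>M) = ennreal (\<integral>\<omega>. b * (p i powr \<beta> * a i i \<omega> powr \<beta>) \<partial>M)"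
      using b0 i \<beta> by (intro nn_integral_eq_integral integrable_mult_right moment_le) auto
    also have "(\<integral>\<omega>. b * (p i powr \<beta> * a i i \<omega> powr \<beta>) \<partial>M) = \<delta> powr - \<beta> * K * \<rho> ^ Suc k * p i powr \<beta>"
      by (simp add: b_def \<rho>_def mult_ac)
    also have "c * (\<integral>\<^sup>+\<omega>. lower_tail \<beta> Y (row_mult p \<omega>) \<partial>M) \<le> c * lower_tail \<beta> Y p"
      by (intro mult_left_mono lower_tail_step p) auto
    finally show ?case unfolding c_def by (simp add: add_mono)
  qed
  have key2: "upper_tail \<beta> X p \<le> ennreal ((1 - \<delta>) powr - \<beta>) * lower_tail \<beta> Y p" if \<delta>: "0 < \<delta>" "\<delta> < 1" for \<delta>
  proof -
    have "(\<lambda>k. \<delta> powr - \<beta> * K * \<rho> ^ k * p i powr \<beta>) \<longlonglongrightarrow> \<delta> powr - \<beta> * K * 0 * p i powr \<beta>"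
      using \<rho> by (intro tendsto_intros LIMSEQ_power_zero) auto
    then have "(\<lambda>k. ennreal (\<delta> powr - \<beta> * K * \<rho> ^ k * p i powr \<beta>)) \<longlonglongrightarrow> ennreal 0"
      by (intro tendsto_ennrealI) simp
    then have "(\<lambda>k. ennreal ((1 - \<delta>) powr - \<beta>) * lower_tail \<beta> Y p + ennreal (\<delta> powr - \<beta> * K * \<rho> ^ k * p i powr \<beta>)) \<longlonglongrightarrow> ennreal ((1 - \<delta>) powr - \<beta>) * lower_tail \<beta> Y p + ennreal 0"
      by (intro tendsto_add tendsto_const)
    moreover have "upper_tail \<beta> X p \<le> ennreal ((1 - \<delta>) powr - \<beta>) * lower_tail \<beta> Y p + ennreal (\<delta> powr - \<beta> * K * \<rho> ^ k * p i powr \<beta>)" for k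
      by (rule key[OF \<delta> p]) (use supp in \<open>auto simp: R'_def\<close>)
    ultimately have "upper_tail \<beta> X p \<le> ennreal ((1 - \<delta>) powr - \<beta>) * lower_tail \<beta> Y p + ennreal 0"
      by (intro LIMSEQ_le_const[where X="\<lambda>k. ennreal ((1 - \<delta>) powr - \<beta>) * lower_tail \<beta> Y p + ennreal (\<delta> powr - \<beta> * K * \<rho> ^ k * p i powr \<beta>)"]) auto
    then show ?thesis by simp
  qed
  \<comment> \<open>The choice \<open>\<delta> = 1 / (k + 2)\<close> stays strictly between 0 and 1
    for every \<open>k\<close>.\<close>
  have "(\<lambda>k. (1 - 1 / real (k + 2)) powr - \<beta>) \<longlonglongrightarrow> (1 - 0) powr - \<beta>"
  proof -
    have "(\<lambda>k. 1 / real (k + 2)) \<longlonglongrightarrow> 0" using LIMSEQ_ignore_initial_segment[OF lim_1_over_n, of 2] by simp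
    then show ?thesis by (intro tendsto_intros) auto
  qed
  then have "(\<lambda>k. ennreal ((1 - 1 / real (k + 2)) powr - \<beta>)) \<longlonglongrightarrow> ennreal 1" by (intro tendsto_ennrealI) simp
  then have "(\<lambda>k. ennreal ((1 - 1 / real (k + 2)) powr - \<beta>) * lower_tail \<beta> Y p) \<longlonglongrightarrow> ennreal 1 * lower_tail \<beta> Y p"
    by (intro tendsto_mult_ennreal tendsto_const) auto
  then have "upper_tail \<beta> X p \<le> ennreal 1 * lower_tail \<beta> Y p"
    by (rule LIMSEQ_le_const) (intro exI[of _ 0] allI impI key2, auto)
  then show ?thesis by simp
qed

end

text \<open>One fixed sequence \<open>Z\<close> supplies the limit; comparing it with an arbitrary
  sequence in both orders squeezes that sequence to the same value.\<close>

lemma convergent_at_top_of_limsup_le_liminf: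
  fixes f :: "real \<Rightarrow> real"
  assumes f0: "\<And>x. 0 < x \<Longrightarrow> 0 \<le> f x" and fB: "\<And>x. 0 < x \<Longrightarrow> f x \<le> B"
    and ul: "\<And>X Y. (\<And>k. 0 < X k) \<Longrightarrow> (\<And>k. 0 < Y k) \<Longrightarrow> filterlim X at_top sequentially \<Longrightarrow> filterlim Y at_top sequentially
       \<Longrightarrow> limsup (\<lambda>k. ennreal (f (X k))) \<le> liminf (\<lambda>k. ennreal (f (Y k)))"
  shows "\<exists>C\<ge>0. (f \<longlongrightarrow> C) at_top"
proof -
  define Z :: "nat \<Rightarrow> real" where "Z k = real (Suc k)" for k
  have Z: "\<And>k. 0 < Z k" "filterlim Z at_top sequentially"
    unfolding Z_def by simp (rule filterlim_compose[OF filterlim_real_sequentially filterlim_Suc])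
  define L where "L = liminf (\<lambda>k. ennreal (f (Z k)))"
  have "L \<le> limsup (\<lambda>k. ennreal (f (Z k)))" unfolding L_def by (rule Liminf_le_Limsup) simp
  also have "\<dots> \<le> ennreal B" using fB Z by (intro Limsup_bounded always_eventually allI ennreal_leI) auto
  finally have "L \<noteq> top" by (auto simp: top_unique)
  then obtain C where C: "L = ennreal C" "0 \<le> C" by (cases L) auto
  have "(f \<longlongrightarrow> C) at_top"
  proof (rule tendsto_at_topI_sequentially)
    fix X :: "nat \<Rightarrow> real" assume X: "filterlim X at_top sequentially"
    \<comment> \<open>The comparison is available for positive sequences, and \<open>X\<close> is
      positive only eventually.\<close>
    define X' where "X' k = max 1 (X k)" for k
    have ev: "eventually (\<lambda>k. X' k = X k) sequentially"
      using X unfolding filterlim_at_top by (auto simp: X'_def elim!: eventually_mono allE[of _ 1])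
    have X'0: "\<And>k. 0 < X' k" by (auto simp: X'_def)
    have X': "filterlim X' at_top sequentially"
      by (rule filterlim_at_top_mono[OF X]) (auto simp: X'_def)
    have 1: "limsup (\<lambda>k. ennreal (f (X' k))) \<le> L" unfolding L_def by (rule ul[OF X'0 Z(1) X' Z(2)])
    have "L \<le> limsup (\<lambda>k. ennreal (f (Z k)))" unfolding L_def by (rule Liminf_le_Limsup) simp
    also have "\<dots> \<le> liminf (\<lambda>k. ennreal (f (X' k)))" by (rule ul[OF Z(1) X'0 Z(2) X'])
    finally have 2: "L \<le> liminf (\<lambda>k. ennreal (f (X' k)))" .
    have "(\<lambda>k. ennreal (f (X' k))) \<longlonglongrightarrow> L"
    proof (rule Liminf_eq_Limsup)
      show "liminf (\<lambda>k. ennreal (f (X' k))) = L"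
        using 1 2 Liminf_le_Limsup[of sequentially "\<lambda>k. ennreal (f (X' k))"] by (auto intro: antisym)
      show "limsup (\<lambda>k. ennreal (f (X' k))) = L"
        using 1 2 Liminf_le_Limsup[of sequentially "\<lambda>k. ennreal (f (X' k))"] by (auto intro: antisym)
    qed simp
    then have "(\<lambda>k. f (X' k)) \<longlonglongrightarrow> C"
      unfolding C(1) using C(2) f0[OF X'0] by (subst (asm) tendsto_ennreal_iff) auto
    then show "(\<lambda>k. f (X k)) \<longlonglongrightarrow> C"
      by (rule Lim_transform_eventually) (use ev in \<open>auto elim: eventually_mono\<close>)
  qed
  with C show ?thesis by blast
qed

section \<open>Positivity and the asymptotics at a general index\<close>

context triangular_fixpoint begin

definition tail_positive :: "real \<Rightarrow> nat \<Rightarrow> bool" where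
  "tail_positive \<beta> i \<longleftrightarrow> (\<exists>c>0. eventually (\<lambda>x. c \<le> x powr \<beta> * measure M {\<omega> \<in> space M. x < w i \<omega>}) at_top)"

text \<open>In law \<open>w i\<close> dominates the product of \<open>a i j\<close> with an
  independent copy of \<open>w j\<close>, and \<open>a i j\<close> exceeds some \<open>e > 0\<close>
  with probability \<open>P > 0\<close>. So the tail of \<open>w i\<close> at \<open>x\<close> is at
  least \<open>P\<close> times the tail of \<open>w j\<close> at \<open>x / e\<close>. Asking for a
  lower bound instead of a limit lets the property travel along a path.\<close>

lemma tail_positive_step:
  assumes i: "i \<in> {1..n}" "j \<in> {1..n}" and pos: "0 < measure M {\<omega> \<in> space M. 0 < a i j \<omega>}" and j: "tail_positive \<beta> j"
  shows "tail_positive \<beta> i"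
proof -
  obtain c where c: "0 < c" "eventually (\<lambda>x. c \<le> x powr \<beta> * measure M {\<omega> \<in> space M. x < w j \<omega>}) at_top"
    using j unfolding tail_positive_def by auto
  have "\<exists>k. measure M {\<omega> \<in> space M. 1 / real (Suc k) < a i j \<omega>} \<noteq> 0"
  proof (rule ccontr)
    assume no: "\<not> ?thesis"
    have "emeasure M (\<Union>k. {\<omega> \<in> space M. 1 / real (Suc k) < a i j \<omega>}) = 0"
      using no by (intro emeasure_UN_eq_0) (auto simp: emeasure_eq_measure)
    moreover have "(\<Union>k. {\<omega> \<in> space M. 1 / real (Suc k) < a i j \<omega>}) = {\<omega> \<in> space M. 0 < a i j \<omega>}"
    proof (intro set_eqI iffI)
      fix \<omega> assume "\<omega> \<in> {\<omega> \<in> space M. 0 < a i j \<omega>}"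
      then have w: "\<omega> \<in> space M" "0 < a i j \<omega>" by auto
      then obtain k where "inverse (real (Suc k)) < a i j \<omega>" using reals_Archimedean by blast
      then show "\<omega> \<in> (\<Union>k. {\<omega> \<in> space M. 1 / real (Suc k) < a i j \<omega>})" using w by (auto simp: inverse_eq_divide)
    next
      fix \<omega> assume "\<omega> \<in> (\<Union>k. {\<omega> \<in> space M. 1 / real (Suc k) < a i j \<omega>})"
      then obtain k where k: "\<omega> \<in> space M" "1 / real (Suc k) < a i j \<omega>" by auto
      have "0 < 1 / real (Suc k)" by simp
      then have "0 < a i j \<omega>" using k(2) by (rule less_trans)
      with k show "\<omega> \<in> {\<omega> \<in> space M. 0 < a i j \<omega>}" by simp
    qed
    ultimately show False using pos by (simp add: emeasure_eq_measure)
  qed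
  then obtain k where k: "measure M {\<omega> \<in> space M. 1 / real (Suc k) < a i j \<omega>} \<noteq> 0" by blast
  define e where "e = 1 / real (Suc k)"
  have e: "0 < e" by (simp add: e_def)
  define P where "P = measure M {\<omega> \<in> space M. e < a i j \<omega>}"
  have P: "0 < P" using k measure_nonneg[of M "{\<omega> \<in> space M. e < a i j \<omega>}"] unfolding P_def e_def by linarith
  let ?N = "M \<Otimes>\<^sub>M M"
  have low: "P * measure M {\<omega> \<in> space M. x / e < w j \<omega>} \<le> measure M {\<omega> \<in> space M. x < w i \<omega>}" for x
  proof -
    have "P * measure M {\<omega> \<in> space M. x / e < w j \<omega>} = measure ?N ({\<omega> \<in> space M. e < a i j \<omega>} \<times> {\<omega> \<in> space M. x / e < w j \<omega>})"
      by (simp add: P_def measure_def emeasure_pair_measure_Times enn2real_mult)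
    also have "\<dots> \<le> measure ?N {z \<in> space ?N. x < a i i (fst z) * w i (snd z) + (\<Sum>l\<in>{i<..n}. a i l (fst z) * w l (snd z))}"
    proof (rule MM.finite_measure_mono)
      show "{\<omega> \<in> space M. e < a i j \<omega>} \<times> {\<omega> \<in> space M. x / e < w j \<omega>}
        \<subseteq> {z \<in> space ?N. x < a i i (fst z) * w i (snd z) + (\<Sum>l\<in>{i<..n}. a i l (fst z) * w l (snd z))}"
      proof safe
        fix \<omega> \<omega>' assume w: "\<omega> \<in> space M" "\<omega>' \<in> space M" "e < a i j \<omega>" "x / e < w j \<omega>'"
        have ij: "i \<le> j" using upper[of j i \<omega>] w e by (cases "j < i") auto
        have "x = e * (x / e)" using e by simp
        also have "\<dots> < e * w j \<omega>'" using w e by (intro mult_strict_left_mono)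
        also have "\<dots> \<le> a i j \<omega> * w j \<omega>'" using w w0 by (intro mult_right_mono) auto
        also have "\<dots> \<le> a i i \<omega> * w i \<omega>' + (\<Sum>l\<in>{i<..n}. a i l \<omega> * w l \<omega>')"
        proof (cases "j = i")
          case True then show ?thesis using a0 w0 by (simp add: sum_nonneg)
        next
          case False
          then have "a i j \<omega> * w j \<omega>' \<le> (\<Sum>l\<in>{i<..n}. a i l \<omega> * w l \<omega>')"
            using ij i a0 w0 by (intro member_le_sum[of j _ "\<lambda>l. a i l \<omega> * w l \<omega>'"]) auto
          then show ?thesis using a0[of i i \<omega>] w0[of i \<omega>'] by (simp add: add_increasing)
        qed
        finally show "x < a i i (fst (\<omega>, \<omega>')) * w i (snd (\<omega>, \<omega>')) + (\<Sum>l\<in>{i<..n}. a i l (fst (\<omega>, \<omega>')) * w l (snd (\<omega>, \<omega>')))" by simp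
      qed (auto simp: space_pair_measure)
    qed measurable
    finally show ?thesis unfolding fix_eq_single[OF i(1)] .
  qed
  have sc: "filterlim (\<lambda>x::real. 1 / e * x) at_top at_top"
    using e by (intro filterlim_tendsto_pos_mult_at_top[OF tendsto_const] filterlim_ident) auto
  have "eventually (\<lambda>x. c \<le> (1 / e * x) powr \<beta> * measure M {\<omega> \<in> space M. 1 / e * x < w j \<omega>}) at_top"
    using c(2) sc by (rule eventually_compose_filterlim)
  then have "eventually (\<lambda>x. e powr \<beta> * P * c \<le> x powr \<beta> * measure M {\<omega> \<in> space M. x < w i \<omega>}) at_top"
    using eventually_gt_at_top[of 0]
  proof eventually_elim
    case (elim x)
    have "e powr \<beta> * P * c \<le> e powr \<beta> * P * ((1 / e * x) powr \<beta> * measure M {\<omega> \<in> space M. 1 / e * x < w j \<omega>})"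
      using P by (intro mult_left_mono elim) auto
    also have "\<dots> = x powr \<beta> * (P * measure M {\<omega> \<in> space M. x / e < w j \<omega>})"
      using e elim by (simp add: powr_divide powr_mult)
    also have "\<dots> \<le> x powr \<beta> * measure M {\<omega> \<in> space M. x < w i \<omega>}" by (intro mult_left_mono low) auto
    finally show ?case .
  qed
  then show ?thesis unfolding tail_positive_def using e P c(1) by (intro exI[of _ "e powr \<beta> * P * c"]) auto
qed

definition step_rel :: "nat \<Rightarrow> nat \<Rightarrow> bool" where
  "step_rel k l \<longleftrightarrow> k \<in> {1..n} \<and> l \<in> {1..n} \<and> (\<exists>\<omega>. a k l \<omega> \<noteq> 0)"

text \<open>\<open>j0\<close> is the unique minimiser among the exponents reachable from
  \<open>i\<close>. The renewal theorem settles \<open>j0\<close>, and descending induction from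
  \<open>j0\<close> to \<open>i\<close> extends the agreement of upper and lower limits to all
  vectors on the reachable set. This gives convergence to a limit that might still be 0; the lower
  bound carried back from \<open>j0\<close> to \<open>i\<close> excludes that.\<close>

theorem tail_asymptotics:
  assumes i: "i \<in> {1..<n}" and j0: "j0 \<in> {1..<n}" and reach: "step_rel\<^sup>*\<^sup>* i j0"
    and min: "\<And>j. j \<in> {1..<n} \<Longrightarrow> step_rel\<^sup>*\<^sup>* i j \<Longrightarrow> j \<noteq> j0 \<Longrightarrow> \<alpha> j0 < \<alpha> j"
    and pos: "\<And>k l. step_rel k l \<Longrightarrow> 0 < measure M {\<omega> \<in> space M. 0 < a k l \<omega>}"
  shows "\<exists>C>0. ((\<lambda>x. x powr \<alpha> j0 * measure M {\<omega> \<in> space M. x < w i \<omega>}) \<longlongrightarrow> C) at_top"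
proof -
  define R where "R = {j. step_rel\<^sup>*\<^sup>* i j}"
  have R1: "R \<subseteq> {1..n}"
  proof
    fix j assume "j \<in> R"
    then have "step_rel\<^sup>*\<^sup>* i j" by (simp add: R_def)
    then show "j \<in> {1..n}" by (cases rule: rtranclp.cases) (use i in \<open>auto simp: step_rel_def\<close>)
  qed
  have R: "closed_set R"
    unfolding closed_set_def
  proof (intro conjI ballI impI R1)
    fix k l assume k: "k \<in> R" and l: "l \<in> {1..n}" "\<exists>\<omega>. a k l \<omega> \<noteq> 0"
    then have "step_rel k l" using R1 by (auto simp: step_rel_def)
    with k show "l \<in> R" unfolding R_def by (auto intro: rtranclp.rtrancl_into_rtrancl)
  qed
  have iR: "i \<in> R" and jR: "j0 \<in> R" using reach by (auto simp: R_def)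
  have step_le: "k \<le> l" if "step_rel k l" for k l
    using that upper[of l k] unfolding step_rel_def by (cases "l < k") auto
  have ij: "i \<le> j0" using reach by (induction rule: rtranclp_induct) (auto dest: step_le)
  define \<beta> where "\<beta> = \<alpha> j0"
  have \<beta>0: "0 < \<beta>" unfolding \<beta>_def by (rule \<alpha>0[OF j0])
  have minR: "\<beta> < \<alpha> j" if "j \<in> R" "j < n" "j \<noteq> j0" for j
    unfolding \<beta>_def using that R1 by (intro min) (auto simp: R_def)
  have minR': "\<beta> \<le> \<alpha> j" if "j \<in> R" "j < n" for j
    using minR[OF that] by (cases "j = j0") (auto simp: \<beta>_def)
  note crit = critical_tail[OF j0 R jR, folded \<beta>_def]
  have less: "\<And>j. j \<in> R \<Longrightarrow> j0 < j \<Longrightarrow> j < n \<Longrightarrow> \<beta> < \<alpha> j" using minR by auto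
  obtain C0 where C0: "0 < C0" "((\<lambda>x. x powr \<beta> * measure M {\<omega> \<in> space M. x < w j0 \<omega>}) \<longlongrightarrow> C0) at_top"
    using crit(1)[OF less] by auto
  have tbj0: "tail_bound \<beta> j0" by (rule crit(2)[OF less])
  obtain \<beta>' where \<beta>': "\<beta> < \<beta>'" "\<And>j. j \<in> R \<inter> {j0<..} \<Longrightarrow> tail_bound \<beta>' j" using crit(3)[OF less] by auto
  have tbR: "tail_bound \<beta> j" if "j \<in> R" for j
  proof (rule tail_bound_closed[OF R \<beta>0 _ that])
    fix j assume "j \<in> R" "j < n"
    then show "\<beta> < \<alpha> j \<or> tail_bound \<beta> j" using minR[of j] tbj0 by (cases "j = j0") auto
  qed
  obtain K where K: "0 \<le> K" "\<And>l x. l \<in> R \<Longrightarrow> 0 < x \<Longrightarrow> measure M {\<omega> \<in> space M. x < w l \<omega>} \<le> K * x powr - \<beta>"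
    using uniform_tail_bound[OF finite_subset[OF R1] tbR] by auto
  have j01: "j0 \<in> {1..n}" using j0 by auto
  have S: "upper_tail \<beta> X p \<le> lower_tail \<beta> Y p"
    if "\<And>j. 0 \<le> p j" "\<And>j. j \<notin> R \<inter> {i..} \<Longrightarrow> p j = 0" "\<And>k. 0 < X k" "\<And>k. 0 < Y k"
      "filterlim X at_top sequentially" "filterlim Y at_top sequentially" for p X Y
    using ij i(1) that
  proof (induction i arbitrary: p X Y rule: inc_induct)
    case base
    show ?case
      by (rule upper_tail_le_lower_tail_of_limit[OF lin_tail_limit_critical[OF j01 R1 \<beta>0 \<beta>'(1) C0(2) \<beta>'(2) base(2,3)] base(6,7)])
  next
    case (step k)
    have k1: "Suc k \<in> {1..<n}" using step.hyps j0 by auto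
    show ?case
    proof (cases "k \<in> R")
      case True
      have kn: "k \<in> {1..<n}" using True R1 step.hyps j0 by auto
      have bk: "\<beta> < \<alpha> k" using minR[OF True] step.hyps kn by auto
      show ?thesis
        by (rule upper_tail_le_lower_tail_step[OF R kn \<beta>0 minR' bk True K(1) K(2) step.IH[OF k1] step.prems(2,3) step.prems(4,6) step.prems(5,7)])
    next
      case False
      \<comment> \<open>An index outside \<open>R\<close> carries no weight, so the vector is
        already supported beyond \<open>k\<close>.\<close>
      have "p j = 0" if "j \<notin> R \<inter> {Suc k..}" for j
        using step.prems(3)[of j] that False by (cases "j = k") auto
      then show ?thesis by (rule step.IH[OF k1 step.prems(2) _ step.prems(4-7)])
    qed
  qed
  define e where "e j = (if j = i then 1 else (0::real))" for j
  have i1: "i \<in> {1..n}" using i by auto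
  define f where "f x = x powr \<beta> * measure M {\<omega> \<in> space M. x < w i \<omega>}" for x
  have fe: "f x = x powr \<beta> * lin_tail e x" for x
    unfolding f_def e_def lin_tail_single[OF i1] ..
  have "\<exists>C\<ge>0. (f \<longlongrightarrow> C) at_top"
  proof (rule convergent_at_top_of_limsup_le_liminf)
    fix x :: real assume x: "0 < x"
    show "0 \<le> f x" by (simp add: f_def)
    have "f x \<le> x powr \<beta> * (K * x powr - \<beta>)" unfolding f_def by (intro mult_left_mono K(2)[OF iR x]) simp
    also have "\<dots> = K" using x by (simp add: powr_minus)
    finally show "f x \<le> K" .
  next
    fix X Y :: "nat \<Rightarrow> real"
    assume XY: "\<And>k. 0 < X k" "\<And>k. 0 < Y k" "filterlim X at_top sequentially" "filterlim Y at_top sequentially"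
    show "limsup (\<lambda>k. ennreal (f (X k))) \<le> liminf (\<lambda>k. ennreal (f (Y k)))"
      unfolding fe upper_tail_def[symmetric] lower_tail_def[symmetric]
      using iR by (intro S XY) (auto simp: e_def)
  qed
  then obtain C where C: "0 \<le> C" "(f \<longlongrightarrow> C) at_top" by blast
  have tp: "tail_positive \<beta> j0"
    unfolding tail_positive_def
  proof (intro exI[of _ "C0 / 2"] conjI)
    have "eventually (\<lambda>x. C0 / 2 < x powr \<beta> * measure M {\<omega> \<in> space M. x < w j0 \<omega>}) at_top"
      using C0 by (intro order_tendstoD(1)[OF C0(2)]) auto
    then show "eventually (\<lambda>x. C0 / 2 \<le> x powr \<beta> * measure M {\<omega> \<in> space M. x < w j0 \<omega>}) at_top"
      by eventually_elim simp
  qed (use C0 in simp)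
  have "tail_positive \<beta> i"
    using reach
  proof (induction rule: converse_rtranclp_induct)
    case base show ?case by (rule tp)
  next
    case (step y z)
    then show ?case using pos[OF step(1)] by (intro tail_positive_step[of y z]) (auto simp: step_rel_def)
  qed
  then obtain c where c: "0 < c" "eventually (\<lambda>x. c \<le> f x) at_top" unfolding tail_positive_def f_def by auto
  have "c \<le> C" by (rule tendsto_lowerbound[OF C(2) c(2)]) simp
  then have "0 < C" using c by simp
  then show ?thesis using C(2) unfolding f_def \<beta>_def by blast
qed

end

section \<open>Reduction to the product space\<close>

lemma log_nonarithmetic_cong_AE:
  assumes "AE \<omega> in M. X \<omega> = Y \<omega>" "log_nonarithmetic M X" shows "log_nonarithmetic M Y"
proof -
  have "AE \<omega> in M. X \<omega> > 0 \<longrightarrow> ln (X \<omega>) \<in> range (\<lambda>k::int. h * of_int k)"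
    if "AE \<omega> in M. Y \<omega> > 0 \<longrightarrow> ln (Y \<omega>) \<in> range (\<lambda>k::int. h * of_int k)" for h
    using that assms(1) by eventually_elim simp
  then show ?thesis using assms(2) unfolding log_nonarithmetic_def by blast
qed

context prob_space begin

lemma AE_pair_fst:
  assumes "AE \<omega> in M. P \<omega>" shows "AE z in M \<Otimes>\<^sub>M M. P (fst z)"
proof -
  obtain N where N: "N \<in> null_sets M" "{\<omega> \<in> space M. \<not> P \<omega>} \<subseteq> N" using assms by (auto elim: AE_E simp: null_sets_def)
  show ?thesis
  proof (rule AE_I[where N="N \<times> space M"])
    show "{z \<in> space (M \<Otimes>\<^sub>M M). \<not> P (fst z)} \<subseteq> N \<times> space M" using N by (auto simp: space_pair_measure)
    show "emeasure (M \<Otimes>\<^sub>M M) (N \<times> space M) = 0" using N by (subst emeasure_pair_measure_Times) (auto simp: null_sets_def)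
    show "N \<times> space M \<in> sets (M \<Otimes>\<^sub>M M)" using N by (auto simp: null_sets_def)
  qed
qed

lemma AE_pair_snd:
  assumes "AE \<omega> in M. P \<omega>" shows "AE z in M \<Otimes>\<^sub>M M. P (snd z)"
proof -
  obtain N where N: "N \<in> null_sets M" "{\<omega> \<in> space M. \<not> P \<omega>} \<subseteq> N" using assms by (auto elim: AE_E simp: null_sets_def)
  show ?thesis
  proof (rule AE_I[where N="space M \<times> N"])
    show "{z \<in> space (M \<Otimes>\<^sub>M M). \<not> P (snd z)} \<subseteq> space M \<times> N" using N by (auto simp: space_pair_measure)
    show "emeasure (M \<Otimes>\<^sub>M M) (space M \<times> N) = 0" using N by (subst emeasure_pair_measure_Times) (auto simp: null_sets_def)
    show "space M \<times> N \<in> sets (M \<Otimes>\<^sub>M M)" using N by (auto simp: null_sets_def)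
  qed
qed

text \<open>Independence identifies the joint law of \<open>W\<close> and \<open>(A, B)\<close> with
  the product of their laws, and hence with the law obtained by reading them off different
  coordinates of the product space. The fixed point equation is then pushed through the measurable
  map \<open>\<Phi>\<close>. Whole vectors are treated at once, since combinations of several
  components are needed later.\<close>

lemma fixpoint_pair_measure:
  fixes A :: "'a \<Rightarrow> nat \<Rightarrow> nat \<Rightarrow> real" and B W :: "'a \<Rightarrow> nat \<Rightarrow> real"
  assumes A_meas: "\<And>i j. i \<in> {1..d} \<Longrightarrow> j \<in> {1..d} \<Longrightarrow> (\<lambda>\<omega>. A \<omega> i j) \<in> borel_measurable M"
    and B_meas: "\<And>i. i \<in> {1..d} \<Longrightarrow> (\<lambda>\<omega>. B \<omega> i) \<in> borel_measurable M"
    and W_meas: "\<And>i. i \<in> {1..d} \<Longrightarrow> (\<lambda>\<omega>. W \<omega> i) \<in> borel_measurable M"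
    and indep: "indep_set
        {(\<lambda>\<omega>. \<lambda>i\<in>{1..d}. W \<omega> i) -` S \<inter> space M | S. S \<in> sets (PiM {1..d} (\<lambda>_. borel))}
        {(\<lambda>\<omega>. (\<lambda>(i,j)\<in>{1..d} \<times> {1..d}. A \<omega> i j, \<lambda>i\<in>{1..d}. B \<omega> i)) -` S \<inter> space M | S.
           S \<in> sets (PiM ({1..d} \<times> {1..d}) (\<lambda>_. borel) \<Otimes>\<^sub>M PiM {1..d} (\<lambda>_. borel))}"
    and fixpoint: "distr M (PiM {1..d} (\<lambda>_. borel)) (\<lambda>\<omega>. \<lambda>i\<in>{1..d}. W \<omega> i)
       = distr M (PiM {1..d} (\<lambda>_. borel))
           (\<lambda>\<omega>. \<lambda>i\<in>{1..d}. (\<Sum>j=1..d. A \<omega> i j * W \<omega> j) + B \<omega> i)"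
    and S: "S \<in> sets (PiM {1..d} (\<lambda>_. borel))"
  shows "emeasure M {\<omega> \<in> space M. (\<lambda>i\<in>{1..d}. W \<omega> i) \<in> S}
    = emeasure (M \<Otimes>\<^sub>M M) {z \<in> space (M \<Otimes>\<^sub>M M). (\<lambda>i\<in>{1..d}. (\<Sum>j=1..d. A (fst z) i j * W (snd z) j) + B (fst z) i) \<in> S}"
proof -
  interpret MM: pair_prob_space M M ..
  define I where "I = {1..d}"
  define SW where "SW = (PiM I (\<lambda>_. borel) :: (nat \<Rightarrow> real) measure)"
  define SA where "SA = (PiM (I \<times> I) (\<lambda>_. borel) \<Otimes>\<^sub>M PiM I (\<lambda>_. borel) :: ((nat \<times> nat \<Rightarrow> real) \<times> (nat \<Rightarrow> real)) measure)"
  define Wv where "Wv \<omega> = (\<lambda>i\<in>I. W \<omega> i)" for \<omega>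
  define AB where "AB \<omega> = (\<lambda>(i,j)\<in>I \<times> I. A \<omega> i j, \<lambda>i\<in>I. B \<omega> i)" for \<omega>
  define \<Phi> where "\<Phi> x = (\<lambda>i\<in>I. (\<Sum>j\<in>I. fst (snd x) (i, j) * fst x j) + snd (snd x) i)"
    for x :: "(nat \<Rightarrow> real) \<times> (nat \<times> nat \<Rightarrow> real) \<times> (nat \<Rightarrow> real)"
  have Wv_meas [measurable]: "Wv \<in> measurable M SW"
    unfolding Wv_def SW_def by (intro measurable_restrict W_meas) (auto simp: I_def)
  have AB_meas [measurable]: "AB \<in> measurable M SA"
    unfolding AB_def SA_def
    by (intro measurable_Pair measurable_restrict) (auto simp: I_def intro!: A_meas B_meas)
  have \<Phi>_meas [measurable]: "\<Phi> \<in> measurable (SW \<Otimes>\<^sub>M SA) SW"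
    unfolding \<Phi>_def SW_def SA_def
    by (intro measurable_restrict borel_measurable_add borel_measurable_sum borel_measurable_times)
       (auto intro!: measurable_compose[OF _ measurable_component_singleton] measurable_fst'' measurable_snd'' measurable_compose[OF measurable_fst] measurable_compose[OF measurable_snd] measurable_fst measurable_snd)
  have ind: "indep_set {Wv -` S \<inter> space M | S. S \<in> sets SW} {AB -` S \<inter> space M | S. S \<in> sets SA}"
    using indep unfolding Wv_def[abs_def] AB_def[abs_def] SW_def SA_def I_def .
  have joint: "distr M SW Wv \<Otimes>\<^sub>M distr M SA AB = distr M (SW \<Otimes>\<^sub>M SA) (\<lambda>\<omega>. (Wv \<omega>, AB \<omega>))"
  proof (rule pair_measure_eqI)
    fix S T assume S: "S \<in> sets (distr M SW Wv)" and T: "T \<in> sets (distr M SA AB)"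
    have "prob ((Wv -` S \<inter> space M) \<inter> (AB -` T \<inter> space M)) = prob (Wv -` S \<inter> space M) * prob (AB -` T \<inter> space M)"
      using S T by (intro indep_setD[OF ind]) auto
    moreover have "(Wv -` S \<inter> space M) \<inter> (AB -` T \<inter> space M) = (\<lambda>\<omega>. (Wv \<omega>, AB \<omega>)) -` (S \<times> T) \<inter> space M"
      by auto
    ultimately show "emeasure (distr M SW Wv) S * emeasure (distr M SA AB) T
        = emeasure (distr M (SW \<Otimes>\<^sub>M SA) (\<lambda>\<omega>. (Wv \<omega>, AB \<omega>))) (S \<times> T)"
      using S T by (simp add: emeasure_distr emeasure_eq_measure ennreal_mult)
  qed (auto intro!: prob_space_imp_sigma_finite prob_space_distr intro: sets_pair_measure_cong)
  have prod: "distr M SW Wv \<Otimes>\<^sub>M distr M SA AB = distr (M \<Otimes>\<^sub>M M) (SW \<Otimes>\<^sub>M SA) (\<lambda>(x, y). (Wv x, AB y))"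
    by (intro pair_measure_distr Wv_meas AB_meas prob_space_imp_sigma_finite prob_space_distr)
  have \<Phi>1: "\<Phi> (Wv \<omega>', AB \<omega>) = (\<lambda>i\<in>{1..d}. (\<Sum>j=1..d. A \<omega> i j * W \<omega>' j) + B \<omega> i)" for \<omega> \<omega>'
    by (auto simp: \<Phi>_def Wv_def AB_def I_def fun_eq_iff restrict_def intro!: sum.cong)
  have "distr M SW Wv = distr M SW (\<lambda>\<omega>. \<Phi> (Wv \<omega>, AB \<omega>))"
    using fixpoint unfolding \<Phi>1 by (simp add: Wv_def[abs_def] SW_def I_def)
  also have "\<dots> = distr (distr M (SW \<Otimes>\<^sub>M SA) (\<lambda>\<omega>. (Wv \<omega>, AB \<omega>))) SW \<Phi>"
    by (subst distr_distr) (auto simp: comp_def)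
  also have "\<dots> = distr (distr (M \<Otimes>\<^sub>M M) (SW \<Otimes>\<^sub>M SA) (\<lambda>(x, y). (Wv x, AB y))) SW \<Phi>"
    unfolding joint[symmetric] prod ..
  also have "\<dots> = distr (M \<Otimes>\<^sub>M M) SW (\<lambda>z. \<Phi> (Wv (fst z), AB (snd z)))"
    by (subst distr_distr) (auto simp: comp_def case_prod_beta)
  \<comment> \<open>The coordinates are swapped so that the coefficients come from the first one, as
    in the product formulas for tails.\<close>
  also have "\<dots> = distr (distr (M \<Otimes>\<^sub>M M) (M \<Otimes>\<^sub>M M) (\<lambda>(x, y). (y, x))) SW (\<lambda>z. \<Phi> (Wv (fst z), AB (snd z)))"
    by (subst MM.distr_pair_swap) simp
  also have "\<dots> = distr (M \<Otimes>\<^sub>M M) SW (\<lambda>z. \<Phi> (Wv (snd z), AB (fst z)))"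
    by (subst distr_distr) (auto simp: comp_def case_prod_beta)
  finally have law: "distr M SW Wv = distr (M \<Otimes>\<^sub>M M) SW (\<lambda>z. \<Phi> (Wv (snd z), AB (fst z)))" .
  have S': "S \<in> sets SW" using S by (simp add: SW_def I_def)
  have "emeasure M {\<omega> \<in> space M. Wv \<omega> \<in> S} = emeasure (distr M SW Wv) S"
    using S' by (subst emeasure_distr) (auto simp: vimage_def Int_def conj_commute)
  also have "\<dots> = emeasure (M \<Otimes>\<^sub>M M) {z \<in> space (M \<Otimes>\<^sub>M M). \<Phi> (Wv (snd z), AB (fst z)) \<in> S}"
    unfolding law using S' by (subst emeasure_distr) (auto simp: vimage_def Int_def conj_commute)
  finally show ?thesis unfolding \<Phi>1 by (simp add: Wv_def I_def)
qed

text \<open>The negative part satisfies a homogeneous tail inequality. There is nothing to cut off,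
  so \<open>tail_contraction\<close> is used with \<open>K = 0\<close> and \<open>c = 1\<close>, and
  its bound is 0 at every positive level.\<close>

lemma fixpoint_component_nonneg:
  fixes a X :: "'a \<Rightarrow> real"
  assumes [measurable]: "a \<in> borel_measurable M" "X \<in> borel_measurable M" and a0: "\<And>\<omega>. 0 \<le> a \<omega>"
    and \<beta>: "0 < \<beta>" and int: "integrable M (\<lambda>\<omega>. a \<omega> powr \<beta>)" and less: "(\<integral>\<omega>. a \<omega> powr \<beta> \<partial>M) < 1"
    and le: "\<And>x. 0 < x \<Longrightarrow> emeasure M {\<omega> \<in> space M. x < - X \<omega>}
       \<le> emeasure (M \<Otimes>\<^sub>M M) {z \<in> space (M \<Otimes>\<^sub>M M). x < a (fst z) * - X (snd z)}"
  shows "AE \<omega> in M. 0 \<le> X \<omega>"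
proof -
  define F where "F x = measure M {\<omega> \<in> space M. x < - X \<omega>}" for x
  have zero: "F x \<le> 0 / (1 - (\<integral>\<omega>. a \<omega> powr \<beta> \<partial>M)) * x powr - \<beta>" if x: "0 < x" for x
  proof (rule tail_contraction[where a=a and c=1 and F=F])
    show "\<exists>K>0. \<forall>x\<ge>K. F x < e" if "0 < e" for e unfolding F_def using that by (intro tail_less_eps) auto
    show "(\<integral>\<^sup>+\<omega>. ennreal (a \<omega> powr \<beta>) \<partial>M) \<le> ennreal ((\<integral>\<omega>. a \<omega> powr \<beta> \<partial>M) * 1 powr \<beta>)"
      using nn_integral_eq_integral[OF int] by simp
    show "0 \<le> (\<integral>\<omega>. a \<omega> powr \<beta> \<partial>M)" by (intro integral_nonneg_AE) auto
    fix x :: real assume x: "0 < x"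
    have "ennreal (F x) \<le> emeasure (M \<Otimes>\<^sub>M M) {z \<in> space (M \<Otimes>\<^sub>M M). x < a (fst z) * - X (snd z)}"
      unfolding F_def using le[OF x] by (simp add: emeasure_eq_measure)
    also have "\<dots> = (\<integral>\<^sup>+\<omega>. (if 0 < a \<omega> then ennreal (F (x / a \<omega>)) else 0) \<partial>M)"
      unfolding F_def using x by (intro emeasure_pair_product_tail a0) auto
    finally show "ennreal (F x) \<le> (\<integral>\<^sup>+\<omega>. (if 0 < a \<omega> then ennreal (F (1 * x / a \<omega>)) else 0) \<partial>M) + ennreal (0 * x powr - \<beta>)"
      by (simp only: mult_1_left mult_zero_left ennreal_0 add_0_right)
  qed (use \<beta> less x a0 in \<open>auto simp: F_def\<close>)
  have "AE \<omega> in M. \<not> 1 / real (Suc k) < - X \<omega>" for k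
  proof -
    have "F (1 / real (Suc k)) = 0" using zero[of "1 / real (Suc k)"] unfolding F_def by (simp add: measure_le_0_iff)
    then show ?thesis unfolding F_def by (subst (asm) prob_eq_0) auto
  qed
  then have "AE \<omega> in M. \<forall>k. \<not> 1 / real (Suc k) < - X \<omega>" by (simp only: AE_all_countable) simp
  then show ?thesis
  proof eventually_elim
    case (elim \<omega>)
    show ?case
    proof (rule ccontr)
      assume "\<not> 0 \<le> X \<omega>"
      then have "0 < - X \<omega>" by simp
      then obtain k where "inverse (real (Suc k)) < - X \<omega>" using reals_Archimedean by blast
      then show False using elim[rule_format, of k] by (simp add: inverse_eq_divide)
    qed
  qed
qed

end

theorem theorem3p3:
  fixes M :: "'a measure" and d :: nat
    and A :: "'a \<Rightarrow> nat \<Rightarrow> nat \<Rightarrow> real" and B W :: "'a \<Rightarrow> nat \<Rightarrow> real"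
    and \<alpha> :: "nat \<Rightarrow> real"
  assumes "prob_space M"
    and "d \<ge> 1"
    and A_meas: "\<And>i j. i \<in> {1..d} \<Longrightarrow> j \<in> {1..d} \<Longrightarrow> (\<lambda>\<omega>. A \<omega> i j) \<in> borel_measurable M"
    and B_meas: "\<And>i. i \<in> {1..d} \<Longrightarrow> (\<lambda>\<omega>. B \<omega> i) \<in> borel_measurable M"
    and W_meas: "\<And>i. i \<in> {1..d} \<Longrightarrow> (\<lambda>\<omega>. W \<omega> i) \<in> borel_measurable M"
    and T: "condition_T M d A B \<alpha>"
    and indep: "prob_space.indep_set M
        {(\<lambda>\<omega>. \<lambda>i\<in>{1..d}. W \<omega> i) -` S \<inter> space M | S. S \<in> sets (PiM {1..d} (\<lambda>_. borel))}
        {(\<lambda>\<omega>. (\<lambda>(i,j)\<in>{1..d} \<times> {1..d}. A \<omega> i j, \<lambda>i\<in>{1..d}. B \<omega> i)) -` S \<inter> space M | S.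
           S \<in> sets (PiM ({1..d} \<times> {1..d}) (\<lambda>_. borel) \<Otimes>\<^sub>M PiM {1..d} (\<lambda>_. borel))}"
    and fixpoint: "distr M (PiM {1..d} (\<lambda>_. borel)) (\<lambda>\<omega>. \<lambda>i\<in>{1..d}. W \<omega> i)
       = distr M (PiM {1..d} (\<lambda>_. borel))
           (\<lambda>\<omega>. \<lambda>i\<in>{1..d}. (\<Sum>j=1..d. A \<omega> i j * W \<omega> j) + B \<omega> i)"
  shows "\<exists>C :: nat \<Rightarrow> real. \<forall>i\<in>{1..d}. C i > 0 \<and>
     ((\<lambda>x. x powr (Min {\<alpha> j | j. j \<in> {1..d} \<and> tri_rel M A i j})
            * measure M {\<omega> \<in> space M. W \<omega> i > x}) \<longlongrightarrow> C i) at_top"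
proof -
  interpret prob_space M by fact
  interpret MM: pair_prob_space M M ..
  let ?N = "M \<Otimes>\<^sub>M M"
  define I where "I = {1..d}"
  note [measurable] = A_meas[folded I_def] B_meas[folded I_def] W_meas[folded I_def]
  have T1: "\<And>i j. i \<in> I \<Longrightarrow> j \<in> I \<Longrightarrow> AE \<omega> in M. 0 \<le> A \<omega> i j"
    and T1': "\<And>i. i \<in> I \<Longrightarrow> AE \<omega> in M. 0 \<le> B \<omega> i"
    and T2: "\<And>i. i \<in> I \<Longrightarrow> measure M {\<omega> \<in> space M. B \<omega> i = 0} < 1"
    and T3: "\<And>i j. i \<in> I \<Longrightarrow> j \<in> I \<Longrightarrow> j < i \<Longrightarrow> measure M {\<omega> \<in> space M. A \<omega> i j = 0} = 1"
    and T4: "\<And>i. i \<in> I \<Longrightarrow> 0 < \<alpha> i" "\<And>i. i \<in> I \<Longrightarrow> (\<integral>\<omega>. A \<omega> i i powr \<alpha> i \<partial>M) = 1"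
    and inj: "inj_on \<alpha> I"
    and T5: "\<And>i j. i \<in> I \<Longrightarrow> j \<in> I \<Longrightarrow> integrable M (\<lambda>\<omega>. A \<omega> i j powr \<alpha> i)"
    and T6: "\<And>i. i \<in> I \<Longrightarrow> integrable M (\<lambda>\<omega>. B \<omega> i powr \<alpha> i)"
    and T7: "\<And>i. i \<in> I \<Longrightarrow> integrable M (\<lambda>\<omega>. A \<omega> i i powr \<alpha> i * max 0 (ln (A \<omega> i i)))"
    and T8: "\<And>i. i \<in> I \<Longrightarrow> log_nonarithmetic M (\<lambda>\<omega>. A \<omega> i i)"
    using T unfolding condition_T_def I_def by blast+
  have lower0: "AE \<omega> in M. A \<omega> i j = 0" if "i \<in> I" "j \<in> I" "j < i" for i j
    using T3[OF that] that by (subst (asm) prob_eq_1) auto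
  have pair_law: "emeasure M {\<omega> \<in> space M. (\<lambda>i\<in>I. W \<omega> i) \<in> S}
      = emeasure ?N {z \<in> space ?N. (\<lambda>i\<in>I. (\<Sum>j\<in>I. A (fst z) i j * W (snd z) j) + B (fst z) i) \<in> S}"
    if "S \<in> sets (PiM I (\<lambda>_. borel))" for S
    unfolding I_def
    by (rule fixpoint_pair_measure[OF A_meas B_meas W_meas indep fixpoint]) (use that in \<open>simp_all add: I_def\<close>)

  \<comment> \<open>The constant 1 is appended as component \<open>n = d + 1\<close>, so that \<open>B\<close> becomes the last column of the matrix;
    entries that vanish almost surely are made to vanish identically.\<close>
  define n where "n = Suc d"
  define a where "a i j \<omega> = (if i = n \<and> j = n then 1 else if i \<in> I \<and> j = n then max 0 (B \<omega> i)
      else if i \<in> I \<and> j \<in> I \<and> i \<le> j \<and> prec_rel M A i j then max 0 (A \<omega> i j) else 0)" for i j \<omega>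
  have nI: "n \<notin> I" by (simp add: n_def I_def)
  have a_meas: "a i j \<in> borel_measurable M" for i j
    unfolding a_def by (cases "i = n \<and> j = n"; cases "i \<in> I \<and> j = n"; cases "i \<in> I \<and> j \<in> I \<and> i \<le> j \<and> prec_rel M A i j") auto
  have a0: "0 \<le> a i j \<omega>" for i j \<omega> by (simp add: a_def)
  have aA: "AE \<omega> in M. a i j \<omega> = A \<omega> i j" if ij: "i \<in> I" "j \<in> I" for i j
  proof (cases "i \<le> j")
    case False
    then have "AE \<omega> in M. A \<omega> i j = 0" using lower0[OF ij] by simp
    then show ?thesis using False ij nI by (auto simp: a_def elim: eventually_mono)
  next
    case True
    show ?thesis
    proof (cases "prec_rel M A i j")
      case True
      from T1[OF ij] show ?thesis
        using True \<open>i \<le> j\<close> ij nI by (auto simp: a_def elim!: eventually_mono)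
    next
      case False
      then have "measure M {\<omega> \<in> space M. 0 < A \<omega> i j} = 0"
        unfolding prec_rel_def rv_positive_def using measure_nonneg[of M] by (metis order_le_less)
      then have "AE \<omega> in M. \<not> 0 < A \<omega> i j" using ij by (subst (asm) prob_eq_0) auto
      with T1[OF ij] show ?thesis
      proof eventually_elim
        case (elim \<omega>)
        then have "A \<omega> i j = 0" by simp
        then show ?case using False ij nI by (auto simp: a_def)
      qed
    qed
  qed
  have aB: "AE \<omega> in M. a i n \<omega> = B \<omega> i" if "i \<in> I" for i
    using T1'[OF that] that nI by (auto simp: a_def elim!: eventually_mono)
  have crit_a: "(\<integral>\<omega>. a i i \<omega> powr \<alpha> i \<partial>M) = 1" if i: "i \<in> I" for i
  proof -
    have "(\<integral>\<omega>. a i i \<omega> powr \<alpha> i \<partial>M) = (\<integral>\<omega>. A \<omega> i i powr \<alpha> i \<partial>M)"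
      using aA[OF i i] a_meas i by (intro integral_cong_AE) (auto elim: eventually_mono)
    then show ?thesis using T4(2)[OF i] by simp
  qed
  have mom_a: "integrable M (\<lambda>\<omega>. a i j \<omega> powr \<alpha> i)" if i: "i \<in> I" and j: "j \<in> I \<or> j = n" for i j
    using j
  proof
    assume j: "j \<in> I"
    show ?thesis
      using T5[OF i j] by (rule integrable_cong_AE_imp) (use aA[OF i j] a_meas in \<open>auto elim: eventually_mono\<close>)
  next
    assume j: "j = n"
    show ?thesis
      using T6[OF i] by (rule integrable_cong_AE_imp) (use aB[OF i] a_meas j in \<open>auto elim: eventually_mono\<close>)
  qed
  have log_a: "integrable M (\<lambda>\<omega>. a i i \<omega> powr \<alpha> i * max 0 (ln (a i i \<omega>)))" if i: "i \<in> I" for i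
    using T7[OF i] by (rule integrable_cong_AE_imp) (use aA[OF i i] a_meas in \<open>auto elim: eventually_mono\<close>)
  have na_a: "log_nonarithmetic M (a i i)" if i: "i \<in> I" for i
    by (rule log_nonarithmetic_cong_AE[OF _ T8[OF i]]) (use aA[OF i i] in \<open>auto elim: eventually_mono\<close>)

  \<comment> \<open>Descending induction: once the later components are nonnegative,
    \<open>- W i\<close> is dominated by \<open>a i i\<close> times an independent copy of itself,
    because the remaining terms and \<open>B\<close> only help. Half the critical exponent makes the
    diagonal moment less than 1.\<close>
  have W0: "AE \<omega> in M. 0 \<le> W \<omega> i" if "i \<in> I" for i
    using that
  proof (induction "d - i" arbitrary: i rule: less_induct)
    case less
    note i = less.prems
    define \<beta> where "\<beta> = \<alpha> i / 2"
    have \<beta>: "0 < \<beta>" "\<beta> < \<alpha> i" using T4(1)[OF i] by (auto simp: \<beta>_def)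
    have IH: "AE \<omega> in M. 0 \<le> W \<omega> j" if "j \<in> I" "i < j" for j
      using that i by (intro less.hyps) (auto simp: I_def)
    show ?case
    proof (rule fixpoint_component_nonneg[OF a_meas _ a0 \<beta>(1)])
      show "integrable M (\<lambda>\<omega>. a i i \<omega> powr \<beta>)"
        by (rule integrable_powr_less[OF a_meas a0 mom_a[OF i]]) (use \<beta> i in auto)
      show "(\<integral>\<omega>. a i i \<omega> powr \<beta> \<partial>M) < 1"
        by (rule expectation_powr_less_1[OF a_meas a0 mom_a[OF i] crit_a[OF i] \<beta>])
           (use i log_nonarithmetic_not_AE_1[OF na_a[OF i]] in auto)
      show "(\<lambda>\<omega>. W \<omega> i) \<in> borel_measurable M" using i by simp
      fix x :: real assume x: "0 < x"
      define S where "S = {v \<in> space (PiM I (\<lambda>_. borel)). x < - v i}"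
      have S: "S \<in> sets (PiM I (\<lambda>_. borel))" unfolding S_def using i by measurable
      have rs: "(\<lambda>i\<in>I. f i) \<in> S \<longleftrightarrow> x < - f i" for f :: "nat \<Rightarrow> real"
        using i by (auto simp: S_def space_PiM)
      have "emeasure M {\<omega> \<in> space M. x < - W \<omega> i} = emeasure ?N {z \<in> space ?N. x < - ((\<Sum>j\<in>I. A (fst z) i j * W (snd z) j) + B (fst z) i)}"
        using pair_law[OF S] unfolding rs .
      also have "\<dots> \<le> emeasure ?N {z \<in> space ?N. x < a i i (fst z) * - W (snd z) i}"
      proof (rule emeasure_mono_AE)
        have 1: "AE z in ?N. \<forall>j\<in>I. a i j (fst z) = A (fst z) i j"
          by (rule AE_pair_fst, rule AE_finite_allI) (use aA[OF i] in \<open>auto simp: I_def\<close>)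
        have 2: "AE z in ?N. \<forall>j\<in>I \<inter> {i<..}. 0 \<le> W (snd z) j"
          by (rule AE_pair_snd, rule AE_finite_allI) (use IH in \<open>auto simp: I_def\<close>)
        have 3: "AE z in ?N. 0 \<le> B (fst z) i" by (rule AE_pair_fst[OF T1'[OF i]])
        from 1 2 3 show "AE z in ?N. z \<in> {z \<in> space ?N. x < - ((\<Sum>j\<in>I. A (fst z) i j * W (snd z) j) + B (fst z) i)}
            \<longrightarrow> z \<in> {z \<in> space ?N. x < a i i (fst z) * - W (snd z) i}"
        proof eventually_elim
          case (elim z)
          have "(\<Sum>j\<in>I. A (fst z) i j * W (snd z) j) = (\<Sum>j\<in>I. a i j (fst z) * W (snd z) j)" using elim(1) by simp
          also have "\<dots> = a i i (fst z) * W (snd z) i + (\<Sum>j\<in>I - {i}. a i j (fst z) * W (snd z) j)"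
            using i by (intro sum.remove) (auto simp: I_def)
          finally have split: "(\<Sum>j\<in>I. A (fst z) i j * W (snd z) j) = a i i (fst z) * W (snd z) i + (\<Sum>j\<in>I - {i}. a i j (fst z) * W (snd z) j)" .
          have "(\<Sum>j\<in>I - {i}. a i j (fst z) * W (snd z) j) \<ge> 0"
          proof (rule sum_nonneg)
            fix j assume j: "j \<in> I - {i}"
            show "0 \<le> a i j (fst z) * W (snd z) j"
            proof (cases "i < j")
              case True then show ?thesis using j elim(2) a0 by auto
            next
              case False then show ?thesis using j nI by (auto simp: a_def)
            qed
          qed
          then show ?case using elim(3) split by auto
        qed
        show "{z \<in> space ?N. x < a i i (fst z) * - W (snd z) i} \<in> sets ?N" using i a_meas by measurable
      qed
      finally show "emeasure M {\<omega> \<in> space M. x < - W \<omega> i} \<le> emeasure ?N {z \<in> space ?N. x < a i i (fst z) * - W (snd z) i}" .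
    qed
  qed

  \<comment> \<open>The positive part is nonnegative everywhere and, by \<open>W0\<close>, differs
    from \<open>W\<close> only on a null set; the added component is the constant 1.\<close>
  define w where "w i \<omega> = (if i = n then 1 else if i \<in> I then max 0 (W \<omega> i) else 0)" for i \<omega>
  have w_meas: "w i \<in> borel_measurable M" for i
    unfolding w_def by (cases "i = n"; cases "i \<in> I") auto
  have wW: "AE \<omega> in M. w i \<omega> = W \<omega> i" if "i \<in> I" for i
    using W0[OF that] that nI by (auto simp: w_def elim!: eventually_mono)
  have n_range: "{1..<n} = I" "{1..n} = insert n I" by (auto simp: n_def I_def)
  have sum_n: "(\<Sum>j=1..n. f j) = (\<Sum>j\<in>I. f j) + f n" for f :: "nat \<Rightarrow> real"
    by (simp add: n_def I_def)
  have fix_w: "measure M {\<omega> \<in> space M. x < (\<Sum>j=1..n. p j * w j \<omega>)}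
       = measure ?N {z \<in> space ?N. x < (\<Sum>j=1..n. p j * (\<Sum>l=1..n. a j l (fst z) * w l (snd z)))}" for p x
  proof -
    \<comment> \<open>The tail event of a combination as a half-space of vectors, to which the
      vector law applies; the constant component contributes \<open>p n\<close>.\<close>
    define S where "S = {v \<in> space (PiM I (\<lambda>_. borel)). x < (\<Sum>j\<in>I. p j * v j) + p n}"
    have S: "S \<in> sets (PiM I (\<lambda>_. borel))" unfolding S_def by measurable
    have rs: "(\<lambda>i\<in>I. f i) \<in> S \<longleftrightarrow> x < (\<Sum>j\<in>I. p j * f j) + p n" for f :: "nat \<Rightarrow> real"
      by (auto simp: S_def space_PiM)
    have "emeasure M {\<omega> \<in> space M. x < (\<Sum>j=1..n. p j * w j \<omega>)} = emeasure M {\<omega> \<in> space M. x < (\<Sum>j\<in>I. p j * W \<omega> j) + p n}"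
    proof (rule emeasure_eq_AE)
      have "AE \<omega> in M. \<forall>j\<in>I. w j \<omega> = W \<omega> j" by (rule AE_finite_allI) (use wW in \<open>auto simp: I_def\<close>)
      then show "AE \<omega> in M. \<omega> \<in> {\<omega> \<in> space M. x < (\<Sum>j=1..n. p j * w j \<omega>)} \<longleftrightarrow> \<omega> \<in> {\<omega> \<in> space M. x < (\<Sum>j\<in>I. p j * W \<omega> j) + p n}"
        by eventually_elim (simp only: mem_Collect_eq sum_n, simp add: w_def[of n])
    qed (use w_meas in measurable)
    also have "\<dots> = emeasure ?N {z \<in> space ?N. x < (\<Sum>j\<in>I. p j * ((\<Sum>l\<in>I. A (fst z) j l * W (snd z) l) + B (fst z) j)) + p n}"
      using pair_law[OF S] unfolding rs .
    also have "\<dots> = emeasure ?N {z \<in> space ?N. x < (\<Sum>j=1..n. p j * (\<Sum>l=1..n. a j l (fst z) * w l (snd z)))}"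
    proof (rule emeasure_eq_AE)
      have 1: "AE z in ?N. \<forall>j\<in>I. \<forall>l\<in>I. a j l (fst z) = A (fst z) j l"
        by (rule AE_pair_fst, rule AE_finite_allI, simp add: I_def, rule AE_finite_allI) (use aA in \<open>auto simp: I_def\<close>)
      have 2: "AE z in ?N. \<forall>l\<in>I. w l (snd z) = W (snd z) l"
        by (rule AE_pair_snd, rule AE_finite_allI) (use wW in \<open>auto simp: I_def\<close>)
      have 3: "AE z in ?N. \<forall>j\<in>I. a j n (fst z) = B (fst z) j"
        by (rule AE_pair_fst, rule AE_finite_allI) (use aB in \<open>auto simp: I_def\<close>)
      from 1 2 3 show "AE z in ?N. z \<in> {z \<in> space ?N. x < (\<Sum>j\<in>I. p j * ((\<Sum>l\<in>I. A (fst z) j l * W (snd z) l) + B (fst z) j)) + p n}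
          \<longleftrightarrow> z \<in> {z \<in> space ?N. x < (\<Sum>j=1..n. p j * (\<Sum>l=1..n. a j l (fst z) * w l (snd z)))}"
      proof eventually_elim
        case (elim z)
        have "(\<Sum>l\<in>I. a n l (fst z) * w l (snd z)) = 0"
          by (rule sum.neutral) (use nI in \<open>auto simp: a_def\<close>)
        then have last: "(\<Sum>l=1..n. a n l (fst z) * w l (snd z)) = 1"
          unfolding sum_n by (simp add: a_def[of n n] w_def[of n])
        have "(\<Sum>l=1..n. a j l (fst z) * w l (snd z)) = (\<Sum>l\<in>I. A (fst z) j l * W (snd z) l) + B (fst z) j" if "j \<in> I" for j
          unfolding sum_n using elim that by (simp add: w_def[of n])
        then have "(\<Sum>j=1..n. p j * (\<Sum>l=1..n. a j l (fst z) * w l (snd z)))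
          = (\<Sum>j\<in>I. p j * ((\<Sum>l\<in>I. A (fst z) j l * W (snd z) l) + B (fst z) j)) + p n"
          unfolding sum_n[of "\<lambda>j. p j * (\<Sum>l=1..n. a j l (fst z) * w l (snd z))"] last by simp
        then show ?case by simp
      qed
    qed (use a_meas w_meas in measurable)
    finally show ?thesis by (simp add: emeasure_eq_measure MM.emeasure_eq_measure)
  qed
  have B_pos: "0 < measure M {\<omega> \<in> space M. 0 < a i n \<omega>}" if i: "i \<in> I" for i
  proof (rule ccontr)
    assume "\<not> ?thesis"
    then have "measure M {\<omega> \<in> space M. 0 < a i n \<omega>} = 0" using measure_nonneg[of M] by (metis order_le_less)
    then have "AE \<omega> in M. \<not> 0 < a i n \<omega>" using a_meas by (subst (asm) prob_eq_0) auto
    with aB[OF i] T1'[OF i] have "AE \<omega> in M. B \<omega> i = 0" by eventually_elim auto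
    then have "measure M {\<omega> \<in> space M. B \<omega> i = 0} = 1" using i by (subst prob_eq_1) auto
    with T2[OF i] show False by simp
  qed
  have upper_a: "a i j \<omega> = 0" if "j < i" for i j \<omega> using that nI by (auto simp: a_def I_def n_def)
  interpret tri: triangular_fixpoint M n a w \<alpha>
  proof unfold_locales
    show "0 \<le> w i \<omega>" for i \<omega> by (simp add: w_def)
    show "w n \<omega> = 1" "a n n \<omega> = 1" for \<omega> by (simp_all add: w_def a_def)
    show "integrable M (\<lambda>\<omega>. a i j \<omega> powr \<alpha> i)" if "i \<in> {1..<n}" "j \<in> {1..n}" for i j
      using that unfolding n_range by (intro mom_a) auto
  qed (use a_meas w_meas a0 upper_a T4(1) crit_a log_a na_a B_pos fix_w in \<open>auto simp only: n_range insert_iff\<close>)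

  \<comment> \<open>After the modification an entry of the block over \<open>I\<close> is nonzero
    somewhere exactly if it lies on or above the diagonal and is positive with positive probability,
    so the pointwise graph is the one of \<open>prec_rel\<close>.\<close>
  have step_I: "tri.step_rel k l \<longleftrightarrow> k \<le> l \<and> prec_rel M A k l" if kl: "k \<in> I" "l \<in> I" for k l
  proof
    assume "tri.step_rel k l"
    then obtain \<omega> where "a k l \<omega> \<noteq> 0" unfolding tri.step_rel_def by auto
    then show "k \<le> l \<and> prec_rel M A k l" using kl nI by (auto simp: a_def split: if_splits)
  next
    assume r: "k \<le> l \<and> prec_rel M A k l"
    then have "0 < measure M {\<omega> \<in> space M. 0 < A \<omega> k l}" by (simp add: prec_rel_def rv_positive_def)
    then have "{\<omega> \<in> space M. 0 < A \<omega> k l} \<noteq> {}" by (metis measure_empty less_irrefl)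
    then obtain \<omega> where "0 < A \<omega> k l" by auto
    then have "a k l \<omega> \<noteq> 0" using r kl nI by (auto simp: a_def)
    then show "tri.step_rel k l" using kl unfolding tri.step_rel_def n_range by auto
  qed
  have step_pos: "0 < measure M {\<omega> \<in> space M. 0 < a k l \<omega>}" if st: "tri.step_rel k l" for k l
  proof -
    obtain \<omega> where w: "a k l \<omega> \<noteq> 0" using st unfolding tri.step_rel_def by auto
    consider "k = n" "l = n" | "k \<in> I" "l = n" | "k \<in> I" "l \<in> I" "k \<le> l" "prec_rel M A k l"
      using w by (auto simp: a_def split: if_splits)
    then show ?thesis
    proof cases
      case 1 then show ?thesis by (simp add: a_def prob_space)
    next
      case 2 then show ?thesis using B_pos by simp
    next
      case 3
      then have "{\<omega> \<in> space M. 0 < a k l \<omega>} = {\<omega> \<in> space M. 0 < A \<omega> k l}" using nI by (auto simp: a_def)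
      then show ?thesis using 3 by (simp add: prec_rel_def rv_positive_def)
    qed
  qed
  have tri_step: "tri.step_rel\<^sup>*\<^sup>* i j" if ij: "i \<in> I" "j \<in> I" and t: "tri_rel M A i j" for i j
  proof -
    obtain m f where f: "f 0 = i" "f m = j" "\<And>k. k < m \<Longrightarrow> f k \<le> f (Suc k) \<and> prec_rel M A (f k) (f (Suc k))"
      using t unfolding tri_rel_def by blast
    \<comment> \<open>\<open>tri_rel\<close> does not confine the intermediate indices to
      \<open>{1..d}\<close>; they stay there because the path increases from \<open>i\<close> to
      \<open>j\<close>.\<close>
    have lo: "i \<le> f k" if "k \<le> m" for k
      using that
    proof (induction k)
      case (Suc k) then show ?case using f(3)[of k] by auto
    qed (simp add: f)
    have hi: "f k \<le> j" if "k \<le> m" for k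
      using that
    proof (induction rule: inc_induct)
      case (step k) then show ?case using f(3)[of k] by auto
    qed (simp add: f)
    have fI: "f k \<in> I" if "k \<le> m" for k using lo[OF that] hi[OF that] ij by (auto simp: I_def)
    have "tri.step_rel\<^sup>*\<^sup>* i (f k)" if "k \<le> m" for k
      using that
    proof (induction k)
      case (Suc k)
      then have "tri.step_rel (f k) (f (Suc k))" using f(3)[of k] fI[of k] fI[of "Suc k"] step_I by auto
      then show ?case using Suc by (auto intro: rtranclp.rtrancl_into_rtrancl)
    qed (simp add: f)
    then show ?thesis using f(2) by auto
  qed
  \<comment> \<open>A path may enter the added index \<open>n\<close> but never leaves it, since row
    \<open>n\<close> is zero off the diagonal. Hence a path that ends in \<open>I\<close> has stayed
    in \<open>I\<close>.\<close>
  have step_tri: "j \<in> I \<longrightarrow> tri_rel M A i j" if i: "i \<in> I" and t: "tri.step_rel\<^sup>*\<^sup>* i j" for i j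
    using t
  proof (induction rule: rtranclp_induct)
    case base
    show ?case unfolding tri_rel_def by (intro impI exI[of _ 0] exI[of _ "\<lambda>_. i"]) auto
  next
    case (step y z)
    show ?case
    proof
      assume z: "z \<in> I"
      obtain \<omega> where "a y z \<omega> \<noteq> 0" using step(2) unfolding tri.step_rel_def by auto
      then have y: "y \<in> I" using z nI by (auto simp: a_def split: if_splits)
      then obtain m f where f: "f 0 = i" "f m = y" "\<And>k. k < m \<Longrightarrow> f k \<le> f (Suc k) \<and> prec_rel M A (f k) (f (Suc k))"
        using step.IH unfolding tri_rel_def by blast
      have yz: "y \<le> z \<and> prec_rel M A y z" using step(2) step_I[OF y z] by simp
      show "tri_rel M A i z" unfolding tri_rel_def
      proof (intro exI[of _ "Suc m"] exI[of _ "f(Suc m := z)"] conjI allI impI)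
        fix k assume "k < Suc m"
        then have "k < m \<or> k = m" by auto
        then show "(f(Suc m := z)) k \<le> (f(Suc m := z)) (Suc k)" "prec_rel M A ((f(Suc m := z)) k) ((f(Suc m := z)) (Suc k))"
          using f yz by auto
      qed (use f in auto)
    qed
  qed
  have "\<exists>c>0. ((\<lambda>x. x powr (Min {\<alpha> j | j. j \<in> {1..d} \<and> tri_rel M A i j}) * measure M {\<omega> \<in> space M. W \<omega> i > x}) \<longlongrightarrow> c) at_top"
    if i: "i \<in> {1..d}" for i
  proof -
    have iI: "i \<in> I" using i by (simp add: I_def)
    define Q where "Q = {\<alpha> j | j. j \<in> {1..d} \<and> tri_rel M A i j}"
    have Qf: "finite Q" by (rule finite_subset[of _ "\<alpha> ` {1..d}"]) (auto simp: Q_def)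
    have "\<alpha> i \<in> Q" unfolding Q_def using i step_tri[OF iI rtranclp.rtrancl_refl] iI by auto
    then have "Min Q \<in> Q" using Qf by (intro Min_in) auto
    then obtain j0 where j0: "j0 \<in> I" "tri_rel M A i j0" "Min Q = \<alpha> j0" unfolding Q_def I_def by auto
    have "\<exists>c>0. ((\<lambda>x. x powr \<alpha> j0 * measure M {\<omega> \<in> space M. x < w i \<omega>}) \<longlongrightarrow> c) at_top"
    proof (rule tri.tail_asymptotics[OF _ _ tri_step[OF iI j0(1,2)] _ step_pos])
      fix j assume "j \<in> {1..<n}" "tri.step_rel\<^sup>*\<^sup>* i j" "j \<noteq> j0"
      then have j: "j \<in> I" "tri_rel M A i j" "j \<noteq> j0" using step_tri[OF iI] unfolding n_range by auto
      then have "\<alpha> j \<in> Q" by (auto simp: Q_def I_def)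
      then have "\<alpha> j0 \<le> \<alpha> j" unfolding j0(3)[symmetric] using Qf by (intro Min_le)
      \<comment> \<open>Distinct exponents make the minimiser unique.\<close>
      moreover have "\<alpha> j0 \<noteq> \<alpha> j" using inj j j0 by (auto dest: inj_onD)
      ultimately show "\<alpha> j0 < \<alpha> j" by simp
    qed (use iI j0 in \<open>auto simp only: n_range\<close>)
    moreover have "measure M {\<omega> \<in> space M. x < w i \<omega>} = measure M {\<omega> \<in> space M. W \<omega> i > x}" for x
    proof -
      have "emeasure M {\<omega> \<in> space M. x < w i \<omega>} = emeasure M {\<omega> \<in> space M. x < W \<omega> i}"
        using wW[OF iI] w_meas iI by (intro emeasure_eq_AE) (auto elim: eventually_mono)
      then show ?thesis by (simp add: emeasure_eq_measure)
    qed
    ultimately show ?thesis unfolding Q_def[symmetric] j0(3) by simp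
  qed
  then have "\<forall>i\<in>{1..d}. \<exists>c. c > 0 \<and> ((\<lambda>x. x powr (Min {\<alpha> j | j. j \<in> {1..d} \<and> tri_rel M A i j}) * measure M {\<omega> \<in> space M. W \<omega> i > x}) \<longlongrightarrow> c) at_top"
    by blast
  from bchoice[OF this] show ?thesis .
qed

end
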